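(* Let $K$ be a number field with ring of algebraic integers $\mathcal{O}_K$. Suppose $\varphi\in K[z]$ is a powerful polynomial over $K$ with $\deg\varphi\geqslant3$, and let $0$ be a wandering point of $\varphi$. For each $n\geqslant1$, write the ideal $(\varphi^n(0))\mathcal{O}_K=\mathfrak{A}_n\mathfrak{B}_n^{-1}$ as a quotient of relatively prime integral ideals. Then the sequence $\{\mathfrak{A}_n\}_{n\geqslant1}$ is an $S$-rigid divisibility sequence for some $S$, and the Zsigmondy set $\mathcal{Z}(\{\mathfrak{A}_n\}_{n\geqslant1})$ is finite. In particular, if $\varphi(z)=f_1(z)^{e_1}f_2(z)^{e_2}\cdots f_m(z)^{e_m}$, where $f_i(z)\in\mathcal{O}_K[z]$, $\deg f_i\geqslant1$ (the $f_i$ not necessarily pairwise distinct) and $e_i\geqslant2$ are integers for $1\leqslant i\leqslant m$, then one can take $S=M_K^\infty$, the set of archimedean places of $K$.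
   Context: $\varphi^n$ denotes the $n$-th iterate of $\varphi$. A point is a wandering point of $\varphi$ if its forward orbit under $\varphi$ is infinite. A polynomial $\varphi(z)\in K[z]$ is called powerful over $K$ if $\deg\varphi\geqslant2$ and $p(z)^2$ divides $\varphi(z)$ for every irreducible factor $p(z)$ of $\varphi(z)$ in $K[z]$. For a sequence $\mathcal{A}=\{\mathfrak{A}_n\}_{n\geqslant1}$ of nonzero integral ideals of $K$, a prime ideal $\mathfrak{p}$ is a primitive divisor of $\mathfrak{A}_n$ if $\mathfrak{p}\mid\mathfrak{A}_n$ and $\mathfrak{p}\nmid\mathfrak{A}_i$ for all $1\leqslant i<n$. The Zsigmondy set is $\mathcal{Z}(\mathcal{A})=\{n\geqslant1 : \mathfrak{A}_n \text{ does not have a primitive divisor}\}$. Let $S$ be a finite set of places of $K$ including all archimedean ones. A sequence $\{\mathfrak{a}_n\}_{n\geqslant1}$ of integral ideals of $\mathcal{O}_K$ is an $S$-rigid divisibility sequence if: (1) for every prime ideal $\mathfrak{p}\notin S$ and all $m,n\geqslant 1$, if $\mathfrak{p}\mid\gcd(\mathfrak{a}_n,\mathfrak{a}_m)$ then $\mathfrak{p}\mid\mathfrak{a}_{\gcd(m,n)}$; (2) for every prime ideal $\mathfrak{p}\notin S$ and every $m\geqslant 1$ with $\operatorname{ord}_{\mathfrak{p}}(\mathfrak{a}_m)>0$, we have $\operatorname{ord}_{\mathfrak{p}}(\mathfrak{a}_{km})=\operatorname{ord}_{\mathfrak{p}}(\mathfrak{a}_m)$ for all $k\geqslant1$. *)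

theory Defs
  imports
    "HOL-Algebra.Algebraic_Closure_Type"
    "HOL-Algebra.Ideal_Product"
    "HOL-Algebra.Divisibility"
    "HOL-Library.Extended_Nat"
    "HOL-Computational_Algebra.Computational_Algebra"
begin

definition number_field :: "'a::field_char_0 itself \<Rightarrow> bool" where
  "number_field _ \<longleftrightarrow>
     (\<exists>B. finite_dimensional_vector_space (\<lambda>(q::rat) (x::'a). of_rat q * x) B)"

text \<open>The ring of integers of the number field given by the whole type.\<close>

definition OK :: "'a::field_char_0 ring" where
  "OK = ring_of_type_algebra\<lparr>carrier := {x. algebraic_int x}\<rparr>"

definition nonzero_prime_ideal :: "'a::field_char_0 set \<Rightarrow> bool" where
  "nonzero_prime_ideal P \<longleftrightarrow> primeideal P OK \<and> P \<noteq> {0}"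

abbreviation ideal_divides :: "'a::field_char_0 set \<Rightarrow> 'a set \<Rightarrow> bool" where
  "ideal_divides I J \<equiv> I divides\<^bsub>ideals_set OK\<^esub> J"

text \<open>The order of a nonzero ideal at \<open>P\<close> is finite; the order of the zero ideal is \<open>\<infinity>\<close>.\<close>

definition ideal_ord :: "'a::field_char_0 set \<Rightarrow> 'a set \<Rightarrow> enat" where
  "ideal_ord P I = Sup {enat k | k. ideal_divides (P [^]\<^bsub>ideals_set OK\<^esub> k) I}"

definition principal_fractional_ideal :: "'a::field_char_0 \<Rightarrow> 'a set" where
  "principal_fractional_ideal x = {x * a | a. a \<in> carrier OK}"

definition inverse_ideal :: "'a::field_char_0 set \<Rightarrow> 'a set" where
  "inverse_ideal J = {y. \<forall>b\<in>J. y * b \<in> carrier OK}"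

text \<open>\<open>A\<close> and \<open>B\<close> are the numerator and the denominator of the fractional ideal of \<open>x\<close>. The
  factor \<open>inverse_ideal B\<close> need not lie in the ring of integers, so the product is formed in the
  ambient field.\<close>

definition ideal_quotient :: "'a::field_char_0 \<Rightarrow> 'a set \<Rightarrow> 'a set \<Rightarrow> bool" where
  "ideal_quotient x A B \<longleftrightarrow>
     ideal A OK \<and> ideal B OK \<and> B \<noteq> {0} \<and>
     A <+>\<^bsub>OK\<^esub> B = carrier OK \<and>
     principal_fractional_ideal x = ideal_prod ring_of_type_algebra A (inverse_ideal B)"

definition absolute_value :: "('a::field \<Rightarrow> real) \<Rightarrow> bool" where
  "absolute_value v \<longleftrightarrow>
     (\<forall>x. v x \<ge> 0) \<and> (\<forall>x. v x = 0 \<longleftrightarrow> x = 0) \<and>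
     (\<forall>x y. v (x * y) = v x * v y) \<and> (\<forall>x y. v (x + y) \<le> v x + v y)"

definition nontrivial_absolute_values :: "('a::field \<Rightarrow> real) set" where
  "nontrivial_absolute_values = {v. absolute_value v \<and> (\<exists>x. x \<noteq> 0 \<and> v x \<noteq> 1)}"

definition absolute_value_equiv :: "(('a::field \<Rightarrow> real) \<times> ('a \<Rightarrow> real)) set" where
  "absolute_value_equiv =
     {(v, w). v \<in> nontrivial_absolute_values \<and> w \<in> nontrivial_absolute_values \<and>
              (\<exists>s>0. \<forall>x. w x = v x powr s)}"

definition places :: "('a::field_char_0 \<Rightarrow> real) set set" where
  "places = nontrivial_absolute_values // absolute_value_equiv"

definition nonarchimedean :: "('a::field \<Rightarrow> real) \<Rightarrow> bool" where
  "nonarchimedean v \<longleftrightarrow> (\<forall>x y. v (x + y) \<le> max (v x) (v y))"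

definition arch_places :: "('a::field_char_0 \<Rightarrow> real) set set" where
  "arch_places = {\<pi> \<in> places. \<forall>v\<in>\<pi>. \<not> nonarchimedean v}"

text \<open>A nonzero prime ideal is identified with the nonarchimedean place whose valuation ideal,
  intersected with the ring of integers, it is. For archimedean places \<open>prime_of_place\<close> has no
  meaning and is not used.\<close>

definition prime_of_place :: "('a::field_char_0 \<Rightarrow> real) set \<Rightarrow> 'a set" where
  "prime_of_place \<pi> = {x \<in> carrier OK. \<forall>v\<in>\<pi>. v x < 1}"

definition prime_in_places :: "'a::field_char_0 set \<Rightarrow> ('a \<Rightarrow> real) set set \<Rightarrow> bool" where
  "prime_in_places P S \<longleftrightarrow> (\<exists>\<pi>\<in>S. \<pi> \<notin> arch_places \<and> prime_of_place \<pi> = P)"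

text \<open>Sequences are indexed by the positive integers; the value at \<open>0\<close> is never used.
  The gcd of two ideals is their sum.\<close>

definition rigid_divisibility_sequence ::
    "('a::field_char_0 \<Rightarrow> real) set set \<Rightarrow> (nat \<Rightarrow> 'a set) \<Rightarrow> bool" where
  "rigid_divisibility_sequence S \<aa> \<longleftrightarrow>
     finite S \<and> S \<subseteq> places \<and> arch_places \<subseteq> S \<and>
     (\<forall>n\<ge>1. ideal (\<aa> n) OK) \<and>
     (\<forall>P m n. nonzero_prime_ideal P \<and> \<not> prime_in_places P S \<and> m \<ge> 1 \<and> n \<ge> 1 \<and>
        ideal_divides P (\<aa> n <+>\<^bsub>OK\<^esub> \<aa> m) \<longrightarrow> ideal_divides P (\<aa> (gcd m n))) \<and>
     (\<forall>P m. nonzero_prime_ideal P \<and> \<not> prime_in_places P S \<and> m \<ge> 1 \<and>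
        ideal_ord P (\<aa> m) > 0 \<longrightarrow>
        (\<forall>k\<ge>1. ideal_ord P (\<aa> (k * m)) = ideal_ord P (\<aa> m)))"

definition primitive_divisor :: "(nat \<Rightarrow> 'a::field_char_0 set) \<Rightarrow> nat \<Rightarrow> 'a set \<Rightarrow> bool" where
  "primitive_divisor \<aa> n P \<longleftrightarrow>
     nonzero_prime_ideal P \<and> ideal_divides P (\<aa> n) \<and>
     (\<forall>i. 1 \<le> i \<and> i < n \<longrightarrow> \<not> ideal_divides P (\<aa> i))"

definition zsigmondy_set :: "(nat \<Rightarrow> 'a::field_char_0 set) \<Rightarrow> nat set" where
  "zsigmondy_set \<aa> = {n. n \<ge> 1 \<and> \<not> (\<exists>P. primitive_divisor \<aa> n P)}"

definition wandering :: "'a::field poly \<Rightarrow> 'a \<Rightarrow> bool" where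
  "wandering \<phi> x \<longleftrightarrow> infinite (range (\<lambda>n. (poly \<phi> ^^ n) x))"

definition powerful :: "'a::field poly \<Rightarrow> bool" where
  "powerful \<phi> \<longleftrightarrow>
     degree \<phi> \<ge> 2 \<and> (\<forall>p. Factorial_Ring.irreducible p \<and> p dvd \<phi> \<longrightarrow> p\<^sup>2 dvd \<phi>)"

end

theory Submission
  imports
    Defs
    "Jordan_Normal_Form.Char_Poly"
    "HOL-Computational_Algebra.Fundamental_Theorem_Algebra"
begin

text \<open>
  Write \<open>x\<^sub>n\<close> for the \<open>n\<close>-th iterate of \<open>\<phi>\<close> at \<open>0\<close>. A powerful polynomial divides the square of its
  derivative, \<open>\<phi>'\<^sup>2 = \<phi> H\<close> (\<open>dvd_pderiv_square\<close>), and this identity carries the whole proof: where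
  \<open>\<phi>\<close> takes a value of absolute value \<open>\<epsilon>\<close>, its derivative is at most of the order of the square root of \<open>\<epsilon>\<close>.
  Hence, if \<open>x\<^sub>n\<close> is close to \<open>0\<close>, the \<open>n\<close>-th iterate contracts a neighbourhood of \<open>0\<close> so strongly that all
  \<open>x\<^sub>k\<^sub>n\<close> are closer to \<open>x\<^sub>n\<close> than \<open>x\<^sub>n\<close> is to \<open>0\<close>. This is used at all places.

  At a prime \<open>P\<close> where \<open>\<phi>\<close> and \<open>H\<close> are integral, every \<open>x\<^sub>m\<close> in \<open>P\<close> is close enough, and the conclusion is that
  \<open>x\<^sub>k\<^sub>m\<close> and \<open>x\<^sub>m\<close> have the same order (\<open>orb_rigid\<close>). The set of \<open>n\<close> with \<open>x\<^sub>n\<close> in \<open>P\<close> is closed under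
  sums and differences because \<open>\<phi>\<close> acts on residues (\<open>orb_less_1_gcd\<close>). Together this is rigid divisibility
  outside the primes dividing a common denominator \<open>D\<close> of \<open>\<phi>\<close> and \<open>H\<close>; if \<open>\<phi>\<close> is a product of powers of
  polynomials with integral coefficients, then \<open>H\<close> is integral too and no prime has to be excluded.

  At an arbitrary absolute value, archimedean or not, \<open>x\<^sub>n\<close> may still be small, but not smaller than \<open>c\<^sup>n\<close>
  for some \<open>c > 0\<close> (\<open>orbit_lower_bound\<close>): if \<open>x\<^sub>n\<close> and \<open>x\<^sub>m\<close> are both smaller, then \<open>x\<^sub>n\<^sub>m\<close> is comparable with
  each of them, so all such \<open>x\<^sub>n\<close> have comparable size. This elementary bound takes the place of an appeal
  to Roth's theorem.

  Now let \<open>n\<close> be in the Zsigmondy set. Away from \<open>D\<close>, rigidity shows that \<open>x\<^sub>n\<close> divides the product of the \<open>x\<^sub>j\<close>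
  with \<open>j \<le> n div 2\<close>, because every prime of the numerator of \<open>x\<^sub>n\<close> already divides \<open>x\<^sub>g\<close> to the same order for a proper
  divisor \<open>g\<close> of \<open>n\<close>. So the quotient \<open>u\<close> of this product by \<open>x\<^sub>n\<close> is integral away from \<open>D\<close>. Consider the finite
  set of absolute values that come from complex embeddings and from the primes containing \<open>D\<close>. Each of
  them is at most \<open>exp (O (n d^(n div 2)))\<close> at \<open>u\<close>, where \<open>d\<close> is the degree, so each is also at least
  \<open>exp (- O (n d^(n div 2)))\<close>, a consequence of the product formula (\<open>integral_away_from_lower_bound\<close>). On the
  other hand the orbit is infinite, so by a Northcott argument it is unbounded at one of these absolute
  values, where \<open>x\<^sub>n\<close> then grows like \<open>exp (c d\<^sup>n)\<close> (\<open>exists_escaping_abs_val\<close>) and \<open>u\<close> is correspondingly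
  small. For large \<open>n\<close> the two estimates contradict each other.

  The arithmetic that this needs is built from the finiteness of the residue rings modulo integers, which
  gives a discrete valuation for every nonzero prime, and from the extension of embeddings to the
  complex numbers. Finiteness of the set of archimedean places is proved by weak approximation.
\<close>

section \<open>Orbits under an absolute value\<close>

locale abs_val =
  fixes v :: "'a::field \<Rightarrow> real"
  assumes absolute_value: "absolute_value v"
begin

lemma nonneg [simp]: "v x \<ge> 0"
  and eq_0_iff [simp]: "v x = 0 \<longleftrightarrow> x = 0"
  and mult: "v (x * y) = v x * v y"
  and triangle: "v (x + y) \<le> v x + v y"
  using absolute_value unfolding absolute_value_def by blast+

lemma zero [simp]: "v 0 = 0"
  by simp

lemma pos_iff [simp]: "v x > 0 \<longleftrightarrow> x \<noteq> 0"
  using nonneg[of x] eq_0_iff[of x] by linarith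

lemma one [simp]: "v 1 = 1"
  using mult[of 1 1] eq_0_iff[of 1] by simp

lemma minus_one [simp]: "v (- 1) = 1"
proof -
  have "v (- 1) ^ 2 = 1"
    using mult[of "-1" "-1"] by (simp add: power2_eq_square)
  then show ?thesis
    using nonneg[of "-1"] by (smt (verit) power2_eq_1_iff)
qed

lemma minus [simp]: "v (- x) = v x"
  using mult[of "-1" x] by simp

lemma triangle_diff: "v (x - y) \<le> v x + v y"
  using triangle[of x "- y"] by simp

lemma triangle_rev: "v x - v y \<le> v (x + y)"
  using triangle_diff[of "x + y" y] by simp

lemma power: "v (x ^ n) = v x ^ n"
  by (induction n) (auto simp: mult)

lemma inverse: "v (inverse x) = inverse (v x)"
proof (cases "x = 0")
  case False
  then have "v x * v (inverse x) = 1"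
    using mult[of x "inverse x"] by simp
  then show ?thesis
    by (metis inverse_unique)
qed simp

lemma divide: "v (x / y) = v x / v y"
  by (simp add: divide_inverse mult inverse)

lemma prod: "v (prod f A) = (\<Prod>i\<in>A. v (f i))"
  by (induction A rule: infinite_finite_induct) (auto simp: mult)

lemma sum_le: "v (sum f A) \<le> (\<Sum>i\<in>A. v (f i))"
  by (induction A rule: infinite_finite_induct) (auto intro: order_trans[OF triangle] add_left_mono)

lemma of_nat_le: "v (of_nat n) \<le> of_nat n"
  by (induction n) (use triangle[of 1] in \<open>auto intro: order_trans[OF triangle]\<close>)

lemma of_int_abs: "v (of_int k) = v (of_nat (nat \<bar>k\<bar>))"
  by (cases "k \<ge> 0") (auto simp: abs_if)

lemma poly_bounded:
  assumes "R \<ge> 0"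
  shows "\<exists>C\<ge>0. \<forall>x. v x \<le> R \<longrightarrow> v (poly p x) \<le> C"
proof (induction p)
  case (pCons a p)
  then obtain C where C: "C \<ge> 0" "\<And>x. v x \<le> R \<Longrightarrow> v (poly p x) \<le> C"
    by blast
  have "v (poly (pCons a p) x) \<le> v a + R * C" if "v x \<le> R" for x
  proof -
    have "v (poly (pCons a p) x) \<le> v a + v x * v (poly p x)"
      using triangle[of a "x * poly p x"] by (simp add: mult)
    also have "\<dots> \<le> v a + R * C"
      using C that assms by (intro add_left_mono mult_mono) auto
    finally show ?thesis .
  qed
  then show ?case
    using C assms by (intro exI[of _ "v a + R * C"]) auto
qed auto

text \<open>
  The Taylor remainder of order two satisfies a recursion along the coefficients, so that it can be
  estimated by induction over any field, with the same proof for real and for ultrametric bounds.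
\<close>

lemma poly_taylor_aux:
  fixes x y a :: 'a
  shows "poly (pCons a p) x - poly (pCons a p) y - (x - y) * poly (pderiv (pCons a p)) y
    = x * (poly p x - poly p y - (x - y) * poly (pderiv p) y) + (x - y) ^ 2 * poly (pderiv p) y"
  by (simp add: pderiv_pCons algebra_simps power2_eq_square)

lemma poly_taylor:
  assumes "R \<ge> 0"
  shows "\<exists>C\<ge>0. \<forall>x y. v x \<le> R \<longrightarrow> v y \<le> R \<longrightarrow>
           v (poly p x - poly p y - (x - y) * poly (pderiv p) y) \<le> C * v (x - y) ^ 2"
proof (induction p)
  case (pCons a p)
  then obtain C where C: "C \<ge> 0" "\<And>x y. v x \<le> R \<Longrightarrow> v y \<le> R \<Longrightarrow>
           v (poly p x - poly p y - (x - y) * poly (pderiv p) y) \<le> C * v (x - y) ^ 2"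
    by blast
  obtain D where D: "D \<ge> 0" "\<And>x. v x \<le> R \<Longrightarrow> v (poly (pderiv p) x) \<le> D"
    using poly_bounded[OF assms] by blast
  have "v (poly (pCons a p) x - poly (pCons a p) y - (x - y) * poly (pderiv (pCons a p)) y)
         \<le> (R * C + D) * v (x - y) ^ 2" if "v x \<le> R" "v y \<le> R" for x y
  proof -
    have "v (poly (pCons a p) x - poly (pCons a p) y - (x - y) * poly (pderiv (pCons a p)) y)
      \<le> v x * v (poly p x - poly p y - (x - y) * poly (pderiv p) y) + v (x - y) ^ 2 * v (poly (pderiv p) y)"
      unfolding poly_taylor_aux by (rule order_trans[OF triangle]) (simp add: mult power)
    also have "\<dots> \<le> R * (C * v (x - y) ^ 2) + v (x - y) ^ 2 * D"
      using C D that assms by (intro add_mono mult_mono) auto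
    finally show ?thesis
      by (simp add: algebra_simps)
  qed
  then show ?case
    using C D assms by (intro exI[of _ "R * C + D"]) auto
qed auto

lemma poly_lipschitz:
  assumes "R \<ge> 0"
  shows "\<exists>L\<ge>1. \<forall>x y. v x \<le> R \<longrightarrow> v y \<le> R \<longrightarrow> v (poly p x - poly p y) \<le> L * v (x - y)"
proof -
  obtain C where C: "C \<ge> 0" "\<And>x y. v x \<le> R \<Longrightarrow> v y \<le> R \<Longrightarrow>
           v (poly p x - poly p y - (x - y) * poly (pderiv p) y) \<le> C * v (x - y) ^ 2"
    using poly_taylor[OF assms] by blast
  obtain D where D: "D \<ge> 0" "\<And>x. v x \<le> R \<Longrightarrow> v (poly (pderiv p) x) \<le> D"
    using poly_bounded[OF assms] by blast
  have "v (poly p x - poly p y) \<le> (C * (2 * R) + D + 1) * v (x - y)" if "v x \<le> R" "v y \<le> R" for x y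
  proof -
    have *: "v (x - y) \<le> 2 * R"
      using triangle_diff[of x y] that by simp
    have "v (poly p x - poly p y)
      \<le> v (poly p x - poly p y - (x - y) * poly (pderiv p) y) + v ((x - y) * poly (pderiv p) y)"
      using triangle[of "poly p x - poly p y - (x - y) * poly (pderiv p) y" "(x - y) * poly (pderiv p) y"]
      by simp
    also have "\<dots> \<le> C * (v (x - y) * v (x - y)) + v (x - y) * D"
      using C(2)[OF that] D(2)[OF that(2)]
      by (intro add_mono) (auto simp: mult power2_eq_square intro: mult_left_mono)
    also have "\<dots> \<le> C * ((2 * R) * v (x - y)) + v (x - y) * D"
      using * C by (intro add_right_mono mult_left_mono mult_right_mono) auto
    also have "\<dots> \<le> (C * (2 * R) + D + 1) * v (x - y)"
      by (simp add: algebra_simps)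
    finally show ?thesis .
  qed
  then show ?thesis
    using C D assms by (intro exI[of _ "C * (2 * R) + D + 1"]) auto
qed

lemma poly_upper:
  shows "\<exists>A\<ge>1. \<forall>x. max 1 (v (poly p x)) \<le> A * max 1 (v x) ^ degree p"
proof (intro exI conjI allI)
  let ?A = "1 + (\<Sum>i\<le>degree p. v (coeff p i))"
  show "?A \<ge> 1"
    by (simp add: sum_nonneg)
  fix x
  let ?m = "max 1 (v x)"
  have "v (poly p x) \<le> (\<Sum>i\<le>degree p. v (coeff p i) * v x ^ i)"
    unfolding poly_altdef by (rule order_trans[OF sum_le]) (simp add: mult power)
  also have "\<dots> \<le> (\<Sum>i\<le>degree p. v (coeff p i) * ?m ^ degree p)"
  proof (intro sum_mono mult_left_mono)
    fix i assume "i \<in> {..degree p}"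
    then have "v x ^ i \<le> ?m ^ i" "?m ^ i \<le> ?m ^ degree p"
      by (auto intro: power_mono power_increasing)
    then show "v x ^ i \<le> ?m ^ degree p"
      by linarith
  qed auto
  also have "\<dots> = (\<Sum>i\<le>degree p. v (coeff p i)) * ?m ^ degree p"
    by (simp add: sum_distrib_right)
  finally have 1: "v (poly p x) \<le> (\<Sum>i\<le>degree p. v (coeff p i)) * ?m ^ degree p" .
  have 2: "1 \<le> ?m ^ degree p"
    by simp
  show "max 1 (v (poly p x)) \<le> ?A * ?m ^ degree p"
  proof -
    have "0 \<le> (\<Sum>i\<le>degree p. v (coeff p i)) * ?m ^ degree p"
      by (intro mult_nonneg_nonneg sum_nonneg) auto
    then show ?thesis
      using 1 2 by (simp only: distrib_right mult_1)
  qed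
qed

text \<open>
  Far from the origin the leading term dominates. The last conjunct makes \<open>ln (v x) - a\<close> at least \<open>a\<close>, so
  that this quantity is multiplied by at least the degree at each step of an orbit.
\<close>

lemma poly_escape:
  assumes "degree p \<ge> 2"
  shows "\<exists>a>0. \<exists>R\<ge>1. \<forall>x. v x \<ge> R \<longrightarrow>
           v x < v (poly p x) \<and> ln (v (poly p x)) \<ge> degree p * ln (v x) - a \<and> ln (v x) \<ge> 2 * a"
proof -
  define d where "d = degree p"
  define l where "l = v (lead_coeff p)"
  define s where "s = (\<Sum>i<d. v (coeff p i))"
  have "p \<noteq> 0"
    using assms by auto
  then have l: "l > 0"
    by (simp add: l_def)
  have s: "s \<ge> 0"
    by (simp add: s_def sum_nonneg)
  define a where "a = \<bar>ln (l / 2)\<bar> + 1"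
  have a: "a > 0"
    by (simp add: a_def)
  define R where "R = max (max 1 (2 * s / l)) (exp (2 * a))"
  have *: "v x < v (poly p x) \<and> ln (v (poly p x)) \<ge> d * ln (v x) - a \<and> ln (v x) \<ge> 2 * a"
    if x: "v x \<ge> R" for x
  proof -
    have x1: "v x \<ge> 1" "2 * s / l \<le> v x" "exp (2 * a) \<le> v x"
      using x by (auto simp: R_def)
    have lnx: "ln (v x) \<ge> 2 * a"
      using x1 by (metis ln_exp ln_le_cancel_iff exp_gt_zero order_less_le_trans)
    have d: "d \<ge> 2"
      using assms by (simp add: d_def)
    have split: "poly p x = lead_coeff p * x ^ d + (\<Sum>i<d. coeff p i * x ^ i)"
      unfolding poly_altdef d_def by (simp add: lessThan_Suc_atMost[symmetric])
    have "v (\<Sum>i<d. coeff p i * x ^ i) \<le> (\<Sum>i<d. v (coeff p i) * v x ^ i)"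
      by (rule order_trans[OF sum_le]) (simp add: mult power)
    also have "\<dots> \<le> (\<Sum>i<d. v (coeff p i) * v x ^ (d - 1))"
      using x1 by (intro sum_mono mult_left_mono power_increasing) auto
    also have "\<dots> = s * v x ^ (d - 1)"
      by (simp add: s_def sum_distrib_right)
    also have "\<dots> \<le> (l / 2 * v x) * v x ^ (d - 1)"
      using x1 l by (intro mult_right_mono) (auto simp: field_simps)
    also have "\<dots> = l / 2 * v x ^ d"
      using d by (cases d) auto
    finally have "v (\<Sum>i<d. coeff p i * x ^ i) \<le> l / 2 * v x ^ d" .
    moreover have "v (poly p x) \<ge> l * v x ^ d - v (\<Sum>i<d. coeff p i * x ^ i)"
      unfolding split using triangle_rev[of "lead_coeff p * x ^ d" "\<Sum>i<d. coeff p i * x ^ i"]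
      by (simp add: mult power l_def)
    ultimately have "v (poly p x) \<ge> l * v x ^ d - l / 2 * v x ^ d"
      by linarith
    then have ge: "v (poly p x) \<ge> l / 2 * v x ^ d"
      by linarith
    have pos: "l / 2 * v x ^ d > 0"
      using l x1 by (intro mult_pos_pos zero_less_power) auto
    have "ln (v (poly p x)) \<ge> ln (l / 2 * v x ^ d)"
      using ge pos by (simp add: ln_mono)
    also have "ln (l / 2 * v x ^ d) = ln (l / 2) + d * ln (v x)"
    proof -
      have "ln (l / 2 * v x ^ d) = ln (l / 2) + ln (v x ^ d)"
        using l x1 by (intro ln_mult_pos zero_less_power) linarith+
      then show ?thesis
        using x1 by (simp add: ln_realpow)
    qed
    finally have ln1: "ln (v (poly p x)) \<ge> d * ln (v x) - a"
      unfolding a_def by linarith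
    have "real d * ln (v x) \<ge> 2 * ln (v x)"
      using d lnx a by (intro mult_right_mono) auto
    then have "ln (v (poly p x)) > ln (v x)"
      using ln1 lnx a by linarith
    then have "v x < v (poly p x)"
      using ge pos x1 by (subst (asm) ln_less_cancel_iff) linarith+
    then show ?thesis
      using ln1 lnx by simp
  qed
  then show ?thesis
    using a unfolding d_def by (intro exI[of _ a] exI[of _ R] conjI allI impI) (auto simp: R_def)
qed

end

abbreviation orb :: "'a::comm_semiring_0 poly \<Rightarrow> nat \<Rightarrow> 'a" where
  "orb \<phi> n \<equiv> (poly \<phi> ^^ n) 0"

lemma orb_add: "orb \<phi> (m + n) = (poly \<phi> ^^ m) (orb \<phi> n)"
  by (simp add: funpow_add)

context abs_val
begin

text \<open>
  With the constant \<open>A\<close> of \<open>poly_upper\<close>, the quantity \<open>A max(1, v x)\<close> is at most raised to the power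
  \<open>degree \<phi>\<close> by one application of \<open>\<phi>\<close>.
\<close>

lemma orbit_upper_bound:
  assumes "degree \<phi> \<ge> 2"
  shows "\<exists>C\<ge>0. \<forall>n. v (orb \<phi> n) \<le> exp (C * real (degree \<phi>) ^ n)"
proof -
  obtain A where A: "A \<ge> 1" "\<And>x. max 1 (v (poly \<phi> x)) \<le> A * max 1 (v x) ^ degree \<phi>"
    using poly_upper by blast
  have *: "A * max 1 (v (orb \<phi> n)) \<le> A ^ (degree \<phi> ^ n)" for n
  proof (induction n)
    case (Suc n)
    let ?m = "max 1 (v (orb \<phi> n))"
    have "A * max 1 (v (orb \<phi> (Suc n))) \<le> A * (A * ?m ^ degree \<phi>)"
      using A(2)[of "orb \<phi> n"] A(1) by (intro mult_left_mono) auto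
    also have "\<dots> = A ^ 2 * ?m ^ degree \<phi>"
      by (simp add: power2_eq_square)
    also have "\<dots> \<le> A ^ degree \<phi> * ?m ^ degree \<phi>"
      using A(1) assms by (intro mult_right_mono power_increasing) auto
    also have "\<dots> = (A * ?m) ^ degree \<phi>"
      by (simp add: power_mult_distrib)
    also have "\<dots> \<le> (A ^ (degree \<phi> ^ n)) ^ degree \<phi>"
      using A(1) by (intro power_mono Suc) auto
    finally show ?case
      by (simp add: power_mult[symmetric] mult.commute)
  qed (use A in auto)
  have "v (orb \<phi> n) \<le> exp (ln A * real (degree \<phi>) ^ n)" for n
  proof -
    have "v (orb \<phi> n) \<le> A * max 1 (v (orb \<phi> n))"
      using A(1) mult_mono[of 1 A "v (orb \<phi> n)" "max 1 (v (orb \<phi> n))"] by simp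
    also have "\<dots> \<le> A ^ (degree \<phi> ^ n)"
      by (rule *)
    also have "\<dots> = exp (ln A * real (degree \<phi>) ^ n)"
      using A(1) exp_of_nat_mult[of "degree \<phi> ^ n" "ln A"] by (simp add: mult.commute)
    finally show ?thesis .
  qed
  then show ?thesis
    using A(1) by (intro exI[of _ "ln A"]) auto
qed

text \<open>
  One visit to the region of \<open>poly_escape\<close> is enough: from then on the logarithm grows by a factor of at
  least the degree.
\<close>

lemma orbit_bounded_or_escapes:
  assumes "degree \<phi> \<ge> 2"
  shows "(\<exists>R. \<forall>n. v (orb \<phi> n) \<le> R) \<or>
         (\<exists>c>0. \<exists>N. \<forall>n\<ge>N. v (orb \<phi> n) \<ge> exp (c * real (degree \<phi>) ^ n))"
proof -
  define d where "d = degree \<phi>"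
  obtain a R where aR: "a > 0" "R \<ge> 1" "\<And>x. v x \<ge> R \<Longrightarrow> v x < v (poly \<phi> x)"
    "\<And>x. v x \<ge> R \<Longrightarrow> ln (v (poly \<phi> x)) \<ge> d * ln (v x) - a" "\<And>x. v x \<ge> R \<Longrightarrow> ln (v x) \<ge> 2 * a"
    using poly_escape[OF assms] unfolding d_def by blast
  show ?thesis
  proof (cases "\<exists>j. v (orb \<phi> j) \<ge> R")
    case True
    then obtain j where j: "v (orb \<phi> j) \<ge> R"
      by blast
    have *: "v (orb \<phi> (j + k)) \<ge> R \<and> ln (v (orb \<phi> (j + k))) - a \<ge> a * real d ^ k" for k
    proof (induction k)
      case 0
      then show ?case
        using j aR(5)[OF j] by simp
    next
      case (Suc k)
      let ?x = "orb \<phi> (j + k)"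
      have "ln (v (poly \<phi> ?x)) - a \<ge> d * (ln (v ?x) - a)"
      proof -
        have "2 * a \<le> d * a"
          using aR(1) assms by (intro mult_right_mono) (auto simp: d_def)
        then show ?thesis
          using aR(4)[of ?x] Suc by (simp add: right_diff_distrib)
      qed
      also have "d * (ln (v ?x) - a) \<ge> d * (a * real d ^ k)"
        using Suc by (intro mult_left_mono) auto
      finally (xtrans) show ?case
        using aR(3)[of ?x] Suc by (simp add: mult_ac)
    qed
    have "v (orb \<phi> n) \<ge> exp (a / real d ^ j * real d ^ n)" if "n \<ge> j" for n
    proof -
      have n: "n = j + (n - j)"
        using that by simp
      have "ln (v (orb \<phi> n)) \<ge> a * real d ^ (n - j)"
        using *[of "n - j"] aR(1) n by simp
      also have "a * real d ^ (n - j) = a / real d ^ j * real d ^ n"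
        using assms that by (simp add: power_diff d_def)
      finally (xtrans) have ln: "ln (v (orb \<phi> n)) \<ge> a / real d ^ j * real d ^ n" .
      have "v (orb \<phi> n) \<ge> R"
        using *[of "n - j"] that by simp
      then have "v (orb \<phi> n) > 0"
        using aR(2) by linarith
      then show ?thesis
        using ln ln_ge_iff by blast
    qed
    then show ?thesis
      using aR(1) assms by (intro disjI2 exI[of _ "a / real d ^ j"]) (auto simp: d_def)
  next
    case False
    then show ?thesis
      by (intro disjI1 exI[of _ R]) (auto simp: not_le less_imp_le)
  qed
qed

text \<open>
  If \<open>e = v (orb \<phi> n)\<close> is below \<open>c ^ n\<close>, the orbit has stayed in a bounded region, since it could not have
  returned from far away. There \<open>n - 1\<close> steps expand distances by at most \<open>L ^ n\<close>, while the last step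
  contracts by the derivative, which is of the order of the square root of \<open>e\<close> because of \<open>H\<close>. The
  choice of \<open>c\<close> makes the square root win over \<open>L ^ n\<close>.
\<close>

lemma orbit_near_return:
  assumes "degree \<phi> \<ge> 2" and H: "pderiv \<phi> ^ 2 = \<phi> * H"
  shows "\<exists>c. 0 < c \<and> c \<le> 1 \<and> (\<forall>n\<ge>1. v (orb \<phi> n) < c ^ n \<longrightarrow>
           (\<forall>y. v y \<le> 2 * v (orb \<phi> n) \<longrightarrow>
              v ((poly \<phi> ^^ n) y - orb \<phi> n) \<le> v (orb \<phi> n) / 2))"
proof -
  obtain R where R: "R \<ge> 1" "\<And>x. v x \<ge> R \<Longrightarrow> v x < v (poly \<phi> x)"
    using poly_escape[OF assms(1)] by blast
  obtain L where L: "L \<ge> 1" "\<And>x y. v x \<le> R + 1 \<Longrightarrow> v y \<le> R + 1 \<Longrightarrow>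
      v (poly \<phi> x - poly \<phi> y) \<le> L * v (x - y)"
    using poly_lipschitz[of "R + 1" \<phi>] R(1) by auto
  obtain C where C: "C \<ge> 0" "\<And>x y. v x \<le> R + 1 \<Longrightarrow> v y \<le> R + 1 \<Longrightarrow>
      v (poly \<phi> x - poly \<phi> y - (x - y) * poly (pderiv \<phi>) y) \<le> C * v (x - y) ^ 2"
    using poly_taylor[of "R + 1" \<phi>] R(1) by auto
  obtain K where K: "K \<ge> 0" "\<And>x. v x \<le> R + 1 \<Longrightarrow> v (poly H x) \<le> K"
    using poly_bounded[of "R + 1" H] R(1) by auto
  define M where "M = 64 * (K + C + 1)"
  \<comment> \<open>then \<open>c ^ n \<le> 1 / (M * (L ^ n)\<^sup>2)\<close> for \<open>n \<ge> 1\<close>, and \<open>M\<close> absorbs the constants of both remainder terms\<close>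
  define c where "c = 1 / (L ^ 2 * M)"
  have M: "M \<ge> 64"
    using K C by (simp add: M_def)
  have "1 * 1 \<le> L ^ 2 * M"
    using L(1) M by (intro mult_mono) auto
  then have c: "0 < c" "c \<le> 1"
    by (auto simp: c_def field_simps)
  have "v ((poly \<phi> ^^ n) y - orb \<phi> n) \<le> v (orb \<phi> n) / 2"
    if n: "n \<ge> 1" and e: "v (orb \<phi> n) < c ^ n" and y: "v y \<le> 2 * v (orb \<phi> n)" for n y
  proof -
    define e where "e = v (orb \<phi> n)"
    define T where "T = L ^ n"
    have T: "T \<ge> 1"
      using L by (simp add: T_def)
    have "c ^ n = 1 / (T ^ 2 * M ^ n)"
      by (simp add: c_def T_def power_divide power_mult_distrib power_mult[symmetric] mult.commute)
    also have "\<dots> \<le> 1 / (T ^ 2 * M)"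
      using T M n self_le_power[of M n] by (intro divide_left_mono mult_left_mono mult_pos_pos) auto
    finally have "e < 1 / (T ^ 2 * M)"
      using e unfolding e_def by linarith
    then have e1: "e * (T ^ 2 * M) < 1"
      using T M by (simp add: field_simps)
    have e0: "e \<ge> 0"
      by (simp add: e_def)
    have "e * (T ^ 2 * 64) \<le> e * (T ^ 2 * M)"
      using e0 T M by (intro mult_left_mono) auto
    then have e64: "e * T ^ 2 \<le> 1 / 64"
      using e1 by simp
    have "e * (T ^ 2 * (64 * K)) \<le> e * (T ^ 2 * M)"
      using e0 T K C by (intro mult_left_mono) (auto simp: M_def)
    then have eK: "e * T ^ 2 * K \<le> 1 / 64"
      using e1 by simp
    have "e * (T ^ 2 * (64 * C)) \<le> e * (T ^ 2 * M)"
      using e0 T K C by (intro mult_left_mono) (auto simp: M_def)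
    then have eC: "e * T ^ 2 * C \<le> 1 / 64"
      using e1 by simp
    have TT: "e * T \<le> e * T ^ 2"
      using T e0 by (intro mult_left_mono) (auto simp: power2_eq_square)
    have yT: "T * v y \<le> 1"
    proof -
      have "T * v y \<le> T * (2 * e)"
        using y T by (intro mult_left_mono) (auto simp: e_def)
      then show ?thesis
        using TT e64 by (simp add: mult_ac)
    qed
    have "e < 1"
    proof -
      have "e * 1 \<le> e * T"
        using T e0 by (intro mult_left_mono) auto
      then show ?thesis
        using TT e64 by linarith
    qed
    have bdd: "v (orb \<phi> j) < R" if "j \<le> n" for j
    proof (rule ccontr)
      assume "\<not> v (orb \<phi> j) < R"
      then have *: "v (orb \<phi> j) \<ge> R"
        by simp
      have "v (orb \<phi> (j + k)) \<ge> R" for k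
      proof (induction k)
        case (Suc k)
        then show ?case
          using R(2)[of "orb \<phi> (j + k)"] by simp
      qed (use * in simp)
      from this[of "n - j"] show False
        using that \<open>e < 1\<close> R(1) by (simp add: e_def)
    qed
    have lip: "v ((poly \<phi> ^^ j) y - orb \<phi> j) \<le> L ^ j * v y \<and> v ((poly \<phi> ^^ j) y) \<le> R + 1" if "j \<le> n" for j
      using that
    proof (induction j)
      case 0
      have "1 * v y \<le> T * v y"
        using T by (intro mult_right_mono) auto
      then show ?case
        using yT R(1) by simp
    next
      case (Suc j)
      let ?u = "(poly \<phi> ^^ j) y" and ?w = "orb \<phi> j"
      have "v (poly \<phi> ?u - poly \<phi> ?w) \<le> L * v (?u - ?w)"
        using Suc bdd[of j] by (intro L(2)) auto
      also have "\<dots> \<le> L * (L ^ j * v y)"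
        using Suc L(1) by (intro mult_left_mono) auto
      finally have 1: "v ((poly \<phi> ^^ Suc j) y - orb \<phi> (Suc j)) \<le> L ^ Suc j * v y"
        by simp
      also have "\<dots> \<le> T * v y"
        unfolding T_def using L(1) Suc by (intro mult_right_mono power_increasing) auto
      finally have "v ((poly \<phi> ^^ Suc j) y - orb \<phi> (Suc j)) \<le> 1"
        using yT by linarith
      moreover have "v (orb \<phi> (Suc j)) < R"
        using bdd Suc by blast
      ultimately have "v ((poly \<phi> ^^ Suc j) y) \<le> R + 1"
        using triangle[of "(poly \<phi> ^^ Suc j) y - orb \<phi> (Suc j)" "orb \<phi> (Suc j)"] by simp
      then show ?case
        using 1 by blast
    qed
    obtain m where m: "n = Suc m"
      using n by (cases n) auto
    define u w where "u = (poly \<phi> ^^ m) y" and "w = orb \<phi> m"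
    have uw: "v u \<le> R + 1" "v w \<le> R + 1"
      using lip[of m] bdd[of m] by (auto simp: u_def w_def m)
    have "v (u - w) \<le> L ^ m * v y"
      using lip[of m] by (simp add: u_def w_def m)
    also have "\<dots> \<le> T * (2 * e)"
      unfolding T_def using L(1) y by (intro mult_mono power_increasing) (auto simp: m e_def)
    finally have d: "v (u - w) \<le> T * (2 * e)" .
    have phiw: "poly \<phi> w = orb \<phi> n" "poly \<phi> u = (poly \<phi> ^^ n) y"
      by (simp_all add: w_def u_def m)
    \<comment> \<open>the square of the derivative is \<open>\<phi> * H\<close>, and \<open>\<phi>\<close> has absolute value \<open>e\<close> at \<open>w\<close>\<close>
    have "v (poly (pderiv \<phi>) w) \<le> 1 / (8 * T)"
    proof (rule power2_le_imp_le)
      have "v (poly (pderiv \<phi>) w) ^ 2 = v (poly (pderiv \<phi> ^ 2) w)"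
        by (simp add: power poly_power)
      also have "\<dots> = e * v (poly H w)"
        unfolding H by (simp add: mult phiw e_def)
      also have "\<dots> \<le> e * K"
        using uw e0 by (intro mult_left_mono K) auto
      also have "\<dots> \<le> (1 / (8 * T)) ^ 2"
        using eK T by (simp add: field_simps power2_eq_square)
      finally show "v (poly (pderiv \<phi>) w) ^ 2 \<le> (1 / (8 * T)) ^ 2" .
    qed (use T in simp)
    then have "v (u - w) * v (poly (pderiv \<phi>) w) \<le> T * (2 * e) * (1 / (8 * T))"
      using d T e0 by (intro mult_mono) auto
    then have t1: "v (u - w) * v (poly (pderiv \<phi>) w) \<le> e / 4"
      using T by simp
    have "C * v (u - w) ^ 2 \<le> C * (T * (2 * e)) ^ 2"
      using d C(1) by (intro mult_left_mono power_mono) auto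
    also have "\<dots> = 4 * e * (e * T ^ 2 * C)"
      by (simp add: power2_eq_square)
    also have "\<dots> \<le> 4 * e * (1 / 64)"
      using eC e0 by (intro mult_left_mono) auto
    finally have t2: "C * v (u - w) ^ 2 \<le> e / 4"
      using e0 by simp
    have "v (poly \<phi> u - poly \<phi> w) \<le> v (poly \<phi> u - poly \<phi> w - (u - w) * poly (pderiv \<phi>) w)
        + v ((u - w) * poly (pderiv \<phi>) w)"
      using triangle[of "poly \<phi> u - poly \<phi> w - (u - w) * poly (pderiv \<phi>) w"
          "(u - w) * poly (pderiv \<phi>) w"] by simp
    also have "\<dots> \<le> e / 4 + e / 4"
      using C(2)[OF uw] t1 t2 by (simp add: mult)
    finally show ?thesis
      by (simp add: phiw e_def)
  qed
  then show ?thesis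
    using c by blast
qed

text \<open>
  Two exceptionally small terms with indices \<open>m\<close> and \<open>n\<close> are compared at the common multiple \<open>m * n\<close>: each
  of them agrees with the term of that index up to a factor of two. So all exceptionally small terms are
  at least a quarter of any single one of them.
\<close>

lemma orbit_lower_bound:
  assumes "degree \<phi> \<ge> 2" and H: "pderiv \<phi> ^ 2 = \<phi> * H"
    and nz: "\<And>n. n \<ge> 1 \<Longrightarrow> orb \<phi> n \<noteq> 0"
  shows "\<exists>c>0. \<forall>n\<ge>1. v (orb \<phi> n) \<ge> c ^ n"
proof -
  obtain c where c: "0 < c" "c \<le> 1" "\<And>n y. n \<ge> 1 \<Longrightarrow> v (orb \<phi> n) < c ^ n \<Longrightarrow>
      v y \<le> 2 * v (orb \<phi> n) \<Longrightarrow> v ((poly \<phi> ^^ n) y - orb \<phi> n) \<le> v (orb \<phi> n) / 2"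
    using orbit_near_return[OF assms(1,2)] by blast
  have ret: "v (orb \<phi> n) \<le> 2 * v (orb \<phi> (Suc k * n)) \<and> v (orb \<phi> (Suc k * n)) \<le> 2 * v (orb \<phi> n)"
    if n: "n \<ge> 1" "v (orb \<phi> n) < c ^ n" for n k
  proof (induction k)
    case (Suc k)
    let ?y = "orb \<phi> (Suc k * n)"
    have eq: "orb \<phi> (Suc (Suc k) * n) = (poly \<phi> ^^ n) ?y"
      using orb_add[of n "Suc k * n" \<phi>] by simp
    have *: "v ((poly \<phi> ^^ n) ?y - orb \<phi> n) \<le> v (orb \<phi> n) / 2"
      using c(3)[OF n] Suc by blast
    show ?case
      unfolding eq
      using triangle[of "(poly \<phi> ^^ n) ?y - orb \<phi> n" "orb \<phi> n"]
        triangle_rev[of "orb \<phi> n" "(poly \<phi> ^^ n) ?y - orb \<phi> n"] * nonneg[of "orb \<phi> n"]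
      by auto
  qed auto
  show ?thesis
  proof (cases "\<exists>n\<ge>1. v (orb \<phi> n) < c ^ n")
    case True
    then obtain m where m: "m \<ge> 1" "v (orb \<phi> m) < c ^ m"
      by blast
    \<comment> \<open>small indices are covered by \<open>c\<close>, exceptional ones by comparison with the index \<open>m\<close>\<close>
    define b where "b = min c (min 1 (v (orb \<phi> m) / 4))"
    have b: "0 < b" "b \<le> c" "b \<le> 1" "b \<le> v (orb \<phi> m) / 4"
      using c nz[OF m(1)] by (auto simp: b_def)
    have "v (orb \<phi> n) \<ge> b ^ n" if n: "n \<ge> 1" for n
    proof (cases "v (orb \<phi> n) < c ^ n")
      case True
      obtain m' n' where mn: "m = Suc m'" "n = Suc n'"
        using m n by (cases m; cases n) auto
      have "v (orb \<phi> m) \<le> 2 * v (orb \<phi> (n * m))" "v (orb \<phi> (m * n)) \<le> 2 * v (orb \<phi> n)"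
        using ret[OF m, of n'] ret[OF n True, of m'] mn by auto
      then have "v (orb \<phi> m) / 4 \<le> v (orb \<phi> n)"
        by (simp add: mult.commute)
      moreover have "b ^ n \<le> b ^ 1"
        using b n by (intro power_decreasing) auto
      ultimately show ?thesis
        using b by simp
    next
      case False
      moreover have "b ^ n \<le> c ^ n"
        using b by (intro power_mono) auto
      ultimately show ?thesis
        by simp
    qed
    then show ?thesis
      using b by blast
  next
    case False
    then show ?thesis
      using c by (intro exI[of _ c]) (auto simp: not_less)
  qed
qed

end

locale nonarch_abs_val = abs_val +
  assumes nonarch: "nonarchimedean v"
begin

lemma ultra: "v (x + y) \<le> max (v x) (v y)"
  using nonarch unfolding nonarchimedean_def by blast

lemma ultra_diff: "v (x - y) \<le> max (v x) (v y)"
  using ultra[of x "- y"] by simp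

lemma ultra_eq:
  assumes "v (x - y) < v y"
  shows "v x = v y"
  using ultra[of "x - y" y] ultra_diff[of x "x - y"] assms by simp

lemma of_nat_le_1: "v (of_nat n) \<le> 1"
  by (induction n) (auto intro: order_trans[OF ultra])

lemma poly_le_1:
  assumes "\<And>i. v (coeff p i) \<le> 1" "v x \<le> 1"
  shows "v (poly p x) \<le> 1"
  using assms
proof (induction p)
  case (pCons a p)
  have "v (poly p x) \<le> 1"
    using pCons.prems(1)[of "Suc _"] pCons.prems(2) by (intro pCons.IH) simp_all
  then have "v (x * poly p x) \<le> 1"
    using pCons.prems(2) mult_mono[of "v x" 1 "v (poly p x)" 1] by (simp add: mult)
  moreover have "v a \<le> 1"
    using pCons.prems(1)[of 0] by simp
  ultimately show ?case
    using ultra[of a "x * poly p x"] by simp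
qed auto

lemma coeff_pderiv_le_1:
  assumes "\<And>i. v (coeff p i) \<le> 1"
  shows "v (coeff (pderiv p) i) \<le> 1"
  using mult_mono[OF of_nat_le_1[of "Suc i"] assms[of "Suc i"]]
  by (simp add: coeff_pderiv mult)

lemma poly_taylor_ultra:
  assumes "\<And>i. v (coeff p i) \<le> 1" "v x \<le> 1" "v y \<le> 1"
  shows "v (poly p x - poly p y - (x - y) * poly (pderiv p) y) \<le> v (x - y) ^ 2"
  using assms
proof (induction p)
  case (pCons a p)
  have p: "v (coeff p i) \<le> 1" for i
    using pCons.prems(1)[of "Suc i"] by simp
  have "v (x * (poly p x - poly p y - (x - y) * poly (pderiv p) y)) \<le> 1 * v (x - y) ^ 2"
    unfolding mult using pCons.prems p by (intro mult_mono pCons.IH) auto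
  moreover have "v ((x - y) ^ 2 * poly (pderiv p) y) \<le> v (x - y) ^ 2 * 1"
    unfolding mult power using pCons.prems p
    by (intro mult_left_mono poly_le_1 coeff_pderiv_le_1) auto
  ultimately show ?case
    unfolding poly_taylor_aux
    by (intro order_trans[OF ultra]) auto
qed auto

lemma poly_lipschitz_ultra:
  assumes "\<And>i. v (coeff p i) \<le> 1" "v x \<le> 1" "v y \<le> 1"
  shows "v (poly p x - poly p y) \<le> v (x - y)"
proof -
  have "v (x - y) \<le> 1"
    using ultra_diff[of x y] assms by auto
  then have "v (x - y) ^ 2 \<le> v (x - y)"
    by (simp add: power2_eq_square mult_left_le)
  then have "v (poly p x - poly p y - (x - y) * poly (pderiv p) y) \<le> v (x - y)"
    using poly_taylor_ultra[OF assms] by linarith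
  moreover have "v ((x - y) * poly (pderiv p) y) \<le> v (x - y) * 1"
    unfolding mult using assms by (intro mult_left_mono poly_le_1 coeff_pderiv_le_1) auto
  ultimately show ?thesis
    using ultra[of "poly p x - poly p y - (x - y) * poly (pderiv p) y" "(x - y) * poly (pderiv p) y"]
    by auto
qed

context
  fixes \<phi> H :: "'a poly"
  assumes phi: "\<And>i. v (coeff \<phi> i) \<le> 1"
begin

lemma iter_le_1: "v x \<le> 1 \<Longrightarrow> v ((poly \<phi> ^^ n) x) \<le> 1"
  by (induction n) (auto intro: poly_le_1 phi)

lemma iter_lipschitz_ultra:
  assumes "v x \<le> 1" "v y \<le> 1"
  shows "v ((poly \<phi> ^^ n) x - (poly \<phi> ^^ n) y) \<le> v (x - y)"
proof (induction n)
  case (Suc n)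
  then show ?case
    using poly_lipschitz_ultra[OF phi iter_le_1[OF assms(1), of n] iter_le_1[OF assms(2), of n]]
    by (auto intro: order_trans)
qed auto

text \<open>
  An integral polynomial acts on residue classes, and \<open>orb \<phi> m\<close> has the residue class of \<open>0\<close>.
\<close>

lemma orb_less_1_add_iff:
  assumes "v (orb \<phi> m) < 1"
  shows "v (orb \<phi> (n + m)) < 1 \<longleftrightarrow> v (orb \<phi> n) < 1"
proof -
  have *: "v (orb \<phi> (n + m) - orb \<phi> n) < 1"
    using iter_lipschitz_ultra[of "orb \<phi> m" 0 n] assms by (auto simp: orb_add)
  show ?thesis
    using * ultra[of "orb \<phi> (n + m) - orb \<phi> n" "orb \<phi> n"]
      ultra_diff[of "orb \<phi> (n + m)" "orb \<phi> (n + m) - orb \<phi> n"] by auto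
qed

lemma orb_less_1_gcd:
  assumes "v (orb \<phi> m) < 1" "v (orb \<phi> n) < 1"
  shows "v (orb \<phi> (gcd m n)) < 1"
  using assms
proof (induction "m + n" arbitrary: m n rule: less_induct)
  case less
  consider "m = 0" | "n = 0" | "0 < m" "m \<le> n" | "0 < n" "n < m"
    by linarith
  then show ?case
  proof cases
    case 3
    then have "v (orb \<phi> (n - m)) < 1"
      using orb_less_1_add_iff[of m "n - m"] less.prems by simp
    then show ?thesis
      using less.hyps[of m "n - m"] less.prems 3 gcd_add2[of m "n - m"] by simp
  next
    case 4
    then have "v (orb \<phi> (m - n)) < 1"
      using orb_less_1_add_iff[of n "m - n"] less.prems by simp
    then show ?thesis
      using less.hyps[of "m - n" n] less.prems 4 gcd_add1[of "m - n" n] by simp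
  qed (use less.prems in auto)
qed

text \<open>
  Since \<open>\<phi>\<close> is integral, the first \<open>m - 1\<close> steps do not increase the distance between the orbits of \<open>0\<close> and of
  a point \<open>y\<close> with \<open>v y \<le> v (orb \<phi> m)\<close>, and in the last step the distance becomes strictly smaller, as the
  square of the derivative has absolute value at most \<open>v (orb \<phi> m)\<close>. So the ultrametric inequality forces
  the images to have the same absolute value.
\<close>

lemma orb_rigid:
  assumes H: "pderiv \<phi> ^ 2 = \<phi> * H" "\<And>i. v (coeff H i) \<le> 1"
    and m: "orb \<phi> m \<noteq> 0" "v (orb \<phi> m) < 1" and "k \<ge> 1"
  shows "v (orb \<phi> (k * m)) = v (orb \<phi> m)"
proof -
  define e where "e = v (orb \<phi> m)"
  have e: "0 < e" "e < 1"
    using m by (auto simp: e_def)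
  obtain j where j: "m = Suc j"
    using m(1) by (cases m) auto
  have step: "v ((poly \<phi> ^^ m) y) = e" if y: "v y \<le> e" for y
  proof -
    define u w where "u = (poly \<phi> ^^ j) y" and "w = orb \<phi> j"
    have uw: "v u \<le> 1" "v w \<le> 1" "v (u - w) \<le> e"
      using y e iter_lipschitz_ultra[of y 0 j] unfolding u_def w_def by (auto intro!: iter_le_1)
    have phiw: "poly \<phi> w = orb \<phi> m" "poly \<phi> u = (poly \<phi> ^^ m) y"
      by (simp_all add: u_def w_def j)
    have "v (poly (pderiv \<phi>) w) ^ 2 = v (poly (pderiv \<phi> ^ 2) w)"
      by (simp add: power poly_power)
    also have "\<dots> = e * v (poly H w)"
      unfolding H(1) by (simp add: mult phiw e_def)
    also have "\<dots> \<le> e * 1"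
      using e uw H by (intro mult_left_mono poly_le_1) auto
    finally have "v (poly (pderiv \<phi>) w) ^ 2 < 1"
      using e by simp
    then have "v (poly (pderiv \<phi>) w) < 1"
      using power_less_imp_less_base[of "v (poly (pderiv \<phi>) w)" 2 1] by simp
    then have "e * v (poly (pderiv \<phi>) w) < e * 1"
      using e(1) by (intro mult_strict_left_mono)
    moreover have "v (u - w) * v (poly (pderiv \<phi>) w) \<le> e * v (poly (pderiv \<phi>) w)"
      using uw(3) by (intro mult_right_mono) auto
    ultimately have "v (u - w) * v (poly (pderiv \<phi>) w) < e"
      by linarith
    moreover have "v (u - w) ^ 2 \<le> e * e"
      using uw e by (auto simp: power2_eq_square intro!: mult_mono)
    moreover have "e * e < e"
      using e by simp
    ultimately have "v (poly \<phi> u - poly \<phi> w) < e"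
      using poly_taylor_ultra[OF phi uw(1,2)]
        ultra[of "poly \<phi> u - poly \<phi> w - (u - w) * poly (pderiv \<phi>) w" "(u - w) * poly (pderiv \<phi>) w"]
      by (auto simp: mult)
    then show ?thesis
      using ultra_eq[of "poly \<phi> u" "poly \<phi> w"] by (simp add: phiw e_def)
  qed
  have "v (orb \<phi> (Suc i * m)) = e" for i
  proof (induction i)
    case (Suc i)
    have "orb \<phi> (Suc (Suc i) * m) = (poly \<phi> ^^ m) (orb \<phi> (Suc i * m))"
      using orb_add[of m "Suc i * m" \<phi>] by simp
    then show ?case
      using step[of "orb \<phi> (Suc i * m)"] Suc by simp
  qed (simp add: e_def)
  from this[of "k - 1"] show ?thesis
    using \<open>k \<ge> 1\<close> by (simp add: e_def)
qed

end

end

section \<open>Powerful polynomials divide the square of their derivative\<close>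

lemma pderiv_square_dvd_mult:
  fixes f g :: "'a::idom poly"
  assumes "pderiv f ^ 2 = f * F" "pderiv g ^ 2 = g * G"
  shows "pderiv (f * g) ^ 2 = (f * g) * (F * g + 2 * pderiv f * pderiv g + f * G)"
proof -
  have "pderiv (f * g) ^ 2 = f ^ 2 * pderiv g ^ 2 + 2 * f * g * pderiv f * pderiv g + g ^ 2 * pderiv f ^ 2"
    by (simp add: pderiv_mult power2_eq_square algebra_simps)
  then show ?thesis
    unfolding assms by (simp add: power2_eq_square algebra_simps)
qed

lemma pderiv_square_power:
  fixes f :: "'a::idom poly"
  shows "pderiv (f ^ Suc (Suc n)) ^ 2 = f ^ Suc (Suc n) * smult ((of_nat (Suc (Suc n)))\<^sup>2) (f ^ n * pderiv f ^ 2)"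
  unfolding pderiv_power_Suc by (simp add: power2_eq_square mult_ac)

lemma exists_irreducible_dvd:
  fixes f :: "'a::field poly"
  assumes "degree f \<ge> 1"
  shows "\<exists>p. Factorial_Ring.irreducible p \<and> p dvd f"
  using assms
proof (induction "degree f" arbitrary: f rule: less_induct)
  case less
  show ?case
  proof (cases "Factorial_Ring.irreducible f")
    case False
    have f: "f \<noteq> 0" "\<not> is_unit f"
      using less.prems by (auto simp: is_unit_iff_degree)
    then obtain a b where ab: "f = a * b" "\<not> is_unit a" "\<not> is_unit b"
      using False unfolding Factorial_Ring.irreducible_def by blast
    then have ab0: "a \<noteq> 0" "b \<noteq> 0"
      using f by auto
    then have deg: "degree a \<ge> 1" "degree b \<ge> 1"
      using ab(2,3) by (auto simp: is_unit_iff_degree)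
    then obtain p where "Factorial_Ring.irreducible p" "p dvd a"
      using less.hyps[of a] ab(1) ab0 by (auto simp: degree_mult_eq)
    then show ?thesis
      using ab(1) by (auto intro: dvd_mult2)
  qed (use dvd_refl in blast)
qed

text \<open>
  The property is multiplicative (\<open>pderiv_square_dvd_mult\<close>) and holds for powers with exponent at least two
  (\<open>pderiv_square_power\<close>), so one splits off the full power of one irreducible factor at a time.
\<close>

lemma dvd_pderiv_square:
  fixes \<phi> :: "'a::field_char_0 poly"
  assumes "\<phi> \<noteq> 0" and "\<And>p. Factorial_Ring.irreducible p \<Longrightarrow> p dvd \<phi> \<Longrightarrow> p ^ 2 dvd \<phi>"
  shows "\<exists>H. pderiv \<phi> ^ 2 = \<phi> * H"
  using assms
proof (induction "degree \<phi>" arbitrary: \<phi> rule: less_induct)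
  case less
  show ?case
  proof (cases "degree \<phi> = 0")
    case True
    then have "pderiv \<phi> = 0"
      by (simp add: pderiv_eq_0_iff)
    then show ?thesis
      by (intro exI[of _ 0]) simp
  next
    case False
    then obtain p where p: "Factorial_Ring.irreducible p" "p dvd \<phi>"
      using exists_irreducible_dvd[of \<phi>] by auto
    have prime: "prime_elem p"
      using p(1) by (rule field_poly_irreducible_imp_prime)
    have degp: "degree p \<ge> 1"
      using prime by (auto simp: prime_elem_def is_unit_iff_degree Suc_le_eq)
    have p0: "p \<noteq> 0"
      using degp by auto
    \<comment> \<open>the multiplicity of \<open>p\<close>, as the largest exponent of a power of \<open>p\<close> dividing \<open>\<phi>\<close>\<close>
    define E where "E = {e. p ^ e dvd \<phi>}"
    have "e \<le> degree \<phi>" if "e \<in> E" for e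
    proof -
      have "degree (p ^ e) \<le> degree \<phi>"
        using that less.prems by (intro dvd_imp_degree_le) (auto simp: E_def)
      moreover have "degree (p ^ e) = e * degree p"
        using degp by (subst Polynomial.degree_power_eq) auto
      moreover have "e \<le> e * degree p"
        using degp by simp
      ultimately show ?thesis
        by linarith
    qed
    then have finE: "finite E"
      by (meson finite_nat_set_iff_bounded_le)
    have "2 \<in> E"
      using less.prems(2)[OF p] by (simp add: E_def)
    define e where "e = Max E"
    have e: "e \<in> E" "e \<ge> 2"
      using finE \<open>2 \<in> E\<close> by (auto simp: e_def intro!: Max_in Max_ge)
    have "Suc e \<notin> E"
      using Max_ge[OF finE, of "Suc e"] unfolding e_def by linarith
    from e obtain g where g: "\<phi> = p ^ e * g"
      by (auto simp: E_def)
    have pg: "\<not> p dvd g"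
      using \<open>Suc e \<notin> E\<close> unfolding E_def g
      by (auto simp: mult.commute[of "p ^ e"] intro: mult_dvd_mono)
    have g0: "g \<noteq> 0"
      using less.prems(1) g by auto
    have "degree \<phi> = e * degree p + degree g"
      unfolding g using g0 p0 by (simp add: degree_mult_eq Polynomial.degree_power_eq)
    then have deg: "degree g < degree \<phi>"
      using e degp by simp
    have "q ^ 2 dvd g" if q: "Factorial_Ring.irreducible q" "q dvd g" for q
    proof -
      have qp: "prime_elem q"
        using q(1) by (rule field_poly_irreducible_imp_prime)
      have "\<not> q dvd p"
      proof
        assume "q dvd p"
        then have "p dvd q"
          using p(1) q(1) by (metis dvdE dvd_mult_unit_iff dvd_refl irreducibleD irreducible_not_unit)
        then show False
          using pg q(2) dvd_trans by blast
      qed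
      then have "\<not> q dvd p ^ e"
        using prime_elem_dvd_power[OF qp] by blast
      moreover have "q ^ 2 dvd p ^ e * g"
        using less.prems(2)[of q] q g by auto
      ultimately show ?thesis
        using prime_power_dvd_multD[OF qp, of 2 "p ^ e" g] by simp
    qed
    then obtain G where "pderiv g ^ 2 = g * G"
      using less.hyps[OF deg g0] by blast
    moreover obtain k where "e = Suc (Suc k)"
      using e(2) by (metis add_2_eq_Suc le_Suc_ex)
    ultimately show ?thesis
      unfolding g using pderiv_square_dvd_mult[OF pderiv_square_power[of p k]] by blast
  qed
qed

text \<open>
  The cofactor is a polynomial expression with integer coefficients in the factors and their derivatives,
  hence has coefficients in every subring that contains those of the factors.
\<close>

lemma prod_of_powers_pderiv_square:
  fixes f :: "nat \<Rightarrow> 'a::field_char_0 poly" and R :: "'a set"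
  assumes R: "0 \<in> R" "1 \<in> R" "\<And>x y. x \<in> R \<Longrightarrow> y \<in> R \<Longrightarrow> x + y \<in> R"
      "\<And>x y. x \<in> R \<Longrightarrow> y \<in> R \<Longrightarrow> x * y \<in> R"
    and f: "\<And>i j. i \<in> I \<Longrightarrow> coeff (f i) j \<in> R" and e: "\<And>i. i \<in> I \<Longrightarrow> e i \<ge> 2" and "finite I"
  shows "(\<forall>j. coeff (\<Prod>i\<in>I. f i ^ e i) j \<in> R) \<and>
         (\<exists>H. pderiv (\<Prod>i\<in>I. f i ^ e i) ^ 2 = (\<Prod>i\<in>I. f i ^ e i) * H \<and> (\<forall>j. coeff H j \<in> R))"
proof -
  define RP where "RP = {p. \<forall>j. coeff p j \<in> R}"
  have nat: "of_nat k \<in> R" for k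
    by (induction k) (auto intro: R)
  have sum: "(\<Sum>x\<in>A. g x) \<in> R" if "\<And>x. x \<in> A \<Longrightarrow> g x \<in> R" for A :: "nat set" and g
    using that by (induction A rule: infinite_finite_induct) (auto intro: R)
  have RP_add: "p + q \<in> RP" if "p \<in> RP" "q \<in> RP" for p q
    using that by (auto simp: RP_def intro: R)
  have RP_mult: "p * q \<in> RP" if "p \<in> RP" "q \<in> RP" for p q
    using that by (auto simp: RP_def coeff_mult intro!: R sum)
  have RP_1: "1 \<in> RP"
    by (auto simp: RP_def coeff_1 intro: R)
  have RP_smult: "Polynomial.smult c p \<in> RP" if "p \<in> RP" "c \<in> R" for p c
    using that by (auto simp: RP_def intro: R)
  have RP_pow: "p ^ n \<in> RP" if "p \<in> RP" for p n
    by (induction n) (auto intro: RP_1 RP_mult that)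
  have RP_deriv: "pderiv p \<in> RP" if "p \<in> RP" for p
    unfolding RP_def mem_Collect_eq coeff_pderiv using that nat by (auto simp: RP_def intro!: R simp del: of_nat_Suc)
  have RP_2: "2 * p \<in> RP" if "p \<in> RP" for p
    unfolding mult_2 by (rule RP_add[OF that that])
  have "(\<Prod>i\<in>I. f i ^ e i) \<in> RP \<and>
        (\<exists>H\<in>RP. pderiv (\<Prod>i\<in>I. f i ^ e i) ^ 2 = (\<Prod>i\<in>I. f i ^ e i) * H)"
    using \<open>finite I\<close> f e
  proof (induction I)
    case empty
    have "(0 :: 'a poly) \<in> RP"
      by (auto simp: RP_def R)
    then show ?case
      using RP_1 by (auto intro!: bexI[of _ 0])
  next
    case (insert i I)
    then obtain H where H: "H \<in> RP" "pderiv (\<Prod>i\<in>I. f i ^ e i) ^ 2 = (\<Prod>i\<in>I. f i ^ e i) * H"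
      and g: "(\<Prod>i\<in>I. f i ^ e i) \<in> RP"
      by auto
    have fi: "f i \<in> RP"
      using insert.prems by (auto simp: RP_def)
    obtain k where k: "e i = Suc (Suc k)"
      using insert.prems(2)[of i] by (metis insertI1 add_2_eq_Suc le_Suc_ex)
    define F where "F = Polynomial.smult ((of_nat (Suc (Suc k)))\<^sup>2) (f i ^ k * pderiv (f i) ^ 2)"
    have F: "pderiv (f i ^ e i) ^ 2 = f i ^ e i * F"
      unfolding F_def k by (rule pderiv_square_power)
    have "F \<in> RP"
      unfolding F_def power2_eq_square using nat fi
      by (intro RP_smult RP_mult RP_pow RP_deriv R) (auto simp del: of_nat_Suc)
    define P where "P = (\<Prod>i\<in>I. f i ^ e i)"
    have prod: "(\<Prod>i\<in>insert i I. f i ^ e i) = f i ^ e i * P"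
      using insert.hyps by (simp add: P_def)
    have P: "P \<in> RP" "pderiv P ^ 2 = P * H"
      using g H by (auto simp: P_def)
    have "F * P + 2 * pderiv (f i ^ e i) * pderiv P + f i ^ e i * H \<in> RP"
      using \<open>F \<in> RP\<close> P H(1) fi by (intro RP_add RP_mult RP_2 RP_pow RP_deriv)
    moreover have "f i ^ e i * P \<in> RP"
      using fi P by (intro RP_mult RP_pow)
    ultimately show ?case
      unfolding prod using pderiv_square_dvd_mult[OF F P(2)] by blast
  qed
  then show ?thesis
    by (auto simp: RP_def)
qed

section \<open>Algebraic integers and embeddings into the complex numbers\<close>

text \<open>
  An eigenvalue of an integer matrix is a root of its characteristic polynomial, which is monic.
\<close>

lemma algebraic_int_eigenvector:
  fixes t :: "'a::field_char_0" and w :: "nat \<Rightarrow> 'a" and A :: "nat \<Rightarrow> nat \<Rightarrow> int"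
  assumes "\<And>i. i < n \<Longrightarrow> t * w i = (\<Sum>j<n. of_int (A i j) * w j)" and "k < n" "w k \<noteq> 0"
  shows "algebraic_int t"
proof -
  define M where "M = mat n n (\<lambda>(i, j). A i j)"
  have M: "M \<in> carrier_mat n n"
    by (simp add: M_def)
  define N where "N = (map_mat of_int M :: 'a mat)"
  have N: "N \<in> carrier_mat n n"
    using M by (simp add: N_def)
  define u where "u = vec n w"
  have "N *\<^sub>v u = t \<cdot>\<^sub>v u"
    by (rule eq_vecI)
      (use assms(1) in \<open>auto simp: N_def M_def u_def scalar_prod_def atLeast0LessThan\<close>)
  moreover have "u \<noteq> 0\<^sub>v n"
    using assms(2,3) by (auto simp: u_def vec_eq_iff)
  ultimately have "eigenvalue N t"
    unfolding eigenvalue_def eigenvector_def using N by (intro exI[of _ u]) (simp add: u_def)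
  then have "poly (char_poly N) t = 0"
    using eigenvalue_root_char_poly[OF N] by simp
  moreover have "char_poly N = map_poly of_int (char_poly M)"
    unfolding N_def by (rule of_int_hom.char_poly_hom[OF M])
  moreover have "lead_coeff (char_poly M) = 1"
    using degree_monic_char_poly[OF M] by simp
  ultimately show ?thesis
    unfolding algebraic_int_altdef_ipoly by metis
qed

lemma algebraic_int_power_reduce:
  fixes x :: "'a::field_char_0"
  assumes "algebraic_int x"
  shows "\<exists>n>0. \<exists>a. x ^ n = (\<Sum>i<n. of_int (a i) * x ^ i)"
proof -
  obtain p where p: "poly (map_poly of_int p) x = 0" "lead_coeff p = 1"
    using assms by (auto simp: algebraic_int_altdef_ipoly)
  define n where "n = degree p"
  have "n > 0"
    using p by (intro Nat.gr0I) (auto simp: n_def elim!: degree_eq_zeroE)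
  have "0 = (\<Sum>i\<le>n. of_int (coeff p i) * x ^ i)"
    using p(1) by (simp add: poly_altdef n_def)
  also have "\<dots> = x ^ n + (\<Sum>i<n. of_int (coeff p i) * x ^ i)"
    using p(2) by (simp add: lessThan_Suc_atMost[symmetric] n_def)
  finally have "x ^ n + (\<Sum>i<n. of_int (coeff p i) * x ^ i) = 0"
    by (rule sym)
  then have "x ^ n = - (\<Sum>i<n. of_int (coeff p i) * x ^ i)"
    by (rule eq_neg_iff_add_eq_0[THEN iffD2])
  also have "\<dots> = (\<Sum>i<n. of_int (- coeff p i) * x ^ i)"
    by (simp only: of_int_minus mult_minus_left sum_negf)
  finally have "x ^ n = (\<Sum>i<n. of_int (- coeff p i) * x ^ i)" .
  then show ?thesis
    using \<open>n > 0\<close> by (intro exI[of _ n] exI[of _ "\<lambda>i. - coeff p i"] conjI)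
qed

lemma algebraic_int_of_finite_module:
  fixes t :: "'a::field_char_0"
  assumes fin: "finite I" and i0: "i0 \<in> I" "w i0 \<noteq> 0"
    and A: "\<And>i. i \<in> I \<Longrightarrow> \<exists>a :: 'i \<Rightarrow> int. t * w i = (\<Sum>j\<in>I. of_int (a j) * w j)"
  shows "algebraic_int t"
proof -
  obtain a :: "'i \<Rightarrow> 'i \<Rightarrow> int" where a: "\<And>i. i \<in> I \<Longrightarrow> t * w i = (\<Sum>j\<in>I. of_int (a i j) * w j)"
    using A by metis
  obtain h where h: "bij_betw h {..<card I} I"
    using ex_bij_betw_nat_finite[OF fin] by (auto simp: atLeast0LessThan)
  obtain k where k: "k < card I" "h k = i0"
    using h i0(1) by (metis bij_betw_imp_surj_on imageE lessThan_iff)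
  show ?thesis
  proof (rule algebraic_int_eigenvector[of "card I" t "\<lambda>k. w (h k)" "\<lambda>k l. a (h k) (h l)" k])
    fix i assume "i < card I"
    then have "h i \<in> I"
      using h by (auto simp: bij_betw_def)
    from a[OF this] show "t * w (h i) = (\<Sum>j<card I. of_int (a (h i) (h j)) * w (h j))"
      using sum.reindex_bij_betw[OF h, of "\<lambda>j. of_int (a (h i) j) * w j"] by simp
  qed (use k i0 in auto)
qed

text \<open>
  Both elements stabilize the module spanned by the finitely many monomials \<open>x ^ i * y ^ j\<close> with exponents
  below the degrees of monic equations of \<open>x\<close> and \<open>y\<close>.
\<close>

lemma algebraic_int_add_mult:
  fixes x y :: "'a::field_char_0"
  assumes "algebraic_int x" "algebraic_int y"
  shows "algebraic_int (x + y)" "algebraic_int (x * y)"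
proof -
  obtain m a where m: "m > 0" "x ^ m = (\<Sum>i<m. of_int (a i) * x ^ i)"
    using algebraic_int_power_reduce[OF assms(1)] by blast
  obtain n b where n: "n > 0" "y ^ n = (\<Sum>i<n. of_int (b i) * y ^ i)"
    using algebraic_int_power_reduce[OF assms(2)] by blast
  define I where "I = {..<m} \<times> {..<n}"
  define w where "w = (\<lambda>(i, j). x ^ i * y ^ j)"
  define span where "span = {s. \<exists>c :: nat \<times> nat \<Rightarrow> int. s = (\<Sum>k\<in>I. of_int (c k) * w k)}"
  have fin: "finite I"
    by (simp add: I_def)
  have span_add: "s + s' \<in> span" if s: "s \<in> span" "s' \<in> span" for s s'
  proof -
    obtain c c' :: "nat \<times> nat \<Rightarrow> int" where
      "s = (\<Sum>k\<in>I. of_int (c k) * w k)" "s' = (\<Sum>k\<in>I. of_int (c' k) * w k)"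
      using s unfolding span_def by blast
    then have "s + s' = (\<Sum>k\<in>I. of_int (c k + c' k) * w k)"
      by (simp add: sum.distrib distrib_right)
    then show ?thesis
      unfolding span_def by (intro CollectI exI[of _ "\<lambda>k. c k + c' k"])
  qed
  have span_scale: "of_int z * s \<in> span" if s: "s \<in> span" for s z
  proof -
    obtain c :: "nat \<times> nat \<Rightarrow> int" where "s = (\<Sum>k\<in>I. of_int (c k) * w k)"
      using s unfolding span_def by blast
    then have "of_int z * s = (\<Sum>k\<in>I. of_int (z * c k) * w k)"
      by (simp add: sum_distrib_left mult_ac)
    then show ?thesis
      unfolding span_def by (intro CollectI exI[of _ "\<lambda>k. z * c k"])
  qed
  have span_base: "w k \<in> span" if "k \<in> I" for k
  proof -
    have "w k = (\<Sum>l\<in>I. of_int (if l = k then 1 else 0) * w l)"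
      using that fin by (simp add: if_distrib[of "\<lambda>c. of_int c * _"] sum.delta' cong: if_cong)
    then show ?thesis
      unfolding span_def by (intro CollectI exI[of _ "\<lambda>l. if l = k then 1 else 0"])
  qed
  have span_sum: "(\<Sum>k\<in>A. f k) \<in> span" if "\<And>k. k \<in> A \<Longrightarrow> f k \<in> span" "finite A" "A \<noteq> {}"
    for A :: "nat set" and f
    using that(2,3,1) by (induction A rule: finite_ne_induct) (auto intro: span_add)
  have x: "x * w k \<in> span" and y: "y * w k \<in> span" if "k \<in> I" for k
  proof -
    obtain i j where k: "k = (i, j)" "i < m" "j < n"
      using \<open>k \<in> I\<close> by (auto simp: I_def)
    show "x * w k \<in> span"
    proof (cases "Suc i < m")
      case True
      then show ?thesis
        using span_base[of "(Suc i, j)"] k by (auto simp: I_def w_def mult_ac)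
    next
      case False
      then have "Suc i = m"
        using k by simp
      then have "x * w k = x ^ m * y ^ j"
        by (auto simp: k(1) w_def mult_ac)
      also have "\<dots> = (\<Sum>i<m. of_int (a i) * w (i, j))"
        unfolding m(2) by (simp add: sum_distrib_left sum_distrib_right mult_ac w_def)
      also have "\<dots> \<in> span"
        using k m(1) by (intro span_sum span_scale span_base) (auto simp: I_def)
      finally show ?thesis .
    qed
    show "y * w k \<in> span"
    proof (cases "Suc j < n")
      case True
      then show ?thesis
        using span_base[of "(i, Suc j)"] k by (auto simp: I_def w_def mult_ac)
    next
      case False
      then have "Suc j = n"
        using k by simp
      then have "y * w k = x ^ i * y ^ n"
        by (auto simp: k(1) w_def mult_ac)
      also have "\<dots> = (\<Sum>j<n. of_int (b j) * w (i, j))"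
        unfolding n(2) by (simp add: sum_distrib_left sum_distrib_right mult_ac w_def)
      also have "\<dots> \<in> span"
        using k n(1) by (intro span_sum span_scale span_base) (auto simp: I_def)
      finally show ?thesis .
    qed
  qed
  have x_span: "x * s \<in> span" if s: "s \<in> span" for s
  proof -
    obtain c :: "nat \<times> nat \<Rightarrow> int" where "s = (\<Sum>k\<in>I. of_int (c k) * w k)"
      using s unfolding span_def by blast
    then have "x * s = (\<Sum>k\<in>I. of_int (c k) * (x * w k))"
      by (simp add: sum_distrib_left mult_ac)
    moreover have "(\<Sum>k\<in>A. of_int (c k) * (x * w k)) \<in> span" if "A \<subseteq> I" "A \<noteq> {}" "finite A" for A
      using that(3,2,1) by (induction A rule: finite_ne_induct) (auto intro!: span_add span_scale x)
    moreover have "I \<noteq> {}"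
      using m n by (auto simp: I_def)
    ultimately show ?thesis
      using fin by simp
  qed
  \<comment> \<open>the module contains \<open>1\<close>, so its generators do not all vanish\<close>
  have 0: "(0, 0) \<in> I" "w (0, 0) \<noteq> 0"
    using m n by (auto simp: I_def w_def)
  show "algebraic_int (x + y)"
  proof (rule algebraic_int_of_finite_module[where w = w, OF fin 0])
    fix k assume "k \<in> I"
    then have "(x + y) * w k \<in> span"
      unfolding distrib_right by (intro span_add x y)
    then show "\<exists>c :: nat \<times> nat \<Rightarrow> int. (x + y) * w k = (\<Sum>j\<in>I. of_int (c j) * w j)"
      by (simp add: span_def)
  qed
  show "algebraic_int (x * y)"
  proof (rule algebraic_int_of_finite_module[where w = w, OF fin 0])
    fix k assume "k \<in> I"
    then have "(x * y) * w k \<in> span"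
      unfolding mult.assoc by (intro x_span y)
    then show "\<exists>c :: nat \<times> nat \<Rightarrow> int. (x * y) * w k = (\<Sum>j\<in>I. of_int (c j) * w j)"
      by (simp add: span_def)
  qed
qed

lemmas algebraic_int_add [intro] = algebraic_int_add_mult(1)
lemmas algebraic_int_mult [intro] = algebraic_int_add_mult(2)

lemma algebraic_int_diff [intro]:
  fixes x y :: "'a::field_char_0"
  shows "algebraic_int x \<Longrightarrow> algebraic_int y \<Longrightarrow> algebraic_int (x - y)"
  using algebraic_int_add[of x "- y"] by simp

lemma algebraic_int_power [intro]:
  fixes x :: "'a::field_char_0"
  shows "algebraic_int x \<Longrightarrow> algebraic_int (x ^ n)"
  by (induction n) auto

lemma algebraic_int_sum [intro]:
  fixes f :: "'b \<Rightarrow> 'a::field_char_0"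
  shows "(\<And>i. i \<in> A \<Longrightarrow> algebraic_int (f i)) \<Longrightarrow> algebraic_int (sum f A)"
  by (induction A rule: infinite_finite_induct) auto

locale number_field_type =
  fixes K :: "'a::field_char_0 itself"
  assumes number_field: "number_field K"
begin

definition qbasis :: "'a set" where
  "qbasis = (SOME B. finite_dimensional_vector_space (\<lambda>(q::rat) (x::'a). of_rat q * x) B)"

lemma finite_dimensional_vector_space_qbasis:
  "finite_dimensional_vector_space (\<lambda>(q::rat) (x::'a). of_rat q * x) qbasis"
  using number_field unfolding number_field_def qbasis_def by (rule someI_ex)

end

sublocale number_field_type \<subseteq> qvs: finite_dimensional_vector_space "\<lambda>(q::rat) (x::'a). of_rat q * x" qbasis
  by (rule finite_dimensional_vector_space_qbasis)

context number_field_type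
begin

lemma rational_dependence:
  fixes w :: "'i \<Rightarrow> 'a"
  assumes "finite I" "card I > card qbasis"
  shows "\<exists>q::'i \<Rightarrow> rat. (\<exists>i\<in>I. q i \<noteq> 0) \<and> (\<Sum>i\<in>I. of_rat (q i) * w i) = 0"
proof (cases "inj_on w I")
  case True
  have "qvs.dependent (w ` I)"
  proof (rule ccontr)
    assume "\<not> qvs.dependent (w ` I)"
    then have "card (w ` I) \<le> qvs.dim UNIV"
      by (intro qvs.independent_card_le_dim) auto
    then show False
      using assms True by (simp add: card_image)
  qed
  then obtain u where u: "\<exists>v\<in>w ` I. u v \<noteq> 0" "(\<Sum>v\<in>w ` I. of_rat (u v) * v) = 0"
    using qvs.dependent_finite[of "w ` I"] assms(1) by auto
  then show ?thesis
    using True by (intro exI[of _ "\<lambda>i. u (w i)"]) (auto simp: sum.reindex)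
next
  case False
  then obtain i j where ij: "i \<in> I" "j \<in> I" "i \<noteq> j" "w i = w j"
    by (auto simp: inj_on_def)
  define q :: "'i \<Rightarrow> rat" where "q = (\<lambda>k. if k = i then 1 else if k = j then -1 else 0)"
  have "(\<Sum>k\<in>I. of_rat (q k) * w k) = (\<Sum>k\<in>{i, j}. of_rat (q k) * w k)"
    using assms(1) ij by (intro sum.mono_neutral_right) (auto simp: q_def)
  also have "\<dots> = 0"
    using ij by (simp add: q_def)
  finally show ?thesis
    using ij by (intro exI[of _ q]) (auto simp: q_def)
qed

lemma rational_poly_root:
  fixes z :: 'a
  shows "\<exists>p::rat poly. p \<noteq> 0 \<and> degree p \<le> card qbasis \<and> poly (map_poly of_rat p) z = 0"
proof -
  let ?n = "card qbasis"
  obtain q :: "nat \<Rightarrow> rat" where q: "\<exists>i\<in>{..?n}. q i \<noteq> 0" "(\<Sum>i\<le>?n. of_rat (q i) * z ^ i) = 0"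
    using rational_dependence[of "{..?n}" "\<lambda>i. z ^ i"] by auto
  define p where "p = (\<Sum>i\<le>?n. monom (q i) i)"
  have coeff_p: "coeff p i = (if i \<le> ?n then q i else 0)" for i
    by (simp add: p_def coeff_sum)
  have "p \<noteq> 0"
    using q(1) coeff_p by (metis atMost_iff coeff_0)
  moreover have deg: "degree p \<le> ?n"
    by (rule degree_le) (simp add: coeff_p)
  moreover have "poly (map_poly of_rat p) z = 0"
  proof -
    have "poly (map_poly of_rat p) z = (\<Sum>i\<le>degree p. of_rat (coeff p i) * z ^ i)"
      by (simp add: poly_altdef)
    also have "\<dots> = (\<Sum>i\<le>?n. of_rat (coeff p i) * z ^ i)"
      using deg by (intro sum.mono_neutral_left) (auto simp: coeff_eq_0)
    also have "\<dots> = 0"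
      using q(2) by (simp add: coeff_p)
    finally show ?thesis .
  qed
  ultimately show ?thesis
    by blast
qed

end

definition embedding :: "('a::field \<Rightarrow> complex) \<Rightarrow> bool" where
  "embedding \<sigma> \<longleftrightarrow> \<sigma> 1 = 1 \<and> (\<forall>x y. \<sigma> (x + y) = \<sigma> x + \<sigma> y) \<and> (\<forall>x y. \<sigma> (x * y) = \<sigma> x * \<sigma> y)"

lemma embedding_simps:
  assumes "embedding \<sigma>"
  shows "\<sigma> 1 = 1" "\<sigma> (x + y) = \<sigma> x + \<sigma> y" "\<sigma> (x * y) = \<sigma> x * \<sigma> y" "\<sigma> 0 = 0" "\<sigma> (- x) = - \<sigma> x"
    "\<sigma> (x - y) = \<sigma> x - \<sigma> y" "\<sigma> (x ^ n) = \<sigma> x ^ n" "\<sigma> (of_nat n) = of_nat n" "\<sigma> (of_int k) = of_int k"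
    "\<sigma> (sum f A) = (\<Sum>i\<in>A. \<sigma> (f i))"
proof -
  show 1: "\<sigma> 1 = 1" and add: "\<sigma> (x + y) = \<sigma> x + \<sigma> y" and mult: "\<sigma> (x * y) = \<sigma> x * \<sigma> y" for x y
    using assms by (auto simp: embedding_def)
  show 0: "\<sigma> 0 = 0"
    using add[of 0 0] by simp
  show minus: "\<sigma> (- x) = - \<sigma> x" for x
    using add[of x "- x"] 0 by (simp add: add_eq_0_iff)
  show "\<sigma> (x - y) = \<sigma> x - \<sigma> y"
    using add[of x "- y"] minus by simp
  show "\<sigma> (x ^ n) = \<sigma> x ^ n"
    by (induction n) (simp_all add: 1 mult)
  show nat: "\<sigma> (of_nat n) = of_nat n" for n
    by (induction n) (simp_all add: 0 1 add)
  show "\<sigma> (of_int k) = of_int k"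
    by (cases k rule: int_cases2) (simp_all add: nat minus)
  show "\<sigma> (sum f A) = (\<Sum>i\<in>A. \<sigma> (f i))"
    by (induction A rule: infinite_finite_induct) (simp_all add: 0 add)
qed

lemma embedding_eq_0_iff:
  assumes "embedding \<sigma>"
  shows "\<sigma> x = 0 \<longleftrightarrow> x = 0"
proof
  assume "\<sigma> x = 0"
  then have "\<sigma> (x * inverse x) = 0"
    by (simp add: embedding_simps[OF assms])
  then show "x = 0"
    using embedding_simps(1)[OF assms] by (cases "x = 0") auto
qed (simp add: embedding_simps[OF assms])

lemma embedding_of_rat:
  fixes \<sigma> :: "'a::field_char_0 \<Rightarrow> complex"
  assumes "embedding \<sigma>"
  shows "\<sigma> (of_rat q) = of_rat q"
proof -
  obtain a b where q: "q = of_int a / of_int b" "b > 0"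
    using quotient_of_div[of q] quotient_of_denom_pos by (metis surj_pair)
  have "\<sigma> (of_rat q * of_int b) = \<sigma> (of_int a)"
    using q by (simp add: of_rat_divide)
  then have "\<sigma> (of_rat q) * of_int b = of_int a"
    by (simp add: embedding_simps[OF assms])
  moreover have "(of_rat q :: complex) * of_int b = of_int a"
    using q by (simp add: of_rat_divide)
  moreover have "of_int b \<noteq> (0 :: complex)"
    using q(2) by simp
  ultimately show ?thesis
    by (metis mult_right_cancel)
qed

lemma embedding_poly:
  assumes "embedding \<sigma>"
  shows "\<sigma> (poly p x) = (\<Sum>i\<le>degree p. \<sigma> (coeff p i) * \<sigma> x ^ i)"
  by (simp add: poly_altdef embedding_simps[OF assms])

lemma embedding_int_poly_root:
  fixes \<sigma> :: "'a::field_char_0 \<Rightarrow> complex"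
  assumes "embedding \<sigma>" "poly (map_poly of_int p) x = 0"
  shows "poly (map_poly of_int p) (\<sigma> x) = 0"
  using arg_cong[OF assms(2), of \<sigma>]
  by (simp add: embedding_poly[OF assms(1)] embedding_simps[OF assms(1)] poly_altdef)

lemma embedding_rat_poly_root:
  fixes \<sigma> :: "'a::field_char_0 \<Rightarrow> complex"
  assumes "embedding \<sigma>" "poly (map_poly of_rat p) x = 0"
  shows "poly (map_poly of_rat p) (\<sigma> x) = 0"
  using arg_cong[OF assms(2), of \<sigma>]
  by (simp add: embedding_poly[OF assms(1)] embedding_simps[OF assms(1)] embedding_of_rat[OF assms(1)] poly_altdef)

lemma embedding_abs_val:
  assumes "embedding \<sigma>"
  shows "abs_val (\<lambda>x. cmod (\<sigma> x))"
  by unfold_locales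
    (auto simp: absolute_value_def embedding_eq_0_iff[OF assms] embedding_simps[OF assms] norm_mult norm_triangle_ineq)

text \<open>
  An embedding with a prescribed value is found among the functionals that are linear over the rationals, as
  a common eigenvector of all multiplications. The polynomial \<open>q\<close> acts on functionals by its value at the
  operator of multiplication by \<open>x\<close>.
\<close>

definition functional :: "('a::field_char_0 \<Rightarrow> complex) \<Rightarrow> bool" where
  "functional f \<longleftrightarrow> (\<forall>x y. f (x + y) = f x + f y) \<and> (\<forall>q x. f (of_rat q * x) = of_rat q * f x)"

definition act :: "'a::field_char_0 \<Rightarrow> complex poly \<Rightarrow> ('a \<Rightarrow> complex) \<Rightarrow> 'a \<Rightarrow> complex" where
  "act x q f y = (\<Sum>j\<le>degree q. coeff q j * f (x ^ j * y))"

lemma functional_0: "functional f \<Longrightarrow> f 0 = 0"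
  unfolding functional_def by (metis add_cancel_right_left)

lemma functional_sum: "functional f \<Longrightarrow> f (\<Sum>i\<in>A. g i) = (\<Sum>i\<in>A. f (g i))"
  by (induction A rule: infinite_finite_induct) (auto simp: functional_0 functional_def)

lemma act_upto:
  assumes "degree q \<le> N"
  shows "act x q f y = (\<Sum>j\<le>N. coeff q j * f (x ^ j * y))"
  unfolding act_def using assms by (intro sum.mono_neutral_left) (auto simp: coeff_eq_0)

lemma act_linear_factor:
  "act x ([:- \<kappa>, 1:] * q) f y = act x q f (x * y) - \<kappa> * act x q f y"
proof -
  define N where "N = degree q"
  have "degree ([:- \<kappa>, 1:] * q) \<le> Suc N"
    using degree_mult_le[of "[:- \<kappa>, 1:]" q] by (simp add: N_def)
  then have "act x ([:- \<kappa>, 1:] * q) f y = (\<Sum>j\<le>Suc N. coeff ([:- \<kappa>, 1:] * q) j * f (x ^ j * y))"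
    by (rule act_upto)
  also have "\<dots> = (\<Sum>j\<le>Suc N. (coeff (pCons 0 q) j - \<kappa> * coeff q j) * f (x ^ j * y))"
    by (intro sum.cong) auto
  also have "\<dots> = (\<Sum>j\<le>Suc N. coeff (pCons 0 q) j * f (x ^ j * y))
      - \<kappa> * (\<Sum>j\<le>Suc N. coeff q j * f (x ^ j * y))"
    by (simp only: left_diff_distrib sum_subtractf sum_distrib_left mult.assoc)
  also have "(\<Sum>j\<le>Suc N. coeff q j * f (x ^ j * y)) = act x q f y"
    by (rule act_upto[symmetric]) (simp add: N_def)
  also have "(\<Sum>j\<le>Suc N. coeff (pCons 0 q) j * f (x ^ j * y)) = act x q f (x * y)"
    unfolding sum.atMost_Suc_shift act_def N_def by (simp add: mult_ac)
  finally show ?thesis .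
qed

lemma act_functional:
  assumes "functional f"
  shows "functional (act x q f)"
  using assms unfolding functional_def act_def
  by (auto simp: distrib_left sum.distrib sum_distrib_left mult.left_commute)

lemma act_annihilator:
  fixes x :: "'a::field_char_0"
  assumes "functional f" "poly (map_poly of_rat p) x = 0"
  shows "act x (map_poly of_rat p) f y = 0"
proof -
  have "act x (map_poly of_rat p) f y = (\<Sum>j\<le>degree p. f (of_rat (coeff p j) * (x ^ j * y)))"
    using assms(1) by (simp add: act_def functional_def)
  also have "\<dots> = f (\<Sum>j\<le>degree p. of_rat (coeff p j) * (x ^ j * y))"
    by (rule functional_sum[OF assms(1), symmetric])
  also have "(\<Sum>j\<le>degree p. of_rat (coeff p j) * (x ^ j * y)) = poly (map_poly of_rat p) x * y"
    by (simp add: poly_altdef sum_distrib_right mult.assoc)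
  finally show ?thesis
    using assms functional_0 by simp
qed

text \<open>
  The actions of different field elements commute, so an eigenvector of one stays an eigenvector of it
  under the action of the others.
\<close>

lemma act_eigen:
  assumes "\<And>y. f (u * y) = \<rho> * f y"
  shows "act x q f (u * y) = \<rho> * act x q f y"
  unfolding act_def sum_distrib_left
  by (intro sum.cong refl) (use assms[of "x ^ _ * y"] in \<open>simp add: mult.left_commute[of _ u]\<close>)

context number_field_type
begin

text \<open>
  A polynomial \<open>q\<close> of least degree whose action at \<open>x\<close> annihilates \<open>f\<close> has a linear factor; the action of the
  cofactor takes \<open>f\<close> to an eigenvector, which is nonzero by minimality.
\<close>

lemma functional_eigen_extend:
  fixes x :: 'a
  assumes f: "functional f" "f \<noteq> (\<lambda>_. 0)"
  shows "\<exists>g \<kappa>. functional g \<and> g \<noteq> (\<lambda>_. 0) \<and> (\<forall>y. g (x * y) = \<kappa> * g y) \<and>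
           (\<forall>u \<rho>. (\<forall>y. f (u * y) = \<rho> * f y) \<longrightarrow> (\<forall>y. g (u * y) = \<rho> * g y))"
proof -
  obtain p :: "rat poly" where p: "p \<noteq> 0" "poly (map_poly of_rat p) x = 0"
    using rational_poly_root[of x] by metis
  define Q where "Q = (\<lambda>d. \<exists>q. q \<noteq> 0 \<and> degree q = d \<and> act x q f = (\<lambda>_. 0))"
  have "Q (degree p)"
    unfolding Q_def
  proof (intro exI[of _ "map_poly of_rat p"] conjI ext)
    show "act x (map_poly of_rat p) f y = 0" for y
      using f(1) p(2) by (rule act_annihilator)
  qed (use p(1) in auto)
  then have "Q (LEAST d. Q d)"
    by (rule LeastI)
  then obtain q where q: "q \<noteq> 0" "degree q = (LEAST d. Q d)" "act x q f = (\<lambda>_. 0)"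
    unfolding Q_def by blast
  have "degree q > 0"
  proof (rule Nat.gr0I)
    assume "degree q = 0"
    then obtain c where c: "q = [:c:]"
      by (rule degree_eq_zeroE)
    then have "c \<noteq> 0" "\<And>y. c * f y = 0"
      using q(1) fun_cong[OF q(3)] by (auto simp: act_def)
    then show False
      using f(2) by auto
  qed
  then obtain \<kappa> where "poly q \<kappa> = 0"
    using alg_closed_imp_poly_has_root by blast
  then obtain r where r: "q = [:- \<kappa>, 1:] * r"
    by (auto simp: poly_eq_0_iff_dvd)
  have r0: "r \<noteq> 0"
    using q(1) r by auto
  have "degree q = Suc (degree r)"
    unfolding r using r0 by (subst degree_mult_eq) auto
  then have "\<not> Q (degree r)"
    using q(2) not_less_Least[of "degree r" Q] by simp
  then have "act x r f \<noteq> (\<lambda>_. 0)"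
    using r0 unfolding Q_def by blast
  moreover have "act x r f (x * y) = \<kappa> * act x r f y" for y
    using fun_cong[OF q(3), of y] unfolding r act_linear_factor by simp
  moreover have "\<forall>y. act x r f (u * y) = \<rho> * act x r f y" if "\<forall>y. f (u * y) = \<rho> * f y" for u \<rho>
    using that by (intro allI act_eigen) simp
  ultimately show ?thesis
    using act_functional[OF f(1)]
    by (intro exI[of _ "act x r f"] exI[of _ \<kappa>] conjI allI impI) simp_all
qed

lemma functional_common_eigen:
  fixes W :: "'a set"
  assumes f: "functional f" "f \<noteq> (\<lambda>_. 0)" and "finite W"
  shows "\<exists>g. functional g \<and> g \<noteq> (\<lambda>_. 0) \<and> (\<forall>x\<in>W. \<exists>\<kappa>. \<forall>y. g (x * y) = \<kappa> * g y) \<and>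
           (\<forall>u \<rho>. (\<forall>y. f (u * y) = \<rho> * f y) \<longrightarrow> (\<forall>y. g (u * y) = \<rho> * g y))"
  using \<open>finite W\<close>
proof (induction W)
  case empty
  then show ?case
    using f by blast
next
  case (insert x W)
  then obtain g where g: "functional g" "g \<noteq> (\<lambda>_. 0)" "\<And>x. x \<in> W \<Longrightarrow> \<exists>\<kappa>. \<forall>y. g (x * y) = \<kappa> * g y"
     "\<And>u \<rho>. (\<forall>y. f (u * y) = \<rho> * f y) \<Longrightarrow> (\<forall>y. g (u * y) = \<rho> * g y)"
    by blast
  obtain h \<kappa> where h: "functional h" "h \<noteq> (\<lambda>_. 0)" "\<forall>y. h (x * y) = \<kappa> * h y"
     "\<And>u \<rho>. (\<forall>y. g (u * y) = \<rho> * g y) \<Longrightarrow> (\<forall>y. h (u * y) = \<rho> * h y)"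
    using functional_eigen_extend[OF g(1,2), of x] by blast
  have "\<exists>\<kappa>. \<forall>y. h (x' * y) = \<kappa> * h y" if "x' \<in> insert x W" for x'
    using that h(3,4) g(3) by (metis insert_iff)
  moreover have "\<forall>y. h (u * y) = \<rho> * h y" if "\<forall>y. f (u * y) = \<rho> * f y" for u \<rho>
    using h(4) g(4) that by blast
  ultimately show ?case
    using h(1,2) by blast
qed

text \<open>
  A common eigenvector \<open>g\<close> of all multiplications satisfies \<open>g (x * y) = l x * g y\<close>, and then \<open>l\<close>, which is \<open>g\<close>
  up to the factor \<open>g 1\<close>, is a ring homomorphism. It is enough to make \<open>g\<close> an eigenvector for a basis.
\<close>

lemma exists_embedding_with_eigenvalue:
  fixes z :: 'a
  assumes f: "functional f" "f \<noteq> (\<lambda>_. 0)" "\<And>y. f (z * y) = \<alpha> * f y"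
  shows "\<exists>\<sigma>. embedding \<sigma> \<and> \<sigma> z = \<alpha>"
proof -
  obtain g where g: "functional g" "g \<noteq> (\<lambda>_. 0)" "\<And>x. x \<in> qbasis \<Longrightarrow> \<exists>\<kappa>. \<forall>y. g (x * y) = \<kappa> * g y"
     "\<And>u \<rho>. (\<forall>y. f (u * y) = \<rho> * f y) \<Longrightarrow> (\<forall>y. g (u * y) = \<rho> * g y)"
    using functional_common_eigen[OF f(1,2) qvs.finite_Basis] by blast
  have eigen: "\<exists>\<kappa>. \<forall>y. g (x * y) = \<kappa> * g y" for x
  proof -
    let ?E = "{x. \<exists>\<kappa>. \<forall>y. g (x * y) = \<kappa> * g y}"
    have add: "g (x + y) = g x + g y" and scale: "g (of_rat q * x) = of_rat q * g x" for x y q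
      using g(1) by (auto simp: functional_def)
    have "qvs.subspace ?E"
    proof (rule qvs.subspaceI)
      show "0 \<in> ?E"
        using functional_0[OF g(1)] by (auto intro!: exI[of _ 0])
      show "x + y \<in> ?E" if xy: "x \<in> ?E" "y \<in> ?E" for x y
      proof -
        obtain a b where "\<And>t. g (x * t) = a * g t" "\<And>t. g (y * t) = b * g t"
          using xy by blast
        then have "\<forall>t. g ((x + y) * t) = (a + b) * g t"
          by (simp add: distrib_right add)
        then show ?thesis
          by blast
      qed
      show "of_rat q * x \<in> ?E" if x: "x \<in> ?E" for q x
      proof -
        obtain a where "\<And>t. g (x * t) = a * g t"
          using x by blast
        then have "\<forall>t. g (of_rat q * x * t) = (of_rat q * a) * g t"
          by (simp add: mult.assoc scale)
        then show ?thesis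
          by blast
      qed
    qed
    then have "qvs.span qbasis \<subseteq> ?E"
      using g(3) by (intro qvs.span_minimal) auto
    then show ?thesis
      unfolding qvs.span_Basis by blast
  qed
  then obtain l where l: "\<And>x y. g (x * y) = l x * g y"
    by metis
  have g1: "g 1 \<noteq> 0"
  proof
    assume "g 1 = 0"
    then have "g x = 0" for x
      using l[of x 1] by simp
    then show False
      using g(2) by blast
  qed
  have lx: "l x = g x / g 1" for x
    using l[of x 1] g1 by simp
  have "embedding l"
    unfolding embedding_def
  proof (intro conjI allI)
    show "l (x + y) = l x + l y" for x y
      using g(1) by (simp add: lx functional_def add_divide_distrib)
    show "l (x * y) = l x * l y" for x y
      using l[of x y] by (simp add: lx)
  qed (use g1 in \<open>simp add: lx\<close>)
  moreover have "l z = \<alpha>"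
  proof -
    have "g (z * 1) = \<alpha> * g 1"
      using g(4)[of z \<alpha>] f(3) by blast
    then show ?thesis
      using l[of z 1] g1 by simp
  qed
  ultimately show ?thesis
    by blast
qed

lemma exists_min_poly:
  fixes z :: 'a
  shows "\<exists>m::rat poly. lead_coeff m = 1 \<and> degree m \<le> card qbasis \<and> poly (map_poly of_rat m) z = 0 \<and>
    (\<forall>p. p \<noteq> 0 \<longrightarrow> degree p < degree m \<longrightarrow> poly (map_poly of_rat p) z \<noteq> 0)"
proof -
  define Q where "Q = (\<lambda>d. \<exists>p::rat poly. p \<noteq> 0 \<and> degree p = d \<and> poly (map_poly of_rat p) z = 0)"
  obtain p0 :: "rat poly" where p0: "p0 \<noteq> 0" "degree p0 \<le> card qbasis" "poly (map_poly of_rat p0) z = 0"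
    using rational_poly_root[of z] by metis
  then have Q0: "Q (degree p0)"
    unfolding Q_def by blast
  then have "Q (LEAST d. Q d)"
    by (rule LeastI)
  then obtain p where p: "p \<noteq> 0" "degree p = (LEAST d. Q d)" "poly (map_poly of_rat p) z = 0"
    unfolding Q_def by blast
  define m where "m = Polynomial.smult (inverse (lead_coeff p)) p"
  have dm: "degree m = degree p"
    using p(1) by (simp add: m_def)
  have "poly (map_poly of_rat m) z = of_rat (inverse (lead_coeff p)) * poly (map_poly of_rat p) z"
    unfolding m_def by (subst map_poly_smult) (simp_all add: of_rat_mult)
  then have "poly (map_poly of_rat m) z = 0"
    using p(3) by simp
  moreover have "lead_coeff m = 1"
    using p(1) by (simp add: m_def)
  moreover have "poly (map_poly of_rat r) z \<noteq> 0" if "r \<noteq> 0" "degree r < degree m" for r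
  proof -
    have "\<not> Q (degree r)"
      using that(2) not_less_Least[of "degree r" Q] p(2) dm by simp
    then show ?thesis
      unfolding Q_def using that(1) by metis
  qed
  moreover have "degree m \<le> card qbasis"
    using p0(2) Least_le[of Q, OF Q0] p(2) dm by simp
  ultimately show ?thesis
    by (intro exI[of _ m] conjI allI impI)
qed

text \<open>
  Take a functional that vanishes on all powers of \<open>z\<close> below the degree of \<open>q\<close> and is \<open>1\<close> on the next one, where
  \<open>q\<close> is the minimal polynomial divided by the factor of the root. The action of \<open>q\<close> at \<open>z\<close> turns it into an
  eigenvector with the root as eigenvalue; it is nonzero because its value at \<open>1\<close> is the leading
  coefficient of \<open>q\<close>.
\<close>

lemma embedding_of_min_poly_root:
  fixes z :: 'a and m :: "rat poly"
  assumes m: "lead_coeff m = 1" "poly (map_poly of_rat m) z = 0"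
    and min: "\<And>p. p \<noteq> 0 \<Longrightarrow> degree p < degree m \<Longrightarrow> poly (map_poly of_rat p) z \<noteq> 0"
    and \<alpha>: "poly (map_poly of_rat m) (\<alpha>::complex) = 0"
  shows "\<exists>\<sigma>. embedding \<sigma> \<and> \<sigma> z = \<alpha>"
proof -
  define M :: "complex poly" where "M = map_poly of_rat m"
  have M: "degree M = degree m" "lead_coeff M = 1"
    using m(1) by (simp_all add: M_def)
  have "poly M \<alpha> = 0"
    using \<alpha> by (simp add: M_def)
  then obtain q where q: "M = [:- \<alpha>, 1:] * q"
    by (auto simp: poly_eq_0_iff_dvd)
  have q0: "q \<noteq> 0"
    using M(2) q by auto
  define r where "r = degree q"
  have r: "degree m = Suc r"
    using M(1) unfolding q r_def using q0 by (subst (asm) degree_mult_eq) auto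
  have lq: "lead_coeff q = 1"
    using M(2) unfolding q lead_coeff_mult by simp
  have min_sum: "c i = 0" if "(\<Sum>i\<le>r. of_rat (c i) * z ^ i) = 0" "i \<le> r" for c :: "nat \<Rightarrow> rat" and i
  proof -
    define p where "p = (\<Sum>i\<le>r. monom (c i) i)"
    have coeff_p: "coeff p i = (if i \<le> r then c i else 0)" for i
      by (simp add: p_def coeff_sum)
    have deg: "degree p \<le> r"
      by (rule degree_le) (simp add: coeff_p)
    have "poly (map_poly of_rat p) z = (\<Sum>i\<le>r. of_rat (coeff p i) * z ^ i)"
      using deg by (simp add: poly_altdef) (intro sum.mono_neutral_left, auto simp: coeff_eq_0)
    also have "\<dots> = 0"
      using that(1) by (simp add: coeff_p)
    finally have "p = 0"
      using min[of p] deg r by auto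
    then show ?thesis
      using coeff_p[of i] that(2) by simp
  qed
  have inj: "inj_on (\<lambda>i. z ^ i) {..r}"
  proof (rule inj_onI, rule ccontr)
    fix i j assume ij: "i \<in> {..r}" "j \<in> {..r}" "z ^ i = z ^ j" "i \<noteq> j"
    define c :: "nat \<Rightarrow> rat" where "c = (\<lambda>k. if k = i then 1 else if k = j then -1 else 0)"
    have "(\<Sum>k\<le>r. of_rat (c k) * z ^ k) = (\<Sum>k\<in>{i, j}. of_rat (c k) * z ^ k)"
      using ij by (intro sum.mono_neutral_right) (auto simp: c_def)
    also have "\<dots> = 0"
      using ij by (simp add: c_def)
    finally show False
      using min_sum[of c i] ij by (simp add: c_def)
  qed
  have indep: "qvs.independent ((\<lambda>i. z ^ i) ` {..r})"
  proof
    assume "qvs.dependent ((\<lambda>i. z ^ i) ` {..r})"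
    then obtain u where u: "\<exists>v\<in>(\<lambda>i. z ^ i) ` {..r}. u v \<noteq> 0" "(\<Sum>v\<in>(\<lambda>i. z ^ i) ` {..r}. of_rat (u v) * v) = 0"
      using qvs.dependent_finite[of "(\<lambda>i. z ^ i) ` {..r}"] by auto
    then have "(\<Sum>i\<le>r. of_rat (u (z ^ i)) * z ^ i) = 0"
      using inj by (simp add: sum.reindex)
    then show False
      using min_sum[of "\<lambda>i. u (z ^ i)"] u(1) by auto
  qed
  interpret pair: vector_space_pair "\<lambda>(q::rat) (x::'a). of_rat q * x" "\<lambda>(q::rat) (x::complex). of_rat q * x"
    by unfold_locales (auto simp: algebra_simps of_rat_add of_rat_mult)
  obtain f where f: "Vector_Spaces.linear (\<lambda>q x. of_rat q * x) (\<lambda>q x. of_rat q * x) f"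
      "\<forall>x\<in>(\<lambda>i. z ^ i) ` {..r}. f x = (if x = z ^ r then 1 else (0::complex))"
    using pair.linear_independent_extend[OF indep, of "\<lambda>x. if x = z ^ r then 1 else 0"] by blast
  have lin: "functional f"
    unfolding functional_def using f(1)
    by (simp add: Vector_Spaces.linear_iff)
  have fz: "f (z ^ i) = (if i = r then 1 else 0)" if "i \<le> r" for i
    using f(2) that inj by (auto simp: inj_on_def)
  have "act z q f 1 = (\<Sum>j\<le>r. coeff q j * f (z ^ j))"
    by (simp add: act_def r_def)
  also have "\<dots> = (\<Sum>j\<le>r. if j = r then coeff q r else 0)"
    by (intro sum.cong) (auto simp: fz)
  also have "\<dots> = 1"
    using lq by (simp add: r_def)
  finally have "act z q f \<noteq> (\<lambda>_. 0)"
    by (metis zero_neq_one)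
  moreover have "act z q f (z * y) = \<alpha> * act z q f y" for y
    using act_annihilator[OF lin m(2), of y] act_linear_factor[of z \<alpha> q f y]
    unfolding M_def[symmetric] q by simp
  ultimately show ?thesis
    by (rule exists_embedding_with_eigenvalue[OF act_functional[OF lin]])
qed

end

lemma linear_factors_coeffs:
  fixes A :: "complex multiset"
  assumes "\<And>\<alpha>. \<alpha> \<in># A \<Longrightarrow> algebraic_int \<alpha>" "\<And>\<alpha>. \<alpha> \<in># A \<Longrightarrow> cmod \<alpha> \<le> R" "R \<ge> 0"
  shows "algebraic_int (coeff (\<Prod>\<alpha>\<in>#A. [:- \<alpha>, 1:]) i) \<and>
         cmod (coeff (\<Prod>\<alpha>\<in>#A. [:- \<alpha>, 1:]) i) \<le> (1 + R) ^ size A"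
  using assms(1,2)
proof (induction A arbitrary: i)
  case empty
  then show ?case
    by (simp add: coeff_1)
next
  case (add \<alpha> A)
  define P where "P = (\<Prod>\<alpha>\<in>#A. [:- \<alpha>, 1:])"
  have IH: "algebraic_int (coeff P j)" "cmod (coeff P j) \<le> (1 + R) ^ size A" for j
    using add.IH[of j] add.prems by (simp_all add: P_def)
  have \<alpha>: "algebraic_int \<alpha>" "cmod \<alpha> \<le> R"
    using add.prems by simp_all
  define c where "c = (if i = 0 then 0 else coeff P (i - 1))"
  have coeff: "coeff (\<Prod>\<alpha>\<in>#add_mset \<alpha> A. [:- \<alpha>, 1:]) i = c - \<alpha> * coeff P i"
    by (cases i) (simp_all add: P_def[symmetric] c_def)
  have c: "algebraic_int c" "cmod c \<le> (1 + R) ^ size A"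
    using IH[of "i - 1"] assms(3) by (auto simp: c_def)
  have "cmod (c - \<alpha> * coeff P i) \<le> cmod c + cmod \<alpha> * cmod (coeff P i)"
    using norm_triangle_ineq4[of c "\<alpha> * coeff P i"] by (simp add: norm_mult)
  also have "\<dots> \<le> (1 + R) ^ size A + R * (1 + R) ^ size A"
    using c \<alpha> IH(2)[of i] assms(3) by (intro add_mono mult_mono) auto
  finally have "cmod (c - \<alpha> * coeff P i) \<le> (1 + R) ^ size (add_mset \<alpha> A)"
    by (simp add: distrib_right)
  moreover have "algebraic_int (c - \<alpha> * coeff P i)"
    using c(1) \<alpha>(1) IH(1) by (intro algebraic_int_diff algebraic_int_mult)
  ultimately show ?case
    unfolding coeff by blast
qed

lemma embedding_algebraic_int:
  fixes \<sigma> :: "'a::field_char_0 \<Rightarrow> complex"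
  assumes "embedding \<sigma>" "algebraic_int x"
  shows "algebraic_int (\<sigma> x)"
  using assms embedding_int_poly_root[OF assms(1)] unfolding algebraic_int_altdef_ipoly by blast

lemma of_rat_in_Ints_imp:
  assumes "(of_rat q :: 'b::field_char_0) \<in> \<int>"
  shows "q \<in> \<int>"
proof -
  obtain k where "(of_rat q :: 'b) = of_int k"
    using assms by (auto elim: Ints_cases)
  then have "(of_rat q :: 'b) = of_rat (of_int k)"
    by simp
  then have "q = of_int k"
    by (simp only: of_rat_eq_iff)
  then show ?thesis
    by simp
qed

context number_field_type
begin

text \<open>
  Every root of the rational minimal polynomial is the image of \<open>z\<close> under an embedding, hence an algebraic
  integer. So the coefficients are rational algebraic integers, that is, integers.
\<close>

lemma integral_min_poly:
  fixes z :: 'a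
  assumes "algebraic_int z"
  shows "\<exists>p A. lead_coeff p = 1 \<and> degree p \<le> card qbasis \<and> poly (map_poly of_int p) z = 0 \<and>
    size A = degree p \<and> (map_poly of_int p :: complex poly) = (\<Prod>\<alpha>\<in>#A. [:- \<alpha>, 1:]) \<and>
    (\<forall>\<alpha>\<in>#A. \<exists>\<sigma>. embedding \<sigma> \<and> \<sigma> z = \<alpha>) \<and> (z \<noteq> 0 \<longrightarrow> coeff p 0 \<noteq> 0)"
proof -
  obtain m :: "rat poly" where m: "lead_coeff m = 1" "degree m \<le> card qbasis" "poly (map_poly of_rat m) z = 0"
    and min: "\<And>p. p \<noteq> 0 \<Longrightarrow> degree p < degree m \<Longrightarrow> poly (map_poly of_rat p) z \<noteq> 0"
    using exists_min_poly[of z] by metis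
  define M :: "complex poly" where "M = map_poly of_rat m"
  have M: "degree M = degree m" "lead_coeff M = 1"
    using m(1) by (simp_all add: M_def)
  then have "M \<noteq> 0"
    by auto
  then obtain A where A: "size A = degree M" "M = (\<Prod>\<alpha>\<in>#A. [:- \<alpha>, 1:])"
    using alg_closed_imp_factorization[of M] M(2) by auto
  have emb: "\<exists>\<sigma>. embedding \<sigma> \<and> \<sigma> z = \<alpha>" if "\<alpha> \<in># A" for \<alpha>
  proof (rule embedding_of_min_poly_root[OF m(1,3) min])
    have "poly M \<alpha> = (\<Prod>\<beta>\<in>#A. poly [:- \<beta>, 1:] \<alpha>)"
      unfolding A(2) by (rule poly_prod_mset)
    also have "\<dots> = 0"
      using that by (auto simp: prod_mset_zero_iff intro!: image_eqI[of _ _ \<alpha>])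
    finally show "poly (map_poly of_rat m) \<alpha> = 0"
      by (simp add: M_def)
  qed auto
  have alg: "algebraic_int \<alpha>" if "\<alpha> \<in># A" for \<alpha>
    using emb[OF that] embedding_algebraic_int[OF _ assms] by metis
  define R where "R = (\<Sum>\<alpha>\<in>set_mset A. cmod \<alpha>)"
  have R: "cmod \<alpha> \<le> R" if "\<alpha> \<in># A" for \<alpha>
    unfolding R_def using that by (intro member_le_sum) auto
  have "R \<ge> 0"
    unfolding R_def by (intro sum_nonneg) auto
  have int: "coeff m i \<in> \<int>" for i
  proof -
    have "algebraic_int (coeff M i)"
      using linear_factors_coeffs[of A R i, OF alg R \<open>R \<ge> 0\<close>] A(2) by simp
    moreover have "coeff M i = of_rat (coeff m i)"
      by (simp add: M_def)
    ultimately have "(of_rat (coeff m i) :: complex) \<in> \<int>"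
      using rational_algebraic_int_is_int[of "coeff M i"] by simp
    then show ?thesis
      by (rule of_rat_in_Ints_imp)
  qed
  define p where "p = map_poly floor m"
  have mp: "m = map_poly of_int p"
    using int by (intro poly_eqI) (auto simp: p_def coeff_map_poly elim!: Ints_cases)
  have degp: "degree p = degree m"
    unfolding mp by simp
  have conv: "(map_poly of_rat m :: 'b::field_char_0 poly) = map_poly of_int p"
    unfolding mp by (intro poly_eqI) (simp add: coeff_map_poly)
  show ?thesis
  proof (intro exI[of _ p] exI[of _ A] conjI ballI impI)
    show "lead_coeff p = 1"
      using m(1) unfolding mp by simp
    show "degree p \<le> card qbasis"
      using m(2) degp by simp
    show "poly (map_poly of_int p) z = 0"
      using m(3) unfolding conv .
    show "size A = degree p"
      using A(1) M(1) degp by simp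
    show "map_poly of_int p = (\<Prod>\<alpha>\<in>#A. [:- \<alpha>, 1:])"
      using A(2) unfolding M_def conv .
    show "\<exists>\<sigma>. embedding \<sigma> \<and> \<sigma> z = \<alpha>" if "\<alpha> \<in># A" for \<alpha>
      by (rule emb[OF that])
    assume z: "z \<noteq> 0"
    show "coeff p 0 \<noteq> 0"
    proof
      assume "coeff p 0 = 0"
      then have m0: "coeff m 0 = 0"
        unfolding mp by simp
      obtain c r where cr: "m = pCons c r"
        by (cases m)
      then have c: "c = 0"
        using m0 by simp
      have r0: "r \<noteq> 0"
        using m(1) cr c by auto
      have "poly (map_poly of_rat m) z = z * poly (map_poly of_rat r) z"
        unfolding cr c by (subst map_poly_pCons) (simp_all add: r0)
      then have "poly (map_poly of_rat r) z = 0"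
        using m(3) z by simp
      moreover have "degree r < degree m"
        unfolding cr using r0 by simp
      ultimately show False
        using min[OF r0] by simp
    qed
  qed
qed

lemma finite_bounded_int_polys: "finite {p::int poly. degree p \<le> n \<and> (\<forall>i. \<bar>coeff p i\<bar> \<le> M)}"
proof (rule finite_subset)
  show "{p::int poly. degree p \<le> n \<and> (\<forall>i. \<bar>coeff p i\<bar> \<le> M)}
      \<subseteq> Poly ` {xs. set xs \<subseteq> {-M..M} \<and> length xs \<le> Suc n}"
  proof
    fix p :: "int poly" assume "p \<in> {p. degree p \<le> n \<and> (\<forall>i. \<bar>coeff p i\<bar> \<le> M)}"
    then have p: "degree p \<le> n" "\<And>i. \<bar>coeff p i\<bar> \<le> M"
      by auto
    have "length (coeffs p) \<le> Suc n"
      using p(1) by (simp add: length_coeffs coeffs_def)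
    moreover have "x \<in> {-M..M}" if "x \<in> set (coeffs p)" for x
      using that p(2) by (auto simp: coeffs_def abs_le_iff minus_le_iff split: if_splits)
    ultimately show "p \<in> Poly ` {xs. set xs \<subseteq> {-M..M} \<and> length xs \<le> Suc n}"
      by (intro image_eqI[of _ _ "coeffs p"]) auto
  qed
  show "finite (Poly ` {xs. set xs \<subseteq> {-M..M} \<and> length xs \<le> Suc n})"
    by (intro finite_imageI finite_lists_length_le) auto
qed

text \<open>
  Northcott's argument: bounded conjugates bound the coefficients of the integral minimal polynomial, whose
  degree is bounded by the degree of the field.
\<close>

lemma finite_algebraic_ints_bounded_conjugates:
  "finite {z::'a. algebraic_int z \<and> (\<forall>\<sigma>. embedding \<sigma> \<longrightarrow> cmod (\<sigma> z) \<le> R)}"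
proof (cases "R \<ge> 0")
  case R: True
  define N where "N = card qbasis"
  define M where "M = \<lceil>(1 + R) ^ N\<rceil>"
  define S where "S = {p::int poly. degree p \<le> N \<and> (\<forall>i. \<bar>coeff p i\<bar> \<le> M)} - {0}"
  show ?thesis
  proof (rule finite_subset)
    show "{z::'a. algebraic_int z \<and> (\<forall>\<sigma>. embedding \<sigma> \<longrightarrow> cmod (\<sigma> z) \<le> R)}
        \<subseteq> (\<Union>p\<in>S. {z. poly (map_poly of_int p) z = 0})"
    proof
      fix z :: 'a assume z: "z \<in> {z. algebraic_int z \<and> (\<forall>\<sigma>. embedding \<sigma> \<longrightarrow> cmod (\<sigma> z) \<le> R)}"
      then have "algebraic_int z"
        by simp
      then obtain p A where p: "lead_coeff p = 1" "degree p \<le> N" "poly (map_poly of_int p) z = 0"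
        "size A = degree p" "(map_poly of_int p :: complex poly) = (\<Prod>\<alpha>\<in>#A. [:- \<alpha>, 1:])"
        "\<And>\<alpha>. \<alpha> \<in># A \<Longrightarrow> \<exists>\<sigma>. embedding \<sigma> \<and> \<sigma> z = \<alpha>"
        unfolding N_def using integral_min_poly[of z] by metis
      have alg: "algebraic_int \<alpha>" if "\<alpha> \<in># A" for \<alpha>
        using p(6)[OF that] embedding_algebraic_int[OF _ \<open>algebraic_int z\<close>] by metis
      have bd: "cmod \<alpha> \<le> R" if "\<alpha> \<in># A" for \<alpha>
        using p(6)[OF that] z by auto
      have "\<bar>coeff p i\<bar> \<le> M" for i
      proof -
        have "cmod (coeff (map_poly of_int p) i) \<le> (1 + R) ^ size A"
          using linear_factors_coeffs[of A R i, OF alg bd R] p(5) by simp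
        also have "\<dots> \<le> (1 + R) ^ N"
          using p(2,4) R by (intro power_increasing) auto
        finally have "real_of_int \<bar>coeff p i\<bar> \<le> (1 + R) ^ N"
          by (simp add: coeff_map_poly)
        then show ?thesis
          unfolding M_def by linarith
      qed
      moreover have "p \<noteq> 0"
        using p(1) by auto
      ultimately show "z \<in> (\<Union>p\<in>S. {z. poly (map_poly of_int p) z = 0})"
        using p(2,3) by (intro UN_I[of p]) (auto simp: S_def)
    qed
    have "finite S"
      unfolding S_def by (intro finite_Diff finite_bounded_int_polys)
    moreover have "finite {z::'a. poly (map_poly of_int p) z = 0}" if "p \<in> S" for p
      using that by (intro poly_roots_finite) (auto simp: S_def)
    ultimately show "finite (\<Union>p\<in>S. {z::'a. poly (map_poly of_int p) z = 0})"
      by blast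
  qed
next
  case False
  have "{z::'a. algebraic_int z \<and> (\<forall>\<sigma>. embedding \<sigma> \<longrightarrow> cmod (\<sigma> z) \<le> R)} \<subseteq> {}"
  proof
    fix z :: 'a assume z: "z \<in> {z. algebraic_int z \<and> (\<forall>\<sigma>. embedding \<sigma> \<longrightarrow> cmod (\<sigma> z) \<le> R)}"
    then obtain p A where p: "lead_coeff p = 1" "poly (map_poly of_int p) z = 0"
        "size A = degree p" "\<And>\<alpha>. \<alpha> \<in># A \<Longrightarrow> \<exists>\<sigma>. embedding \<sigma> \<and> \<sigma> z = \<alpha>"
      using integral_min_poly[of z] by (metis (no_types, lifting) mem_Collect_eq)
    have "degree p \<noteq> 0"
    proof
      assume "degree p = 0"
      then obtain c where "p = [:c:]"
        by (rule degree_eq_zeroE)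
      then show False
        using p(1,2) by (simp add: map_poly_pCons)
    qed
    then obtain \<alpha> where "\<alpha> \<in># A"
      using p(3) by (metis multiset_nonemptyE size_empty)
    then obtain \<sigma> where "embedding \<sigma>" "\<sigma> z = \<alpha>"
      using p(4) by metis
    then have "cmod (\<sigma> z) \<le> R"
      using z by blast
    then show "z \<in> {}"
      using False norm_ge_zero[of "\<sigma> z"] by linarith
  qed
  then show ?thesis
    using finite_subset by blast
qed

text \<open>
  The integer is the constant coefficient of the integral minimal polynomial. It is a product of conjugates
  of \<open>z\<close> up to sign, which is nonzero and therefore has absolute value at least \<open>1\<close>; so no conjugate is
  small unless another one is large.
\<close>

lemma algebraic_int_divides_integer_bounded:
  fixes z :: 'a and R :: real
  assumes z: "algebraic_int z" "z \<noteq> 0" and R: "R \<ge> 1" "\<And>\<sigma>. embedding \<sigma> \<Longrightarrow> cmod (\<sigma> z) \<le> R"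
  shows "\<exists>c::int. c \<noteq> 0 \<and> \<bar>c\<bar> \<le> R ^ card qbasis \<and> algebraic_int (of_int c / z)"
    and "\<And>\<sigma>. embedding \<sigma> \<Longrightarrow> 1 \<le> cmod (\<sigma> z) * R ^ card qbasis"
proof -
  obtain p A where p: "lead_coeff p = 1" "degree p \<le> card qbasis" "poly (map_poly of_int p) z = 0"
    "size A = degree p" "(map_poly of_int p :: complex poly) = (\<Prod>\<alpha>\<in>#A. [:- \<alpha>, 1:])"
    "\<And>\<alpha>. \<alpha> \<in># A \<Longrightarrow> \<exists>\<sigma>. embedding \<sigma> \<and> \<sigma> z = \<alpha>" "coeff p 0 \<noteq> 0"
    using integral_min_poly[OF z(1)] z(2) by metis
  define c where "c = coeff p 0"
  have bd: "cmod \<alpha> \<le> R" if "\<alpha> \<in># A" for \<alpha>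
    using p(6)[OF that] R by auto
  have prod_bd: "cmod (\<Prod>\<alpha>\<in>#B. - \<alpha>) \<le> R ^ size B" if "set_mset B \<subseteq> set_mset A" for B
    using that
  proof (induction B)
    case (add \<alpha> B)
    then show ?case
      using bd[of \<alpha>] R(1) by (simp add: norm_mult mult_mono)
  qed simp
  have "of_int c = poly (map_poly of_int p) (0::complex)"
    by (simp add: c_def poly_0_coeff_0 coeff_map_poly)
  also have "\<dots> = (\<Prod>\<alpha>\<in>#A. - \<alpha>)"
    unfolding p(5) poly_prod_mset by simp
  finally have c: "of_int c = (\<Prod>\<alpha>\<in>#A. - \<alpha>)" .
  have "R ^ size A \<le> R ^ card qbasis"
    using p(2,4) R(1) by (intro power_increasing) auto
  then have "cmod (of_int c) \<le> R ^ card qbasis"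
    unfolding c using prod_bd[of A] by simp
  then have 1: "\<bar>c\<bar> \<le> R ^ card qbasis"
    by simp
  have c1: "1 \<le> cmod (of_int c)"
    using p(7) by (simp add: c_def)
  obtain q where q: "p = pCons c q"
    unfolding c_def by (cases p) auto
  have "of_int c + z * poly (map_poly of_int q) z = 0"
    using p(3,7) unfolding q by (subst (asm) map_poly_pCons) simp_all
  then have "of_int c / z = - poly (map_poly of_int q) z"
    using z(2) by (simp add: field_simps eq_neg_iff_add_eq_0)
  moreover have "algebraic_int (poly (map_poly of_int q) z)"
    unfolding poly_altdef using z(1)
    by (intro algebraic_int_sum algebraic_int_mult algebraic_int_power) (auto simp: coeff_map_poly)
  ultimately have "algebraic_int (of_int c / z)"
    by simp
  then show "\<exists>c::int. c \<noteq> 0 \<and> \<bar>c\<bar> \<le> R ^ card qbasis \<and> algebraic_int (of_int c / z)"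
    using 1 p(7) by (intro exI[of _ c]) (simp add: c_def)
  fix \<sigma> :: "'a \<Rightarrow> complex" assume \<sigma>: "embedding \<sigma>"
  have "poly (map_poly of_int p) (\<sigma> z) = 0"
    by (rule embedding_int_poly_root[OF \<sigma> p(3)])
  then have "(\<Prod>\<alpha>\<in>#A. poly [:- \<alpha>, 1:] (\<sigma> z)) = 0"
    unfolding p(5) poly_prod_mset .
  then have mem: "\<sigma> z \<in># A"
    by (auto simp: prod_mset_zero_iff)
  have "1 \<le> cmod (- \<sigma> z * (\<Prod>\<alpha>\<in>#A - {#\<sigma> z#}. - \<alpha>))"
    using c1 unfolding c by (subst (asm) prod_mset.remove[of "- \<sigma> z"]) (use mem in \<open>auto simp: image_mset_Diff\<close>)
  also have "\<dots> = cmod (\<sigma> z) * cmod (\<Prod>\<alpha>\<in>#A - {#\<sigma> z#}. - \<alpha>)"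
    by (simp add: norm_mult)
  also have "\<dots> \<le> cmod (\<sigma> z) * R ^ size (A - {#\<sigma> z#})"
    by (intro mult_left_mono prod_bd) (auto dest: in_diffD)
  also have "\<dots> \<le> cmod (\<sigma> z) * R ^ card qbasis"
    using p(2,4) R(1) mem by (intro mult_left_mono power_increasing) (auto simp: size_Diff_singleton)
  finally show "1 \<le> cmod (\<sigma> z) * R ^ card qbasis" .
qed

text \<open>
  An embedding is determined by its values on a basis, each of which is a root of a fixed polynomial.
\<close>

lemma finite_embeddings: "finite {\<sigma> :: 'a \<Rightarrow> complex. embedding \<sigma>}"
proof -
  obtain m :: "'a \<Rightarrow> rat poly" where m: "\<And>z. m z \<noteq> 0" "\<And>z. poly (map_poly of_rat (m z)) z = 0"
    using rational_poly_root by metis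
  define T where "T = (\<lambda>b. {w::complex. poly (map_poly of_rat (m b)) w = 0})"
  have "finite (T b)" for b
    unfolding T_def using m(1) by (intro poly_roots_finite) auto
  then have fin: "finite (PiE qbasis T)"
    using qvs.finite_Basis by (intro finite_PiE) auto
  have sub: "(\<lambda>\<sigma>. restrict \<sigma> qbasis) ` {\<sigma>. embedding \<sigma>} \<subseteq> PiE qbasis T"
  proof
    fix f assume "f \<in> (\<lambda>\<sigma>. restrict \<sigma> qbasis) ` {\<sigma>. embedding \<sigma>}"
    then obtain \<sigma> where \<sigma>: "embedding \<sigma>" "f = restrict \<sigma> qbasis"
      by blast
    show "f \<in> PiE qbasis T"
      unfolding \<sigma>(2) T_def using embedding_rat_poly_root[OF \<sigma>(1) m(2)] by simp
  qed
  have "inj_on (\<lambda>\<sigma>. restrict \<sigma> qbasis) {\<sigma> :: 'a \<Rightarrow> complex. embedding \<sigma>}"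
  proof (rule inj_onI)
    fix \<sigma> \<tau> :: "'a \<Rightarrow> complex"
    assume "\<sigma> \<in> {\<sigma>. embedding \<sigma>}" "\<tau> \<in> {\<sigma>. embedding \<sigma>}" and eq: "restrict \<sigma> qbasis = restrict \<tau> qbasis"
    then have \<sigma>: "embedding \<sigma>" and \<tau>: "embedding \<tau>"
      by auto
    let ?E = "{x. \<sigma> x = \<tau> x}"
    have "qvs.subspace ?E"
      by (rule qvs.subspaceI)
        (auto simp: embedding_simps[OF \<sigma>] embedding_simps[OF \<tau>] embedding_of_rat[OF \<sigma>] embedding_of_rat[OF \<tau>])
    moreover have "qbasis \<subseteq> ?E"
      using eq by (auto simp: restrict_def fun_eq_iff split: if_splits)
    ultimately have "qvs.span qbasis \<subseteq> ?E"
      by (intro qvs.span_minimal)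
    then show "\<sigma> = \<tau>"
      unfolding qvs.span_Basis by auto
  qed
  then show ?thesis
    using finite_imageD finite_subset[OF sub fin] by blast
qed

end

section \<open>Finiteness of residue rings\<close>

lemma clear_denominators:
  fixes q :: "'i \<Rightarrow> rat"
  assumes "finite I"
  shows "\<exists>N c. N > (0::int) \<and> (\<forall>i\<in>I. of_int (c i) = of_int N * q i)"
  using assms
proof (induction I)
  case (insert j I)
  then obtain N c where N: "N > 0" "\<And>i. i \<in> I \<Longrightarrow> of_int (c i) = of_int N * q i"
    by blast
  obtain a b where ab: "q j = of_int a / of_int b" "b > 0"
    using quotient_of_div[of "q j"] quotient_of_denom_pos by (metis surj_pair)
  have "of_int (if i = j then N * a else b * c i) = of_int (N * b) * q i" if "i \<in> insert j I" for i
    using that N(2) ab by auto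
  then show ?case
    using N(1) ab(2)
    by (intro exI[of _ "N * b"] exI[of _ "\<lambda>i. if i = j then N * a else b * c i"]) auto
qed (auto intro: exI[of _ 1])

text \<open>
  Descent on the sum of absolute values: a relation whose coefficients are all divisible by \<open>p\<close> can be divided
  by \<open>p\<close>.
\<close>

lemma integer_relation_not_all_divisible:
  fixes c :: "'i \<Rightarrow> int" and w :: "'i \<Rightarrow> 'a::field_char_0"
  assumes "finite I" "p > 1" "\<exists>i\<in>I. c i \<noteq> 0" "(\<Sum>i\<in>I. of_int (c i) * w i) = 0"
  shows "\<exists>d. (\<exists>i\<in>I. \<not> p dvd d i) \<and> (\<Sum>i\<in>I. of_int (d i) * w i) = 0"
  using assms(3,4)
proof (induction "nat (\<Sum>i\<in>I. \<bar>c i\<bar>)" arbitrary: c rule: less_induct)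
  case less
  show ?case
  proof (cases "\<exists>i\<in>I. \<not> p dvd c i")
    case False
    define d where "d = (\<lambda>i. c i div p)"
    have d: "c i = p * d i" if "i \<in> I" for i
      using False that by (simp add: d_def)
    have "of_int p * (\<Sum>i\<in>I. of_int (d i) * w i) = (\<Sum>i\<in>I. of_int (c i) * w i)"
      unfolding sum_distrib_left by (intro sum.cong refl) (simp add: d mult.assoc)
    then have "(\<Sum>i\<in>I. of_int (d i) * w i) = 0"
      using less.prems(2) assms(2) by simp
    moreover obtain j where j: "j \<in> I" "d j \<noteq> 0"
      using less.prems(1) d by fastforce
    moreover have less: "(\<Sum>i\<in>I. \<bar>d i\<bar>) < (\<Sum>i\<in>I. \<bar>c i\<bar>)"
    proof (rule sum_strict_mono_ex1[OF assms(1)])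
      have "\<bar>c i\<bar> = p * \<bar>d i\<bar>" if "i \<in> I" for i
        using d[OF that] assms(2) by (simp add: abs_mult)
      moreover have "\<bar>d i\<bar> \<le> p * \<bar>d i\<bar>" for i
        using assms(2) mult_right_mono[of 1 p "\<bar>d i\<bar>"] by simp
      ultimately show "\<forall>i\<in>I. \<bar>d i\<bar> \<le> \<bar>c i\<bar>"
        by simp
      have "1 * \<bar>d j\<bar> < p * \<bar>d j\<bar>"
        using j assms(2) by (intro mult_strict_right_mono) auto
      then show "\<exists>i\<in>I. \<bar>d i\<bar> < \<bar>c i\<bar>"
        using j d[OF j(1)] assms(2) by (intro bexI[of _ j]) (simp_all add: abs_mult)
    qed
    moreover have "nat (\<Sum>i\<in>I. \<bar>d i\<bar>) < nat (\<Sum>i\<in>I. \<bar>c i\<bar>)"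
      using less sum_nonneg[of I "\<lambda>i. \<bar>d i\<bar>"] by linarith
    ultimately show ?thesis
      using less.hyps[of d] by blast
  qed (use less.prems in blast)
qed

context number_field_type
begin

definition residues_mod :: "nat \<Rightarrow> 'a set \<Rightarrow> bool" where
  "residues_mod N F \<longleftrightarrow> finite F \<and>
     (\<forall>x. algebraic_int x \<longrightarrow> (\<exists>f\<in>F. \<exists>y. algebraic_int y \<and> x = f + of_nat N * y))"

lemma integer_relation:
  fixes w :: "'i \<Rightarrow> 'a"
  assumes "finite I" "card I > card qbasis" "p > 1"
  shows "\<exists>c. (\<exists>i\<in>I. \<not> p dvd (c i :: int)) \<and> (\<Sum>i\<in>I. of_int (c i) * w i) = 0"
proof -
  obtain q where q: "\<exists>i\<in>I. q i \<noteq> (0::rat)" "(\<Sum>i\<in>I. of_rat (q i) * w i) = 0"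
    using rational_dependence[OF assms(1,2), of w] by metis
  obtain N c where N: "N > (0::int)" "\<And>i. i \<in> I \<Longrightarrow> of_int (c i) = of_int N * q i"
    using clear_denominators[OF assms(1), of q] by metis
  have c: "(of_int (c i) :: 'a) = of_int N * of_rat (q i)" if "i \<in> I" for i
    using arg_cong[OF N(2)[OF that], of "of_rat :: rat \<Rightarrow> 'a"] by (simp only: of_rat_mult of_rat_of_int_eq)
  have "(\<Sum>i\<in>I. of_int (c i) * w i) = of_int N * (\<Sum>i\<in>I. of_rat (q i) * w i)"
    unfolding sum_distrib_left by (intro sum.cong refl) (simp add: c mult.assoc)
  also have "\<dots> = 0"
    using q(2) by simp
  finally have "(\<Sum>i\<in>I. of_int (c i) * w i) = 0" .
  moreover have "\<exists>i\<in>I. c i \<noteq> 0"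
  proof -
    obtain i where i: "i \<in> I" "q i \<noteq> 0"
      using q(1) by blast
    then have "c i \<noteq> 0"
      using N(1) N(2)[OF i(1)] by auto
    then show ?thesis
      using i(1) by blast
  qed
  ultimately show ?thesis
    by (intro integer_relation_not_all_divisible[OF assms(1,3)])
qed

text \<open>
  The ring of integers is torsion-free of rank at most the degree of the field, so that a family which is
  independent modulo \<open>p\<close> has at most that many members: a rational relation can be scaled to an integral
  one that is nonzero modulo \<open>p\<close>. Hence the residue ring is a finite-dimensional space over the prime
  field.
\<close>

lemma residues_mod_prime:
  assumes "prime (p::nat)"
  shows "\<exists>F. residues_mod p F"
proof -
  define indep where "indep = (\<lambda>T. finite T \<and> (\<forall>t\<in>T. algebraic_int (t::'a)) \<and>
    (\<forall>c y. algebraic_int y \<longrightarrow> (\<Sum>t\<in>T. of_int (c t) * t) = of_nat p * y \<longrightarrow> (\<forall>t\<in>T. int p dvd c t)))"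
  have p1: "int p > 1"
    using assms prime_gt_1_nat[of p] by simp
  have indepD: "int p dvd c t"
    if "indep T" "algebraic_int y" "(\<Sum>t\<in>T. of_int (c t) * t) = of_nat p * y" "t \<in> T" for T c y t
    using that unfolding indep_def by blast
  have bound: "card T \<le> card qbasis" if T: "indep T" for T
  proof (rule ccontr)
    assume "\<not> card T \<le> card qbasis"
    moreover have "finite T"
      using T by (simp add: indep_def)
    ultimately obtain c where c: "\<exists>t\<in>T. \<not> int p dvd c t" "(\<Sum>t\<in>T. of_int (c t) * t) = 0"
      using integer_relation[of T "int p" "\<lambda>t. t"] p1 by (metis (no_types, lifting) not_le)
    from c(1) obtain t where t: "t \<in> T" "\<not> int p dvd c t"
      by blast
    have "int p dvd c t"
      by (rule indepD[OF T algebraic_int_0 _ t(1)]) (simp add: c(2))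
    then show False
      using t(2) by blast
  qed
  have "indep {}"
    by (simp add: indep_def)
  moreover have "\<forall>T. indep T \<longrightarrow> card T < Suc (card qbasis)"
    using bound le_imp_less_Suc by blast
  ultimately obtain T where T: "indep T" "\<And>T'. indep T' \<Longrightarrow> card T' \<le> card T"
    using ex_has_greatest_nat[of indep "{}" card "Suc (card qbasis)"] by blast
  have finT: "finite T" and intT: "\<And>t. t \<in> T \<Longrightarrow> algebraic_int t"
    using T(1) by (auto simp: indep_def)
  note indepT = indepD[OF T(1)]
  have repr: "\<exists>d y. algebraic_int y \<and> x = (\<Sum>t\<in>T. of_int (d t) * t) + of_nat p * y" if x: "algebraic_int x" for x
  proof (cases "x \<in> T")
    case True
    have "(\<Sum>t\<in>T. of_int (if t = x then 1 else 0) * t) = x"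
      using True finT by (simp add: if_distrib[of "\<lambda>c. of_int c * _"] cong: if_cong)
    then show ?thesis
      by (intro exI[of _ "\<lambda>t. if t = x then 1 else 0"] exI[of _ 0]) simp
  next
    case False
    have "\<not> indep (insert x T)"
      using T(2)[of "insert x T"] False finT by auto
    then obtain c y where cy: "algebraic_int y" "(\<Sum>t\<in>insert x T. of_int (c t) * t) = of_nat p * y"
      "\<not> (\<forall>t\<in>insert x T. int p dvd c t)"
      unfolding indep_def using finT intT x by blast
    have eq: "of_int (c x) * x + (\<Sum>t\<in>T. of_int (c t) * t) = of_nat p * y"
      using cy(2) False finT by simp
    \<comment> \<open>otherwise the term of \<open>x\<close> could be absorbed, and the rest would contradict the independence of \<open>T\<close>\<close>
    have "\<not> int p dvd c x"
    proof
      assume "int p dvd c x"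
      then obtain k where k: "c x = int p * k"
        by blast
      have "(\<Sum>t\<in>T. of_int (c t) * t) = of_nat p * (y - of_int k * x)"
        using eq k by (simp add: algebra_simps)
      moreover have "algebraic_int (y - of_int k * x)"
        using cy(1) x by auto
      ultimately have "\<forall>t\<in>T. int p dvd c t"
        by (intro ballI indepT)
      then show False
        using cy(3) \<open>int p dvd c x\<close> by blast
    qed
    then have "coprime (c x) (int p)"
      using assms prime_imp_coprime[of "int p" "c x"] by (simp add: coprime_commute)
    then obtain u v where uv: "u * c x + v * int p = 1"
      using bezout_int[of "c x" "int p"] by (auto simp: coprime_iff_gcd_eq_1)
    have "x = of_int (u * c x + v * int p) * x"
      unfolding uv by simp
    also have "\<dots> = of_int u * (of_int (c x) * x) + of_nat p * (of_int v * x)"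
      by (simp add: algebra_simps)
    also have "of_int (c x) * x = of_nat p * y - (\<Sum>t\<in>T. of_int (c t) * t)"
      using eq by (simp add: eq_diff_eq)
    also have "of_int u * (of_nat p * y - (\<Sum>t\<in>T. of_int (c t) * t)) + of_nat p * (of_int v * x)
        = (\<Sum>t\<in>T. of_int (- u * c t) * t) + of_nat p * (of_int u * y + of_int v * x)"
      by (simp add: algebra_simps sum_distrib_left sum_negf)
    finally show ?thesis
      using cy(1) x
      by (intro exI[of _ "\<lambda>t. - u * c t"] exI[of _ "of_int u * y + of_int v * x"] conjI
          algebraic_int_add algebraic_int_mult) auto
  qed
  define F where "F = (\<lambda>r. \<Sum>t\<in>T. of_int (r t) * t) ` PiE T (\<lambda>_. {0..<int p})"
  have "residues_mod p F"
    unfolding residues_mod_def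
  proof (intro conjI allI impI)
    show "finite F"
      unfolding F_def using finT by (intro finite_imageI finite_PiE) auto
    fix x :: 'a assume "algebraic_int x"
    then obtain d y where d: "algebraic_int y" "x = (\<Sum>t\<in>T. of_int (d t) * t) + of_nat p * y"
      using repr by metis
    define r where "r = restrict (\<lambda>t. d t mod int p) T"
    define f where "f = (\<Sum>t\<in>T. of_int (r t) * t)"
    define s where "s = (\<Sum>t\<in>T. of_int (d t div int p) * t)"
    have "f \<in> F"
      unfolding F_def f_def r_def using p1 by (intro imageI) auto
    moreover have "algebraic_int (s + y)"
      unfolding s_def using d(1) intT by (intro algebraic_int_add algebraic_int_sum algebraic_int_mult) auto
    moreover have "x = f + of_nat p * (s + y)"
    proof -
      have "of_int (d t) * t = of_int (r t) * t + of_nat p * (of_int (d t div int p) * t)" if "t \<in> T" for t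
      proof -
        have "d t = r t + int p * (d t div int p)"
          using that by (simp add: r_def)
        then have "(of_int (d t) :: 'a) = of_int (r t) + of_nat p * of_int (d t div int p)"
          by (metis of_int_add of_int_mult of_int_of_nat_eq)
        then show ?thesis
          by (simp add: distrib_right mult.assoc)
      qed
      then have "(\<Sum>t\<in>T. of_int (d t) * t) = f + of_nat p * s"
        by (simp add: f_def s_def sum.distrib sum_distrib_left)
      then show ?thesis
        using d(2) by (simp add: distrib_left add.assoc)
    qed
    ultimately show "\<exists>f\<in>F. \<exists>y. algebraic_int y \<and> x = f + of_nat p * y"
      by blast
  qed
  then show ?thesis
    by blast
qed

lemma exists_residues_mod:
  assumes "N > 0"
  shows "\<exists>F. residues_mod N F"
  using assms
proof (induction N rule: less_induct)
  case (less N)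
  show ?case
  proof (cases "N = 1")
    case True
    then show ?thesis
      by (intro exI[of _ "{0}"]) (auto simp: residues_mod_def)
  next
    case False
    then obtain p M where p: "prime p" "N = p * M"
      using prime_factor_nat by (metis dvdE)
    then have M: "M > 0" "M < N"
      using less.prems prime_gt_1_nat[OF p(1)] by (auto intro: Nat.gr0I)
    obtain F where F: "residues_mod M F"
      using less.IH[OF M(2,1)] by blast
    obtain G where G: "residues_mod p G"
      using residues_mod_prime[OF p(1)] by blast
    have "residues_mod N ((\<lambda>(g, f). g + of_nat p * f) ` (G \<times> F))"
      unfolding residues_mod_def
    proof (intro conjI allI impI)
      show "finite ((\<lambda>(g, f). g + of_nat p * f) ` (G \<times> F))"
        using F G by (auto simp: residues_mod_def)
      fix x :: 'a assume "algebraic_int x"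
      then obtain g y where g: "g \<in> G" "algebraic_int y" "x = g + of_nat p * y"
        using G unfolding residues_mod_def by metis
      then obtain f z where f: "f \<in> F" "algebraic_int z" "y = f + of_nat M * z"
        using F unfolding residues_mod_def by metis
      have "x = (g + of_nat p * f) + of_nat N * z"
        unfolding g(3) f(3) p(2) by (simp add: algebra_simps)
      then show "\<exists>h\<in>(\<lambda>(g, f). g + of_nat p * f) ` (G \<times> F). \<exists>y. algebraic_int y \<and> x = h + of_nat N * y"
        using g(1) f(1,2) by (intro bexI[of _ "g + of_nat p * f"] exI[of _ z]) auto
    qed
    then show ?thesis
      by blast
  qed
qed

text \<open>
  The pigeonhole principle in the finite residue ring modulo \<open>N\<close>. This is the form in which finiteness is used
  below; it replaces arguments with finitely generated modules.
\<close>

lemma congruent_terms: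
  assumes "N > 0" "\<And>i. algebraic_int (s i :: 'a)"
  shows "\<exists>i j y. i < (j::nat) \<and> algebraic_int y \<and> s j - s i = of_nat N * y"
proof -
  obtain F where F: "residues_mod N F"
    using exists_residues_mod[OF assms(1)] by blast
  have "\<forall>i. \<exists>f y. f \<in> F \<and> algebraic_int y \<and> s i = f + of_nat N * y"
    using F assms(2) unfolding residues_mod_def by metis
  then obtain f y where fy: "\<And>i. f i \<in> F" "\<And>i. algebraic_int (y i)" "\<And>i. s i = f i + of_nat N * y i"
    by metis
  have "\<not> inj f"
    using F fy(1) finite_subset[of "range f" F] infinite_UNIV_nat finite_imageD[of f UNIV]
    unfolding residues_mod_def by blast
  then obtain i j where ij: "i < j" "f i = f j"
    unfolding inj_def by (metis linorder_neqE_nat)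
  have "s j - s i = of_nat N * (y j - y i)"
    unfolding fy(3)[of i] fy(3)[of j] ij(2) by (simp add: algebra_simps)
  then show ?thesis
    using ij(1) fy(2) by (intro exI[of _ i] exI[of _ j] exI[of _ "y j - y i"]) auto
qed

text \<open>
  Two of the multiples \<open>g ^ k * N\<close> are congruent modulo \<open>N\<close>, which makes \<open>g ^ j - g ^ i\<close> an algebraic integer for
  some \<open>i < j\<close>. Thus \<open>g\<close> is a root of a monic polynomial, up to an algebraic integer.
\<close>

lemma almost_integral_imp_algebraic_int:
  fixes g :: 'a
  assumes "N > 0" "\<And>k. algebraic_int (g ^ k * of_nat N)"
  shows "algebraic_int g"
proof -
  obtain i j y where ij: "i < j" "algebraic_int y" "g ^ j * of_nat N - g ^ i * of_nat N = of_nat N * y"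
    using congruent_terms[OF assms(1), of "\<lambda>k. g ^ k * of_nat N"] assms(2) by metis
  have "of_nat N * (g ^ j - g ^ i) = of_nat N * y"
    using ij(3) by (simp add: algebra_simps)
  then have y: "g ^ j - g ^ i = y"
    using assms(1) by simp
  define p :: "'a poly" where "p = monom 1 j - monom 1 i"
  have "degree p = j"
    unfolding p_def diff_conv_add_uminus using ij(1)
    by (subst degree_add_eq_left) (auto simp: degree_monom_eq)
  then have "lead_coeff p = 1" "degree p > 0"
    using ij(1) by (auto simp: p_def)
  moreover have "poly p g = y"
    using y by (simp add: p_def poly_monom)
  moreover have "\<forall>k. coeff p k \<in> \<int>"
    by (auto simp: p_def)
  ultimately show ?thesis
    using algebraic_int_root[OF ij(2)] by blast
qed

text \<open>
  If \<open>a\<close> is the leading coefficient of an integral equation of degree \<open>n\<close> for \<open>x\<close>, then multiplication by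
  \<open>a * x\<close> preserves the integral span of the first \<open>n\<close> powers of \<open>x\<close>.
\<close>

lemma algebraic_int_of_multiple:
  fixes x :: 'a
  shows "\<exists>N>0. algebraic_int (of_nat N * x)"
proof -
  obtain q :: "rat poly" where q: "q \<noteq> 0" "poly (map_poly of_rat q) x = 0"
    using rational_poly_root[of x] by metis
  define n where "n = degree q"
  obtain M c where M: "M > (0::int)" "\<And>i. i \<in> {..n} \<Longrightarrow> of_int (c i) = of_int M * coeff q i"
    using clear_denominators[of "{..n}" "coeff q"] by auto
  have c: "(of_int (c i) :: 'a) = of_int M * of_rat (coeff q i)" if "i \<le> n" for i
    using arg_cong[OF M(2)[of i], of "of_rat :: rat \<Rightarrow> 'a"] that
    by (simp only: of_rat_mult of_rat_of_int_eq atMost_iff)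
  have "poly (map_poly of_rat q) x = (\<Sum>i\<le>n. of_rat (coeff q i) * x ^ i)"
    by (simp add: poly_altdef n_def)
  moreover have "(\<Sum>i\<le>n. of_int (c i) * x ^ i) = of_int M * (\<Sum>i\<le>n. of_rat (coeff q i) * x ^ i)"
    unfolding sum_distrib_left by (intro sum.cong refl) (simp add: c mult.assoc)
  ultimately have "(\<Sum>i\<le>n. of_int (c i) * x ^ i) = of_int M * poly (map_poly of_rat q) x"
    by metis
  then have rel: "(\<Sum>i<n. of_int (c i) * x ^ i) + of_int (c n) * x ^ n = 0"
    using q(2) by (simp add: lessThan_Suc_atMost[symmetric])
  have cn: "c n \<noteq> 0"
  proof
    assume "c n = 0"
    then have "of_int M * coeff q n = 0"
      using M(2)[of n] by simp
    then show False
      using M(1) q(1) by (simp add: n_def)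
  qed
  have n: "n > 0"
  proof (rule Nat.gr0I)
    assume "n = 0"
    then show False
      using rel cn by simp
  qed
  have "algebraic_int (of_int (c n) * x)"
  proof (rule algebraic_int_of_finite_module[where w = "\<lambda>i. x ^ i" and I = "{..<n}" and ?i0.0 = 0])
    fix i assume "i \<in> {..<n}"
    show "\<exists>a :: nat \<Rightarrow> int. of_int (c n) * x * x ^ i = (\<Sum>j\<in>{..<n}. of_int (a j) * x ^ j)"
    proof (cases "Suc i < n")
      case True
      have "(\<Sum>j<n. of_int (if j = Suc i then c n else 0) * x ^ j)
          = (\<Sum>j<n. if j = Suc i then of_int (c n) * x ^ Suc i else 0)"
        by (intro sum.cong) auto
      also have "\<dots> = of_int (c n) * x * x ^ i"
        using True by (simp add: mult.assoc)
      finally show ?thesis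
        by (intro exI[of _ "\<lambda>j. if j = Suc i then c n else 0"]) simp
    next
      case False
      then have "Suc i = n"
        using \<open>i \<in> {..<n}\<close> by simp
      then have "of_int (c n) * x * x ^ i = of_int (c n) * x ^ n"
        by (auto simp: mult.assoc)
      also have "\<dots> = - (\<Sum>i<n. of_int (c i) * x ^ i)"
        using rel by (simp only: eq_neg_iff_add_eq_0 add.commute)
      also have "\<dots> = (\<Sum>i<n. of_int (- c i) * x ^ i)"
        by (simp only: of_int_minus mult_minus_left sum_negf)
      finally show ?thesis
        by (intro exI[of _ "\<lambda>i. - c i"])
    qed
  qed (use n in auto)
  moreover have "of_nat (nat \<bar>c n\<bar>) * x = of_int (c n) * x \<or> of_nat (nat \<bar>c n\<bar>) * x = - (of_int (c n) * x)"
    by (cases "c n \<ge> 0") auto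
  ultimately have "algebraic_int (of_nat (nat \<bar>c n\<bar>) * x)"
    by (metis algebraic_int_minus)
  then show ?thesis
    using cn by (intro exI[of _ "nat \<bar>c n\<bar>"]) auto
qed

lemma algebraic_int_divides_integer:
  fixes x :: 'a
  assumes "algebraic_int x" "x \<noteq> 0"
  shows "\<exists>N y. N > 0 \<and> algebraic_int y \<and> x * y = of_nat N"
proof -
  obtain N where N: "N > 0" "algebraic_int (of_nat N * inverse x)"
    using algebraic_int_of_multiple by metis
  then show ?thesis
    using assms(2) by (intro exI[of _ N] exI[of _ "of_nat N * inverse x"]) simp
qed

end

section \<open>The valuation of a nonzero prime ideal\<close>

text \<open>
  Nonzero prime ideals of the ring of integers, described by the operations of the field type alone; the
  equivalence with the predicate for ideals is \<open>nonzero_prime_ideal_iff\<close>.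
\<close>

definition nonzero_prime_set :: "'a::field_char_0 set \<Rightarrow> bool" where
  "nonzero_prime_set P \<longleftrightarrow>
     (\<forall>x\<in>P. algebraic_int x) \<and> (\<forall>x\<in>P. \<forall>y\<in>P. x + y \<in> P) \<and>
     (\<forall>a x. algebraic_int a \<longrightarrow> x \<in> P \<longrightarrow> a * x \<in> P) \<and> 1 \<notin> P \<and>
     (\<forall>a b. algebraic_int a \<longrightarrow> algebraic_int b \<longrightarrow> a * b \<in> P \<longrightarrow> a \<in> P \<or> b \<in> P) \<and>
     (\<exists>x\<in>P. x \<noteq> 0)"

locale prime_of_number_field = number_field_type K
  for K :: "'a::field_char_0 itself" +
  fixes P :: "'a set"
  assumes nonzero_prime_set: "nonzero_prime_set P"
begin

lemma integral: "x \<in> P \<Longrightarrow> algebraic_int x"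
  and add_closed: "x \<in> P \<Longrightarrow> y \<in> P \<Longrightarrow> x + y \<in> P"
  and mult_closed: "algebraic_int a \<Longrightarrow> x \<in> P \<Longrightarrow> a * x \<in> P"
  and one_notin: "1 \<notin> P"
  and prime_property: "algebraic_int a \<Longrightarrow> algebraic_int b \<Longrightarrow> a * b \<in> P \<Longrightarrow> a \<in> P \<or> b \<in> P"
  and nonzero: "\<exists>x\<in>P. x \<noteq> 0"
  using nonzero_prime_set unfolding nonzero_prime_set_def by metis+

lemma zero_in: "0 \<in> P"
  using nonzero mult_closed[of 0] by auto

lemma minus_closed: "x \<in> P \<Longrightarrow> - x \<in> P"
  using mult_closed[of "-1" x] by simp

lemma diff_closed: "x \<in> P \<Longrightarrow> y \<in> P \<Longrightarrow> x - y \<in> P"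
  using add_closed[of x "- y"] minus_closed[of y] by simp

lemma mult_notin: "algebraic_int a \<Longrightarrow> algebraic_int b \<Longrightarrow> a \<notin> P \<Longrightarrow> b \<notin> P \<Longrightarrow> a * b \<notin> P"
  using prime_property by blast

lemma power_notin: "algebraic_int a \<Longrightarrow> a \<notin> P \<Longrightarrow> a ^ k \<notin> P"
  by (induction k) (auto simp: one_notin dest: prime_property)

lemma power_in: "x \<in> P \<Longrightarrow> k > 0 \<Longrightarrow> x ^ k \<in> P"
proof (induction k)
  case (Suc k)
  then show ?case
    using mult_closed[of "x ^ k" x] integral by (simp add: mult.commute algebraic_int_power)
qed simp

lemma exists_positive_integer: "\<exists>N>0. (of_nat N :: 'a) \<in> P"
proof -
  obtain x where x: "x \<in> P" "x \<noteq> 0"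
    using nonzero by blast
  obtain N y where N: "N > 0" "algebraic_int y" "x * y = of_nat N"
    using algebraic_int_divides_integer[OF integral[OF x(1)] x(2)] by metis
  then have "of_nat N \<in> P"
    using mult_closed[OF N(2) x(1)] by (simp add: mult.commute)
  then show ?thesis
    using N(1) by blast
qed

text \<open>
  The powers of \<open>s\<close> repeat modulo an integer of \<open>P\<close>, and a nonnegative power of \<open>s\<close> can be cancelled because \<open>P\<close> is
  prime. So a power of \<open>s\<close> is congruent to \<open>1\<close> modulo \<open>P\<close>.
\<close>

lemma maximal:
  assumes "algebraic_int s" "s \<notin> P"
  shows "\<exists>t. algebraic_int t \<and> s * t - 1 \<in> P"
proof -
  obtain N where N: "N > 0" "(of_nat N :: 'a) \<in> P"
    using exists_positive_integer by blast
  obtain i j y where ij: "i < j" "algebraic_int y" "s ^ j - s ^ i = of_nat N * y"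
    using congruent_terms[OF N(1), of "\<lambda>k. s ^ k"] assms(1) by (metis algebraic_int_power)
  have "s ^ i * (s ^ (j - i) - 1) = s ^ j - s ^ i"
    using ij(1) by (simp add: right_diff_distrib power_add[symmetric])
  also have "\<dots> \<in> P"
    unfolding ij(3) using mult_closed[OF ij(2) N(2)] by (simp add: mult.commute)
  finally have "s ^ (j - i) - 1 \<in> P"
    using prime_property[of "s ^ i" "s ^ (j - i) - 1"] power_notin[OF assms] assms(1)
    by (meson algebraic_int_1 algebraic_int_diff algebraic_int_power)
  moreover have "s ^ (j - i) = s * s ^ (j - i - 1)"
    using ij(1) by (simp add: power_eq_if)
  ultimately show ?thesis
    using assms(1) by (intro exI[of _ "s ^ (j - i - 1)"]) (auto intro: algebraic_int_power)
qed

text \<open>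
  \<open>P\<close> is an associated prime of the residue ring modulo any integer that it contains. The element \<open>b\<close> is built so
  that no element outside of \<open>P\<close> annihilates it, while more and more elements of \<open>P\<close> do. To treat a further
  element \<open>q\<close> of \<open>P\<close>, note that \<open>q ^ k * b\<close> is annihilated by some element outside of \<open>P\<close> once \<open>k\<close> is
  large, as powers of \<open>q\<close> repeat modulo \<open>N\<close>; one step before the first such \<open>k\<close> lies the new element.
  Representatives of the residue classes in \<open>P\<close> suffice.
\<close>

lemma exists_annihilated_element:
  assumes N: "N > 0" "(of_nat N :: 'a) \<in> P"
  defines "NO \<equiv> {of_nat N * y | y. algebraic_int (y :: 'a)}"
  shows "\<exists>b. algebraic_int b \<and> b \<notin> NO \<and> (\<forall>x\<in>P. x * b \<in> NO)"
proof -
  have NO_mult: "a * x \<in> NO" if x: "x \<in> NO" "algebraic_int a" for a x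
  proof -
    obtain y where "algebraic_int y" "x = of_nat N * y"
      using x(1) unfolding NO_def by blast
    then have "a * x = of_nat N * (a * y)" "algebraic_int (a * y)"
      using x(2) by auto
    then show ?thesis
      unfolding NO_def by blast
  qed
  have NO_add: "x + y \<in> NO" if xy: "x \<in> NO" "y \<in> NO" for x y
  proof -
    obtain x' y' where "algebraic_int x'" "x = of_nat N * x'" "algebraic_int y'" "y = of_nat N * y'"
      using xy unfolding NO_def by blast
    then have "x + y = of_nat N * (x' + y')" "algebraic_int (x' + y')"
      by (auto simp: distrib_left)
    then show ?thesis
      unfolding NO_def by blast
  qed
  have NO_P: "x \<in> P" if "x \<in> NO" for x
    using that mult_closed[OF _ N(2)] unfolding NO_def by (auto simp: mult.commute)
  obtain F where F: "residues_mod N F"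
    using exists_residues_mod[OF N(1)] by blast
  have "\<exists>b. algebraic_int b \<and> (\<forall>t. algebraic_int t \<longrightarrow> t \<notin> P \<longrightarrow> t * b \<notin> NO) \<and> (\<forall>x\<in>Q. x * b \<in> NO)"
    if "finite Q" "Q \<subseteq> P" for Q
    using that
  proof (induction Q)
    case empty
    then show ?case
      using NO_P by (intro exI[of _ 1]) auto
  next
    case (insert q Q)
    then obtain b where b: "algebraic_int b" "\<And>t. algebraic_int t \<Longrightarrow> t \<notin> P \<Longrightarrow> t * b \<notin> NO"
      "\<And>x. x \<in> Q \<Longrightarrow> x * b \<in> NO"
      by auto
    have q: "q \<in> P" "algebraic_int q"
      using insert.prems integral by auto
    define kills where "kills = (\<lambda>k. \<exists>t. algebraic_int t \<and> t \<notin> P \<and> t * (q ^ k * b) \<in> NO)"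
    obtain i j y where ij: "i < j" "algebraic_int y" "q ^ j - q ^ i = of_nat N * y"
      using congruent_terms[OF N(1), of "\<lambda>k. q ^ k"] q(2) by (metis algebraic_int_power)
    define t where "t = q ^ (j - i) - 1"
    have t: "algebraic_int t"
      using q(2) unfolding t_def by (intro algebraic_int_diff algebraic_int_power) auto
    have "t \<notin> P"
    proof
      assume "t \<in> P"
      moreover have "q ^ (j - i) \<in> P"
        using q(1) ij(1) by (intro power_in) auto
      ultimately have "q ^ (j - i) - t \<in> P"
        by (intro diff_closed)
      then show False
        using one_notin by (simp add: t_def)
    qed
    moreover have "t * (q ^ i * b) \<in> NO"
    proof -
      have "t * q ^ i = q ^ j - q ^ i"
        using ij(1) by (simp add: t_def left_diff_distrib power_add[symmetric])
      then have "t * (q ^ i * b) = b * (of_nat N * y)"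
        using ij(3) by (simp add: mult_ac)
      moreover have "of_nat N * y \<in> NO"
        using ij(2) unfolding NO_def by blast
      ultimately show ?thesis
        using NO_mult b(1) by metis
    qed
    ultimately have "kills i"
      unfolding kills_def using t by blast
    define k where "k = (LEAST k. kills k)"
    have k: "kills k"
      unfolding k_def using \<open>kills i\<close> by (rule LeastI)
    then obtain s where s: "algebraic_int s" "s \<notin> P" "s * (q ^ k * b) \<in> NO"
      unfolding kills_def by blast
    have "k \<noteq> 0"
    proof
      assume "k = 0"
      then show False
        using s b(2)[of s] by simp
    qed
    then obtain l where l: "k = Suc l"
      by (cases k) auto
    have "\<not> kills l"
      using not_less_Least[of l kills] l unfolding k_def by simp
    define b' where "b' = s * (q ^ l * b)"
    have "algebraic_int b'"
      unfolding b'_def using s(1) q(2) b(1) by (intro algebraic_int_mult algebraic_int_power)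
    moreover have "t * b' \<notin> NO" if t: "algebraic_int t" "t \<notin> P" for t
    proof
      assume "t * b' \<in> NO"
      then have "(t * s) * (q ^ l * b) \<in> NO"
        by (simp add: b'_def mult.assoc)
      then have "kills l"
        unfolding kills_def using mult_notin[OF t(1) s(1) t(2) s(2)] t(1) s(1) by blast
      then show False
        using \<open>\<not> kills l\<close> by blast
    qed
    moreover have "x * b' \<in> NO" if "x \<in> insert q Q" for x
    proof (cases "x = q")
      case True
      then show ?thesis
        using s(3) by (simp add: b'_def l mult_ac)
    next
      case False
      have "(s * q ^ l) * (x * b) \<in> NO"
        by (rule NO_mult) (use False that b(3) s(1) q(2) in auto)
      then show ?thesis
        by (simp add: b'_def mult_ac)
    qed
    ultimately show ?case
      by blast
  qed
  moreover have "finite (F \<inter> P)"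
    using F by (simp add: residues_mod_def)
  ultimately obtain b where b: "algebraic_int b"
    "\<And>t. algebraic_int t \<Longrightarrow> t \<notin> P \<Longrightarrow> t * b \<notin> NO" "\<And>x. x \<in> F \<inter> P \<Longrightarrow> x * b \<in> NO"
    by (meson inf_le2)
  have "x * b \<in> NO" if x: "x \<in> P" for x
  proof -
    obtain f y where f: "f \<in> F" "algebraic_int y" "x = f + of_nat N * y"
      using F integral[OF x] unfolding residues_mod_def by metis
    have "of_nat N * y \<in> P"
      using mult_closed[OF f(2) N(2)] by (simp add: mult.commute)
    then have "f \<in> P"
      using diff_closed[OF x] f(3) by (metis add_diff_cancel_right')
    then have "f * b \<in> NO"
      using b(3) f(1) by blast
    moreover have "of_nat N * (y * b) \<in> NO"
      using f(2) b(1) unfolding NO_def by blast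
    ultimately have "f * b + of_nat N * (y * b) \<in> NO"
      by (rule NO_add)
    then show ?thesis
      unfolding f(3) by (simp add: distrib_right mult.assoc)
  qed
  moreover have "b \<notin> NO"
    using b(2)[of 1] one_notin by simp
  ultimately show ?thesis
    using b(1) by blast
qed

text \<open>
  With the element \<open>b\<close> from above, \<open>g = b / N\<close> maps \<open>P\<close> into the ring of integers but is not integral itself. If it
  mapped \<open>P\<close> into \<open>P\<close>, all \<open>g ^ k * N\<close> would be integral, and hence \<open>g\<close> would be integral.
\<close>

lemma exists_inverse_uniformizer:
  "\<exists>g. (\<forall>x\<in>P. algebraic_int (g * x)) \<and> (\<exists>q\<in>P. g * q \<notin> P)"
proof -
  obtain N where N: "N > 0" "(of_nat N :: 'a) \<in> P"
    using exists_positive_integer by blast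
  define NO where "NO = {of_nat N * y | y. algebraic_int (y :: 'a)}"
  obtain b where b: "algebraic_int b" "b \<notin> NO" "\<And>x. x \<in> P \<Longrightarrow> x * b \<in> NO"
    using exists_annihilated_element[OF N, folded NO_def] by blast
  define g where "g = b / of_nat N"
  have N0: "(of_nat N :: 'a) \<noteq> 0"
    using N(1) by simp
  have g: "algebraic_int (g * x)" if x: "x \<in> P" for x
  proof -
    obtain y where y: "algebraic_int y" "x * b = of_nat N * y"
      using b(3)[OF x] unfolding NO_def by blast
    have "g * x = (x * b) / of_nat N"
      by (simp add: g_def)
    also have "\<dots> = y"
      unfolding y(2) using N0 by simp
    finally show ?thesis
      using y(1) by simp
  qed
  moreover have "\<exists>q\<in>P. g * q \<notin> P"
  proof (rule ccontr)
    assume "\<not> (\<exists>q\<in>P. g * q \<notin> P)"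
    then have step: "g * q \<in> P" if "q \<in> P" for q
      using that by blast
    have "g ^ k * of_nat N \<in> P" for k
      by (induction k) (use N(2) step in \<open>auto simp: mult.assoc\<close>)
    then have "algebraic_int g"
      using almost_integral_imp_algebraic_int[OF N(1)] integral by blast
    moreover have "b = of_nat N * g"
      using N0 by (simp add: g_def)
    ultimately show False
      using b(2) unfolding NO_def by blast
  qed
  ultimately show ?thesis
    by blast
qed

text \<open>
  An element of order \<open>-1\<close> at \<open>P\<close>; the order of \<open>x\<close> is the exponent \<open>k\<close> for which \<open>\<gamma> powi k * x\<close> is a unit at \<open>P\<close>.
\<close>

definition \<gamma> :: 'a where
  "\<gamma> = (SOME g. (\<forall>x\<in>P. algebraic_int (g * x)) \<and> (\<exists>q\<in>P. g * q \<notin> P))"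

definition unif :: 'a where
  "unif = (SOME q. q \<in> P \<and> \<gamma> * q \<notin> P)"

lemma gamma_integral: "x \<in> P \<Longrightarrow> algebraic_int (\<gamma> * x)"
  and unif: "unif \<in> P" "\<gamma> * unif \<notin> P"
proof -
  have *: "(\<forall>x\<in>P. algebraic_int (\<gamma> * x)) \<and> (\<exists>q\<in>P. \<gamma> * q \<notin> P)"
    unfolding \<gamma>_def by (rule someI_ex[OF exists_inverse_uniformizer])
  then show "x \<in> P \<Longrightarrow> algebraic_int (\<gamma> * x)"
    by blast
  have "unif \<in> P \<and> \<gamma> * unif \<notin> P"
    unfolding unif_def by (rule someI_ex) (use * in blast)
  then show "unif \<in> P" "\<gamma> * unif \<notin> P"
    by auto
qed

definition local_unit :: "'a \<Rightarrow> bool" where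
  "local_unit x \<longleftrightarrow> (\<exists>a b. algebraic_int a \<and> a \<notin> P \<and> algebraic_int b \<and> b \<notin> P \<and> x = a / b)"

definition local_integral :: "'a \<Rightarrow> bool" where
  "local_integral x \<longleftrightarrow> (\<exists>s. algebraic_int s \<and> s \<notin> P \<and> algebraic_int (s * x))"

lemma gamma_unif: "algebraic_int (\<gamma> * unif)" "\<gamma> * unif \<notin> P" "algebraic_int unif" "\<gamma> \<noteq> 0" "unif \<noteq> 0"
  using gamma_integral unif integral zero_in by auto

lemma local_unit_nonzero: "local_unit x \<Longrightarrow> x \<noteq> 0"
  using zero_in by (auto simp: local_unit_def)

lemma local_unit_integer: "algebraic_int x \<Longrightarrow> x \<notin> P \<Longrightarrow> local_unit x"
  unfolding local_unit_def by (rule exI[of _ x], rule exI[of _ 1]) (simp add: one_notin)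

lemma local_unit_mult: 
  assumes "local_unit x" "local_unit y"
  shows "local_unit (x * y)"
proof -
  obtain a b c d where "algebraic_int a" "a \<notin> P" "algebraic_int b" "b \<notin> P" "x = a / b"
    "algebraic_int c" "c \<notin> P" "algebraic_int d" "d \<notin> P" "y = c / d"
    using assms unfolding local_unit_def by blast
  then show ?thesis
    unfolding local_unit_def
    by (intro exI[of _ "a * c"] exI[of _ "b * d"]) (auto simp: mult_notin)
qed

lemma local_unit_inverse: "local_unit x \<Longrightarrow> local_unit (inverse x)"
  unfolding local_unit_def by (metis inverse_divide)

lemma local_integral_integer: "algebraic_int x \<Longrightarrow> local_integral x"
  unfolding local_integral_def by (intro exI[of _ 1]) (simp add: one_notin)

lemma local_integral_add:
  assumes "local_integral x" "local_integral y"
  shows "local_integral (x + y)"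
proof -
  obtain s t where st: "algebraic_int s" "s \<notin> P" "algebraic_int (s * x)"
    "algebraic_int t" "t \<notin> P" "algebraic_int (t * y)"
    using assms unfolding local_integral_def by blast
  have "s * t * (x + y) = t * (s * x) + s * (t * y)"
    by (simp add: algebra_simps)
  moreover have "algebraic_int (t * (s * x) + s * (t * y))"
    by (rule algebraic_int_add[OF algebraic_int_mult[OF st(4,3)] algebraic_int_mult[OF st(1,6)]])
  moreover have "algebraic_int (s * t)" "s * t \<notin> P"
    using st mult_notin by auto
  ultimately show ?thesis
    unfolding local_integral_def by (intro exI[of _ "s * t"]) simp
qed

text \<open>
  As long as \<open>\<gamma> ^ k * x\<close> lies in \<open>P\<close>, multiplication by \<open>\<gamma>\<close> gives an integral element again. This must stop, as
  otherwise \<open>\<gamma>\<close> would be almost integral and so integral, although it does not preserve \<open>P\<close>.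
\<close>

lemma integer_unit_multiple:
  assumes "algebraic_int x" "x \<noteq> 0"
  shows "\<exists>k. local_unit (\<gamma> ^ k * x)"
proof -
  have "\<exists>k. \<not> algebraic_int (\<gamma> ^ k * x)"
  proof (rule ccontr)
    assume "\<nexists>k. \<not> algebraic_int (\<gamma> ^ k * x)"
    then have *: "algebraic_int (\<gamma> ^ k * x)" for k
      by blast
    obtain N y where N: "N > 0" "algebraic_int y" "x * y = of_nat N"
      using algebraic_int_divides_integer[OF assms] by metis
    have "algebraic_int (\<gamma> ^ k * of_nat N)" for k
      using algebraic_int_mult[OF *[of k] N(2)] N(3) by (simp add: mult.assoc)
    then have "algebraic_int \<gamma>"
      by (rule almost_integral_imp_algebraic_int[OF N(1)])
    then show False
      using mult_closed[OF _ unif(1)] unif(2) by blast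
  qed
  then have "\<not> algebraic_int (\<gamma> ^ (LEAST k. \<not> algebraic_int (\<gamma> ^ k * x)) * x)"
    by (rule LeastI_ex)
  moreover define k where "k = (LEAST k. \<not> algebraic_int (\<gamma> ^ k * x))"
  ultimately have k: "\<not> algebraic_int (\<gamma> ^ k * x)"
    by simp
  then obtain l where l: "k = Suc l"
    using assms(1) by (cases k) auto
  have int: "algebraic_int (\<gamma> ^ l * x)"
    using not_less_Least[of l "\<lambda>k. \<not> algebraic_int (\<gamma> ^ k * x)"] l unfolding k_def by simp
  moreover have "\<gamma> ^ l * x \<notin> P"
    using gamma_integral[of "\<gamma> ^ l * x"] k l by (auto simp: mult.assoc)
  ultimately show ?thesis
    using local_unit_integer by blast
qed

lemma exists_order:
  assumes "x \<noteq> 0"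
  shows "\<exists>k::int. local_unit (\<gamma> powi k * x)"
proof -
  obtain N where N: "N > 0" "algebraic_int (of_nat N * x)"
    using algebraic_int_of_multiple by metis
  obtain i where i: "local_unit (\<gamma> ^ i * (of_nat N * x))"
    using integer_unit_multiple[OF N(2)] N(1) assms by auto
  obtain j where j: "local_unit (\<gamma> ^ j * of_nat N)"
    using integer_unit_multiple[of "of_nat N"] N(1) by auto
  have eq: "\<gamma> powi (int i - int j) * x = (\<gamma> ^ i * (of_nat N * x)) * inverse (\<gamma> ^ j * of_nat N)"
    using N(1) gamma_unif(4) by (simp add: power_int_diff field_simps)
  have "local_unit (\<gamma> powi (int i - int j) * x)"
    unfolding eq by (rule local_unit_mult[OF i local_unit_inverse[OF j]])
  then show ?thesis
    by blast
qed

lemma gamma_power_not_unit: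
  assumes "k > 0"
  shows "\<not> local_unit (\<gamma> ^ k)"
proof
  assume "local_unit (\<gamma> ^ k)"
  then have "local_unit (inverse (\<gamma> ^ k))"
    by (rule local_unit_inverse)
  then obtain a b where ab: "algebraic_int a" "a \<notin> P" "algebraic_int b" "b \<notin> P" "inverse (\<gamma> ^ k) = a / b"
    unfolding local_unit_def by blast
  have b0: "b \<noteq> 0"
    using ab zero_in by auto
  have "b = a * \<gamma> ^ k"
    using ab(5) b0 gamma_unif(4) by (simp add: field_simps)
  then have "b * unif ^ k = a * (\<gamma> * unif) ^ k"
    by (simp add: power_mult_distrib mult_ac)
  moreover have "b * unif ^ k \<in> P"
    using ab(3) power_in[OF unif(1) assms] by (rule mult_closed)
  moreover have "a * (\<gamma> * unif) ^ k \<notin> P"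
    by (rule mult_notin[OF ab(1) algebraic_int_power[OF gamma_unif(1)] ab(2) power_notin[OF gamma_unif(1,2)]])
  ultimately show False
    by simp
qed

lemma order_unique:
  assumes "local_unit (\<gamma> powi i * x)" "local_unit (\<gamma> powi j * x)"
  shows "i = j"
proof (rule ccontr)
  have wlog: False if "i < j" "local_unit (\<gamma> powi i * x)" "local_unit (\<gamma> powi j * x)" for i j
  proof -
    have "x \<noteq> 0"
      using local_unit_nonzero[OF that(2)] by auto
    then have "(\<gamma> powi j * x) * inverse (\<gamma> powi i * x) = \<gamma> powi (j - i)"
      using gamma_unif(4) by (simp add: power_int_diff field_simps)
    also have "\<dots> = \<gamma> ^ nat (j - i)"
      using that(1) by (simp add: power_int_def)
    finally have eq: "(\<gamma> powi j * x) * inverse (\<gamma> powi i * x) = \<gamma> ^ nat (j - i)" .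
    have "local_unit (\<gamma> ^ nat (j - i))"
      unfolding eq[symmetric] by (rule local_unit_mult[OF that(3) local_unit_inverse[OF that(2)]])
    then show False
      using gamma_power_not_unit[of "nat (j - i)"] that(1) by simp
  qed
  assume "i \<noteq> j"
  then show False
    using wlog[of i j] wlog[of j i] assms by linarith
qed

definition ord_at :: "'a \<Rightarrow> int" where
  "ord_at x = (THE k. local_unit (\<gamma> powi k * x))"

lemma ord_at_unit: "x \<noteq> 0 \<Longrightarrow> local_unit (\<gamma> powi ord_at x * x)"
  unfolding ord_at_def by (rule theI', rule ex_ex1I) (use exists_order order_unique in blast)+

lemma ord_at_eqI: "local_unit (\<gamma> powi k * x) \<Longrightarrow> ord_at x = k"
  using order_unique[of "ord_at x" x k] ord_at_unit[of x] local_unit_nonzero[of "\<gamma> powi k * x"] by auto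

lemma ord_at_mult:
  assumes "x \<noteq> 0" "y \<noteq> 0"
  shows "ord_at (x * y) = ord_at x + ord_at y"
proof (rule ord_at_eqI)
  have eq: "\<gamma> powi (ord_at x + ord_at y) * (x * y) = (\<gamma> powi ord_at x * x) * (\<gamma> powi ord_at y * y)"
    using gamma_unif(4) by (simp add: power_int_add mult_ac)
  show "local_unit (\<gamma> powi (ord_at x + ord_at y) * (x * y))"
    unfolding eq by (rule local_unit_mult[OF ord_at_unit[OF assms(1)] ord_at_unit[OF assms(2)]])
qed

lemma ord_at_notin: "algebraic_int x \<Longrightarrow> x \<notin> P \<Longrightarrow> ord_at x = 0"
  by (rule ord_at_eqI) (simp add: local_unit_integer)

lemma ord_at_gamma: "ord_at (\<gamma> powi k) = - k"
proof (rule ord_at_eqI)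
  show "local_unit (\<gamma> powi - k * \<gamma> powi k)"
    using gamma_unif(4) local_unit_integer[of 1] one_notin by (simp add: power_int_minus)
qed

lemma ord_at_integer_nonneg:
  assumes "algebraic_int x" "x \<noteq> 0"
  shows "ord_at x \<ge> 0"
proof -
  obtain k where "local_unit (\<gamma> ^ k * x)"
    using integer_unit_multiple[OF assms] by blast
  then have "ord_at x = int k"
    by (intro ord_at_eqI) simp
  then show ?thesis
    by simp
qed

lemma ord_at_prime_pos:
  assumes "x \<in> P" "x \<noteq> 0"
  shows "ord_at x \<ge> 1"
proof -
  have "ord_at (\<gamma> powi 1 * x) \<ge> 0"
    using gamma_integral[OF assms(1)] assms(2) gamma_unif(4) by (intro ord_at_integer_nonneg) auto
  then show ?thesis
    using ord_at_mult[of "\<gamma> powi 1" x] ord_at_gamma[of 1] assms(2) gamma_unif(4) by simp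
qed

lemma ord_at_clear:
  assumes "x \<noteq> 0" "ord_at x = int k"
  shows "\<exists>s c. algebraic_int s \<and> s \<notin> P \<and> algebraic_int c \<and> s * x = unif ^ k * c"
proof -
  obtain a b where ab: "algebraic_int a" "a \<notin> P" "algebraic_int b" "b \<notin> P" "\<gamma> ^ k * x = a / b"
    using ord_at_unit[OF assms(1)] assms(2) unfolding local_unit_def by auto
  have b0: "b \<noteq> 0"
    using ab zero_in by auto
  then have "b * (\<gamma> ^ k * x) = a"
    using ab(5) by simp
  then have "((\<gamma> * unif) ^ k * b) * x = unif ^ k * a"
    by (simp add: power_mult_distrib mult_ac)
  moreover have "algebraic_int ((\<gamma> * unif) ^ k * b)" "(\<gamma> * unif) ^ k * b \<notin> P"
    using mult_notin[OF algebraic_int_power[OF gamma_unif(1)] ab(3) power_notin[OF gamma_unif(1,2)] ab(4)]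
      algebraic_int_mult[OF algebraic_int_power[OF gamma_unif(1)] ab(3)] by blast+
  ultimately show ?thesis
    using ab(1) by blast
qed

lemma ord_at_nonneg_iff:
  assumes "x \<noteq> 0"
  shows "ord_at x \<ge> 0 \<longleftrightarrow> local_integral x"
proof
  assume "ord_at x \<ge> 0"
  then obtain s c where "algebraic_int s" "s \<notin> P" "algebraic_int c" "s * x = unif ^ nat (ord_at x) * c"
    using ord_at_clear[OF assms, of "nat (ord_at x)"] by auto
  moreover have "algebraic_int (unif ^ nat (ord_at x) * c)" if "algebraic_int c" for c
    using gamma_unif(3) that by (intro algebraic_int_mult algebraic_int_power)
  ultimately show "local_integral x"
    unfolding local_integral_def by (intro exI[of _ s]) simp
next
  assume "local_integral x"
  then obtain s where s: "algebraic_int s" "s \<notin> P" "algebraic_int (s * x)"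
    unfolding local_integral_def by blast
  then have "s \<noteq> 0"
    using zero_in by auto
  then have "ord_at (s * x) \<ge> 0"
    using s assms by (intro ord_at_integer_nonneg) auto
  then show "ord_at x \<ge> 0"
    using ord_at_mult[OF \<open>s \<noteq> 0\<close> assms] ord_at_notin[OF s(1,2)] by simp
qed

lemma ord_at_add:
  assumes "x \<noteq> 0" "y \<noteq> 0" "x + y \<noteq> 0" "ord_at x \<ge> k" "ord_at y \<ge> k"
  shows "ord_at (x + y) \<ge> k"
proof -
  have g0: "\<gamma> powi k \<noteq> 0"
    using gamma_unif(4) by simp
  have ord: "ord_at (\<gamma> powi k * z) = ord_at z - k" if "z \<noteq> 0" for z
    using ord_at_mult[OF g0 that] ord_at_gamma by simp
  have int: "local_integral (\<gamma> powi k * z)" if "z \<noteq> 0" "ord_at z \<ge> k" for z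
    using ord_at_nonneg_iff[of "\<gamma> powi k * z"] ord that g0 by simp
  have "local_integral (\<gamma> powi k * (x + y))"
    unfolding distrib_left using assms by (intro local_integral_add int) auto
  then have "ord_at (\<gamma> powi k * (x + y)) \<ge> 0"
    using ord_at_nonneg_iff[of "\<gamma> powi k * (x + y)"] assms(3) g0 by simp
  then show ?thesis
    using ord[OF assms(3)] by simp
qed

definition val :: "'a \<Rightarrow> real" where
  "val x = (if x = 0 then 0 else 2 powr (- real_of_int (ord_at x)))"

lemma absolute_value_val: "absolute_value val" and nonarchimedean_val: "nonarchimedean val"
proof -
  have ultra: "val (x + y) \<le> max (val x) (val y)" for x y
  proof (cases "x = 0 \<or> y = 0 \<or> x + y = 0")
    case False
    then have "ord_at (x + y) \<ge> min (ord_at x) (ord_at y)"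
      by (intro ord_at_add) auto
    then have "ord_at (x + y) \<ge> ord_at x \<or> ord_at (x + y) \<ge> ord_at y"
      by linarith
    then show ?thesis
      using False by (auto simp: val_def le_max_iff_disj)
  qed (auto simp: val_def le_max_iff_disj)
  then show "nonarchimedean val"
    by (simp add: nonarchimedean_def)
  have nonneg: "val x \<ge> 0" for x
    by (simp add: val_def)
  have "val (x + y) \<le> val x + val y" for x y
    using ultra[of x y] nonneg[of x] nonneg[of y] by linarith
  moreover have "val (x * y) = val x * val y" for x y
    by (simp add: val_def ord_at_mult powr_add[symmetric])
  moreover have "val x = 0 \<longleftrightarrow> x = 0" for x
    by (simp add: val_def)
  ultimately show "absolute_value val"
    using nonneg unfolding absolute_value_def by blast
qed

end

sublocale prime_of_number_field \<subseteq> val: nonarch_abs_val val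
  by unfold_locales (rule absolute_value_val nonarchimedean_val)+

context prime_of_number_field
begin

lemma val_le_iff: "x \<noteq> 0 \<Longrightarrow> val x \<le> 2 powr (- real_of_int k) \<longleftrightarrow> ord_at x \<ge> k"
  by (simp add: val_def)

lemma val_less_1_iff:
  assumes "x \<noteq> 0"
  shows "val x < 1 \<longleftrightarrow> ord_at x \<ge> 1"
proof -
  have "(2::real) powr y < 1 \<longleftrightarrow> y < 0" for y
    using powr_less_cancel_iff[of 2 y 0] by simp
  then show ?thesis
    using assms unfolding val_def by (simp only: if_False) linarith
qed

lemma val_le_1_iff: "val x \<le> 1 \<longleftrightarrow> local_integral x"
proof (cases "x = 0")
  case False
  then show ?thesis
    using val_le_iff[of x 0] ord_at_nonneg_iff[of x] by simp
qed (auto intro: local_integral_integer)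

lemma val_integer_le_1: "algebraic_int x \<Longrightarrow> val x \<le> 1"
  using val_le_1_iff local_integral_integer by blast

lemma val_less_1_iff_in: 
  assumes "algebraic_int x"
  shows "val x < 1 \<longleftrightarrow> x \<in> P"
proof (cases "x = 0")
  case False
  then show ?thesis
    using val_less_1_iff[OF False] ord_at_prime_pos[OF _ False] ord_at_notin[OF assms] by fastforce
qed (use zero_in in auto)

text \<open>
  If \<open>p\<close> is the least positive integer in \<open>P\<close>, integers outside of \<open>P\<close> have value \<open>1\<close>, and those in \<open>P\<close> are
  multiples of \<open>p\<close>.
\<close>

lemma val_of_nat_lower: "\<exists>C\<ge>0. \<forall>M>0. val (of_nat M) \<ge> real M powr (- C)"
proof -
  define p where "p = (LEAST N. N > 0 \<and> (of_nat N :: 'a) \<in> P)"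
  have p: "p > 0" "(of_nat p :: 'a) \<in> P"
    using LeastI_ex[OF exists_positive_integer] unfolding p_def by auto
  have least: "p \<le> N" if "N > 0" "(of_nat N :: 'a) \<in> P" for N
    unfolding p_def using that by (intro Least_le) auto
  have "p \<noteq> 1"
    using p one_notin by auto
  then have p2: "p \<ge> 2"
    using p(1) by linarith
  have vp: "0 < val (of_nat p)" "val (of_nat p) < 1"
    using p val_less_1_iff_in[of "of_nat p"] by auto
  \<comment> \<open>chosen such that \<open>val p = p powr - C\<close>\<close>
  define C where "C = - ln (val (of_nat p)) / ln (real p)"
  have "C \<ge> 0"
    unfolding C_def using vp p2 ln_less_zero[of "val (of_nat p)"]
    by (intro divide_nonneg_pos ln_gt_zero) linarith+
  have valp: "val (of_nat p) = real p powr (- C)"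
    using vp p2 by (simp add: C_def powr_def)
  have "val (of_nat M) \<ge> real M powr (- C)" if "M > 0" for M
    using that
  proof (induction M rule: less_induct)
    case (less M)
    show ?case
    proof (cases "(of_nat M :: 'a) \<in> P")
      case False
      then have "val (of_nat M) = 1"
        using val_less_1_iff_in[of "of_nat M"] val_integer_le_1[of "of_nat M"] by force
      moreover have "real M powr (- C) \<le> 1"
        using less.prems \<open>C \<ge> 0\<close> powr_mono[of "- C" 0 "real M"] by simp
      ultimately show ?thesis
        by simp
    next
      case True
      have "of_nat (M mod p) = (of_nat M :: 'a) - of_nat (M div p) * of_nat p"
        by (metis add_diff_cancel_left' of_nat_add of_nat_mult div_mult_mod_eq)
      also have "\<dots> \<in> P"
        using True p(2) by (intro diff_closed mult_closed) auto
      finally have "M mod p = 0"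
        using least[of "M mod p"] p(1) mod_less_divisor[of p M] by (meson linorder_not_le not_gr_zero)
      then obtain N where N: "M = p * N"
        by blast
      then have N0: "N > 0" "N < M"
        using less.prems p2 by auto
      have "real M powr (- C) = real p powr (- C) * real N powr (- C)"
        unfolding N by (simp add: powr_mult)
      also have "\<dots> \<le> val (of_nat p) * val (of_nat N)"
        using less.IH[OF N0(2,1)] by (intro mult_mono) (simp_all add: valp)
      also have "\<dots> = val (of_nat M)"
        unfolding N by (simp add: val.mult)
      finally show ?thesis .
    qed
  qed
  then show ?thesis
    using \<open>C \<ge> 0\<close> by blast
qed

end

section \<open>A number field has finitely many archimedean places\<close>

text \<open>
  This removes the polynomial factors that arise when an estimate is applied to powers.
\<close>

lemma le_1_if_powers_grow_linearly:
  fixes r :: real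
  assumes "\<And>n. r ^ n \<le> A * real n + B"
  shows "r \<le> 1"
proof (rule ccontr)
  assume "\<not> r \<le> 1"
  then have r: "r > 1"
    by simp
  have lim: "(\<lambda>n. real n * (1 / r) ^ n) \<longlonglongrightarrow> 0" "(\<lambda>n. (1 / r) ^ n) \<longlonglongrightarrow> 0"
    using r powser_times_n_limit_0[of "1 / r"] LIMSEQ_power_zero[of "1 / r"] by simp_all
  have "(\<lambda>n. A * (real n * (1 / r) ^ n) + B * (1 / r) ^ n) \<longlonglongrightarrow> A * 0 + B * 0"
    by (intro tendsto_add tendsto_mult tendsto_const lim)
  moreover have "1 \<le> A * (real n * (1 / r) ^ n) + B * (1 / r) ^ n" for n
  proof -
    have "1 = r ^ n * (1 / r) ^ n"
      using r by (simp add: power_divide)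
    also have "\<dots> \<le> (A * real n + B) * (1 / r) ^ n"
      using r by (intro mult_right_mono assms) auto
    finally show ?thesis
      by (simp add: algebra_simps)
  qed
  ultimately have "1 \<le> A * 0 + B * 0"
    by (intro LIMSEQ_le_const) auto
  then show False
    by simp
qed

context abs_val
begin

lemma inverse_less_1:
  assumes "x \<noteq> 0"
  shows "v (inverse x) < 1 \<longleftrightarrow> v x > 1"
proof -
  have "v x > 0"
    using assms by simp
  then have "\<not> v x \<le> 0"
    by linarith
  then show ?thesis
    unfolding inverse inverse_less_1_iff by blast
qed

lemma nonarchimedean_if_bounded_on_naturals:
  assumes "\<And>n. v (of_nat n) \<le> 1"
  shows "nonarchimedean v"
  unfolding nonarchimedean_def
proof (intro allI)
  fix x y
  define M where "M = max (v x) (v y)"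
  have M: "v x \<le> M" "v y \<le> M" "M \<ge> 0"
    by (auto simp: M_def le_max_iff_disj)
  have pow: "v (x + y) ^ n \<le> M ^ n * (1 * real n + 1)" for n
  proof -
    have "v (x + y) ^ n = v (\<Sum>k\<le>n. of_nat (n choose k) * x ^ k * y ^ (n - k))"
      by (simp add: power[symmetric] binomial_ring)
    also have "\<dots> \<le> (\<Sum>k\<le>n. v (of_nat (n choose k)) * v x ^ k * v y ^ (n - k))"
      by (rule order_trans[OF sum_le]) (simp add: mult power)
    also have "\<dots> \<le> (\<Sum>k\<le>n. 1 * M ^ k * M ^ (n - k))"
      using M assms by (intro sum_mono mult_mono power_mono) auto
    also have "\<dots> = M ^ n * (1 * real n + 1)"
      by (simp add: power_add[symmetric])
    finally show ?thesis .
  qed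
  show "v (x + y) \<le> max (v x) (v y)"
  proof (cases "M = 0")
    case True
    then show ?thesis
      using pow[of 1] by (simp add: M_def)
  next
    case False
    then have "M > 0"
      using M(3) by simp
    have "v (x + y) / M \<le> 1"
    proof (rule le_1_if_powers_grow_linearly)
      show "(v (x + y) / M) ^ n \<le> 1 * real n + 1" for n
        using pow[of n] \<open>M > 0\<close> by (simp add: power_divide field_simps)
    qed
    then show ?thesis
      using \<open>M > 0\<close> by (simp add: M_def field_simps)
  qed
qed

text \<open>
  Expand \<open>N\<close> in base \<open>b\<close>.
\<close>

lemma digit_bound:
  assumes "b \<ge> 2" "N < b ^ k"
  shows "v (of_nat N) \<le> real k * real b * max 1 (v (of_nat b)) ^ k"
  using assms(2)
proof (induction k arbitrary: N)
  case (Suc k)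
  let ?M = "max 1 (v (of_nat b))"
  have "N div b < b ^ k"
    using Suc.prems assms(1) by (simp add: less_mult_imp_div_less mult.commute)
  then have IH: "v (of_nat (N div b)) \<le> real k * real b * ?M ^ k"
    by (rule Suc.IH)
  have "v (of_nat N) = v (of_nat (N mod b) + of_nat b * of_nat (N div b))"
    by (metis mod_mult_div_eq of_nat_add of_nat_mult)
  also have "\<dots> \<le> v (of_nat (N mod b)) + v (of_nat b) * v (of_nat (N div b))"
    using triangle by (metis mult)
  also have "\<dots> \<le> real b * ?M ^ Suc k + ?M * (real k * real b * ?M ^ k)"
  proof (intro add_mono mult_mono)
    have "v (of_nat (N mod b)) \<le> real (N mod b)"
      by (rule of_nat_le)
    also have "\<dots> \<le> real b * 1"
      using assms(1) by (simp add: less_imp_le)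
    also have "\<dots> \<le> real b * ?M ^ Suc k"
      by (intro mult_left_mono one_le_power) auto
    finally show "v (of_nat (N mod b)) \<le> real b * ?M ^ Suc k" .
  qed (use IH in auto)
  also have "\<dots> = real (Suc k) * real b * ?M ^ Suc k"
    by (simp add: algebra_simps)
  finally show ?case .
qed simp

text \<open>
  If \<open>v b \<le> 1\<close>, the expansion in base \<open>b\<close> of the powers of \<open>a\<close> bounds \<open>v a\<close> by \<open>1\<close> for every natural number \<open>a\<close>.
\<close>

lemma archimedean_gt_1:
  assumes "\<not> nonarchimedean v" "b \<ge> 2"
  shows "v (of_nat b) > 1"
proof (rule ccontr)
  assume "\<not> v (of_nat b) > 1"
  then have M: "max 1 (v (of_nat b)) = 1"
    by simp
  have "v (of_nat a) \<le> 1" for a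
  proof (rule le_1_if_powers_grow_linearly)
    fix n
    have "a < 2 ^ a"
      by (rule less_exp)
    also have "\<dots> \<le> b ^ a"
      using assms(2) by (intro power_mono) auto
    finally have "a ^ n \<le> b ^ (a * n)"
      using power_mono[of a "b ^ a" n] by (simp add: power_mult)
    also have "\<dots> < b ^ Suc (a * n)"
      using assms(2) by simp
    finally have "v (of_nat (a ^ n)) \<le> real (Suc (a * n)) * real b"
      using digit_bound[OF assms(2), of "a ^ n" "Suc (a * n)"] M by simp
    then show "v (of_nat a) ^ n \<le> (real a * real b) * real n + real b"
      by (simp add: power algebra_simps)
  qed
  then show False
    using nonarchimedean_if_bounded_on_naturals assms(1) by blast
qed

text \<open>
  The number \<open>a ^ n\<close> has at most \<open>n + 1\<close> digits in base \<open>b\<close>. This weak form of Ostrowski's theorem is all that the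
  comparison of integers below requires.
\<close>

lemma archimedean_mono:
  assumes "\<not> nonarchimedean v" "a \<le> b"
  shows "v (of_nat a) \<le> v (of_nat b)"
proof -
  consider "a = b" | "a = 0" | "b \<ge> 2"
    using assms(2) by linarith
  then show ?thesis
  proof cases
    case 3
    have b1: "v (of_nat b) > 1"
      using archimedean_gt_1[OF assms(1) 3] .
    have "v (of_nat a) / v (of_nat b) \<le> 1"
    proof (rule le_1_if_powers_grow_linearly)
      fix n
      have "a ^ n \<le> b ^ n"
        using assms(2) by (intro power_mono) auto
      also have "\<dots> < b ^ Suc n"
        using 3 by simp
      finally have "v (of_nat (a ^ n)) \<le> real (Suc n) * real b * v (of_nat b) ^ Suc n"
        using digit_bound[OF 3, of "a ^ n" "Suc n"] b1 by simp
      then have "v (of_nat a) ^ n \<le> (real (Suc n) * real b * v (of_nat b)) * v (of_nat b) ^ n"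
        by (simp add: power mult_ac)
      moreover have "v (of_nat b) ^ n > 0"
        using b1 by (intro zero_less_power) linarith
      ultimately have "v (of_nat a) ^ n / v (of_nat b) ^ n \<le> real (Suc n) * real b * v (of_nat b)"
        by (simp add: pos_divide_le_eq)
      then show "(v (of_nat a) / v (of_nat b)) ^ n
          \<le> (real b * v (of_nat b)) * real n + real b * v (of_nat b)"
        by (simp add: power_divide algebra_simps)
    qed
    moreover have "v (of_nat b) > 0"
      using b1 by linarith
    ultimately show ?thesis
      using divide_le_eq_1_pos by blast
  qed auto
qed

lemma archimedean_mono_int:
  assumes "\<not> nonarchimedean v" "\<bar>a\<bar> \<le> \<bar>b\<bar>"
  shows "v (of_int a) \<le> v (of_int b)"
  unfolding of_int_abs using assms by (intro archimedean_mono) auto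

lemma tendsto_one_plus_power:
  assumes "v x < 1"
  shows "(\<lambda>k. v (1 + x ^ k)) \<longlonglongrightarrow> 1"
proof (rule real_tendsto_sandwich)
  have lim: "(\<lambda>k. v x ^ k) \<longlonglongrightarrow> 0"
    using assms by (intro LIMSEQ_power_zero) simp
  show "(\<lambda>k. 1 - v x ^ k) \<longlonglongrightarrow> 1"
    using tendsto_diff[OF tendsto_const[of 1] lim] by simp
  show "(\<lambda>k. 1 + v x ^ k) \<longlonglongrightarrow> 1"
    using tendsto_add[OF tendsto_const[of 1] lim] by simp
  show "\<forall>\<^sub>F k in sequentially. 1 - v x ^ k \<le> v (1 + x ^ k)"
    using triangle_rev[of 1] by (auto simp: power[symmetric])
  show "\<forall>\<^sub>F k in sequentially. v (1 + x ^ k) \<le> 1 + v x ^ k"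
    using triangle[of 1] by (auto simp: power[symmetric])
qed

text \<open>
  The elements \<open>x ^ k / (1 + x ^ k)\<close> tend to \<open>0\<close> where \<open>x\<close> is small and to \<open>1\<close> where \<open>x\<close> is large.
\<close>

lemma tendsto_selector_0:
  assumes "v x < 1"
  shows "(\<lambda>k. v (x ^ k / (1 + x ^ k))) \<longlonglongrightarrow> 0"
proof -
  have "(\<lambda>k. v x ^ k) \<longlonglongrightarrow> 0"
    using assms by (intro LIMSEQ_power_zero) simp
  then have "(\<lambda>k. v x ^ k / v (1 + x ^ k)) \<longlonglongrightarrow> 0 / 1"
    by (intro tendsto_divide tendsto_one_plus_power assms) auto
  then show ?thesis
    by (simp add: divide power)
qed

lemma tendsto_selector_1:
  assumes "v x > 1"
  shows "(\<lambda>k. v (x ^ k / (1 + x ^ k))) \<longlonglongrightarrow> 1"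
proof -
  have x: "x \<noteq> 0"
    using assms by auto
  have "v (inverse x) < 1"
    using assms inverse_less_1[OF x] by blast
  then have "(\<lambda>k. 1 / v (1 + inverse x ^ k)) \<longlonglongrightarrow> 1 / 1"
    by (intro tendsto_divide tendsto_const tendsto_one_plus_power) auto
  moreover have "v (x ^ k / (1 + x ^ k)) = 1 / v (1 + inverse x ^ k)" for k
  proof -
    have "1 + inverse x ^ k = (1 + x ^ k) / x ^ k"
      using x by (simp add: field_simps)
    then show ?thesis
      by (simp add: divide)
  qed
  ultimately show ?thesis
    by simp
qed

end

lemma nontrivialD:
  assumes "v \<in> nontrivial_absolute_values"
  shows "abs_val v" "\<exists>x. v x > 1"
proof -
  show "abs_val v"
    using assms by (simp add: nontrivial_absolute_values_def abs_val_def)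
  then interpret abs_val v .
  obtain x where x: "x \<noteq> 0" "v x \<noteq> 1"
    using assms by (auto simp: nontrivial_absolute_values_def)
  show "\<exists>x. v x > 1"
  proof (cases "v x > 1")
    case False
    then have "v x < 1"
      using x(2) by linarith
    then have "v (inverse x) > 1"
      using x(1) inverse_less_1[of "inverse x"] by simp
    then show ?thesis
      by blast
  qed blast
qed

text \<open>
  For a fixed \<open>y\<close> with \<open>v y > 1\<close>, the ratio \<open>ln (v x) / ln (v y)\<close> is determined by the rationals \<open>m / n\<close> on either
  side of it, that is, by whether \<open>v\<close> is below or above \<open>1\<close> at \<open>x ^ n * y powi - m\<close>. By assumption \<open>w\<close>
  gives the same answers, so the ratios for \<open>v\<close> and \<open>w\<close> agree.
\<close>

lemma dependent_absolute_values_equivalent: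
  assumes v: "v \<in> nontrivial_absolute_values" and w: "w \<in> nontrivial_absolute_values"
    and imp: "\<And>x. v x < 1 \<Longrightarrow> w x < 1"
  shows "(v, w) \<in> absolute_value_equiv"
proof -
  interpret v: abs_val v
    by (rule nontrivialD(1)[OF v])
  interpret w: abs_val w
    by (rule nontrivialD(1)[OF w])
  obtain y where y: "v y > 1"
    using nontrivialD(2)[OF v] by blast
  then have y0: "y \<noteq> 0"
    by auto
  have wy: "w y > 1"
  proof -
    have "w (inverse y) < 1"
      using y v.inverse_less_1[OF y0] by (intro imp) blast
    then show ?thesis
      using w.inverse_less_1[OF y0] by blast
  qed
  have ln_eq: "ln (w x) / ln (w y) = ln (v x) / ln (v y)" if x: "x \<noteq> 0" for x
  proof -
    define z where "z = (\<lambda>(m::int) (n::nat). x ^ n * y powi - m)"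
    have lnz: "ln (u (z m n)) = real n * ln (u x) - real_of_int m * ln (u y)" and zpos: "u (z m n) > 0"
      if "abs_val u" for u m n
    proof -
      interpret u: abs_val u
        by fact
      have pow: "u (y powi k) = u y powi k" for k
        by (simp add: power_int_def u.power u.inverse)
      have pos: "u x > 0" "u y > 0"
        using x y0 by auto
      have "u (z m n) = u x ^ n * u y powr real_of_int (- m)"
        using powr_real_of_int'[of "u y" "- m"] y0 by (simp add: z_def u.mult u.power pow)
      then show "ln (u (z m n)) = real n * ln (u x) - real_of_int m * ln (u y)"
        using pos by (simp add: ln_mult_pos ln_realpow ln_powr)
      show "u (z m n) > 0"
        using x y0 by (simp add: z_def)
    qed
    have 1: "real n * ln (w x) < real_of_int m * ln (w y)"
      if "real n * ln (v x) < real_of_int m * ln (v y)" for m n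
    proof -
      have "ln (v (z m n)) < 0"
        using lnz[OF v.abs_val_axioms, of m n] that by simp
      then have "v (z m n) < 1"
        using zpos[OF v.abs_val_axioms, of m n] by simp
      then have "w (z m n) < 1"
        by (rule imp)
      then have "ln (w (z m n)) < 0"
        using zpos[OF w.abs_val_axioms, of m n] by simp
      then show ?thesis
        using lnz[OF w.abs_val_axioms, of m n] by simp
    qed
    have 2: "real n * ln (w x) > real_of_int m * ln (w y)"
      if "real n * ln (v x) > real_of_int m * ln (v y)" for m n
    proof -
      have "ln (v (z m n)) > 0"
        using lnz[OF v.abs_val_axioms, of m n] that by simp
      then have "v (z m n) > 1"
        using zpos[OF v.abs_val_axioms, of m n] by simp
      have z0: "z m n \<noteq> 0"
        using x y0 by (simp add: z_def)
      have "w (inverse (z m n)) < 1"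
        using \<open>v (z m n) > 1\<close> v.inverse_less_1[OF z0] by (intro imp) blast
      then have "w (z m n) > 1"
        using w.inverse_less_1[OF z0] by blast
      then have "ln (w (z m n)) > 0"
        by (rule ln_gt_zero)
      then show ?thesis
        using lnz[OF w.abs_val_axioms, of m n] by simp
    qed
    have lny: "ln (v y) > 0" "ln (w y) > 0"
      by (rule ln_gt_zero[OF y]) (rule ln_gt_zero[OF wy])
    show ?thesis
    proof (rule ccontr)
      assume "ln (w x) / ln (w y) \<noteq> ln (v x) / ln (v y)"
      then consider "ln (w x) / ln (w y) < ln (v x) / ln (v y)" | "ln (v x) / ln (v y) < ln (w x) / ln (w y)"
        by linarith
      then show False
      proof cases
        case 1
        then obtain r where r: "r \<in> \<rat>" "ln (w x) / ln (w y) < r" "r < ln (v x) / ln (v y)"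
          using Rats_dense_in_real by blast
        obtain m n where mn: "r = real_of_int m / real n" "n \<noteq> 0"
          using r(1) unfolding Rats_eq_int_div_nat by blast
        have "real_of_int m * ln (v y) < real n * ln (v x)"
          using r(3) lny mn by (simp add: field_simps)
        then have "real_of_int m * ln (w y) < real n * ln (w x)"
          by (rule 2)
        then show False
          using r(2) lny mn by (simp add: field_simps)
      next
        case 2
        then obtain r where r: "r \<in> \<rat>" "ln (v x) / ln (v y) < r" "r < ln (w x) / ln (w y)"
          using Rats_dense_in_real by blast
        obtain m n where mn: "r = real_of_int m / real n" "n \<noteq> 0"
          using r(1) unfolding Rats_eq_int_div_nat by blast
        have "real n * ln (v x) < real_of_int m * ln (v y)"
          using r(2) lny mn by (simp add: field_simps)
        then have "real n * ln (w x) < real_of_int m * ln (w y)"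
          by (rule 1)
        then show False
          using r(3) lny mn by (simp add: field_simps)
      qed
    qed
  qed
  define s where "s = ln (w y) / ln (v y)"
  have "s > 0"
    unfolding s_def using y wy by (intro divide_pos_pos ln_gt_zero)
  moreover have "w x = v x powr s" for x
  proof (cases "x = 0")
    case False
    then have "ln (w x) = s * ln (v x)"
      using ln_eq[OF False] ln_gt_zero[OF y] ln_gt_zero[OF wy] by (simp add: s_def field_simps)
    then have "exp (ln (w x)) = exp (s * ln (v x))"
      by simp
    then show ?thesis
      using False by (simp add: powr_def)
  qed simp
  ultimately show ?thesis
    using v w unfolding absolute_value_equiv_def by blast
qed

lemma equiv_absolute_value_equiv:
  "equiv (nontrivial_absolute_values :: ('a::field \<Rightarrow> real) set) absolute_value_equiv"
proof (rule equivI)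
  show "(absolute_value_equiv :: (('a \<Rightarrow> real) \<times> ('a \<Rightarrow> real)) set) \<subseteq> nontrivial_absolute_values \<times> nontrivial_absolute_values"
    by (auto simp: absolute_value_equiv_def)
  show "refl_on nontrivial_absolute_values (absolute_value_equiv :: (('a \<Rightarrow> real) \<times> ('a \<Rightarrow> real)) set)"
  proof (rule refl_onI)
    fix v :: "'a \<Rightarrow> real" assume v: "v \<in> nontrivial_absolute_values"
    then interpret abs_val v
      by (rule nontrivialD)
    show "(v, v) \<in> absolute_value_equiv"
      using v unfolding absolute_value_equiv_def by (auto intro!: exI[of _ 1])
  qed
  show "sym (absolute_value_equiv :: (('a \<Rightarrow> real) \<times> ('a \<Rightarrow> real)) set)"
  proof (rule symI)
    fix v w :: "'a \<Rightarrow> real" assume "(v, w) \<in> absolute_value_equiv"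
    then obtain s where s: "v \<in> nontrivial_absolute_values" "w \<in> nontrivial_absolute_values" "s > 0"
      "\<And>x. w x = v x powr s"
      unfolding absolute_value_equiv_def by blast
    interpret abs_val v
      using s(1) by (rule nontrivialD)
    have "v x = w x powr (1 / s)" for x
      using s(3) by (simp add: s(4) powr_powr)
    then show "(w, v) \<in> absolute_value_equiv"
      using s(1-3) unfolding absolute_value_equiv_def by (auto intro!: exI[of _ "1 / s"])
  qed
  show "trans (absolute_value_equiv :: (('a \<Rightarrow> real) \<times> ('a \<Rightarrow> real)) set)"
  proof (rule transI)
    fix u v w :: "'a \<Rightarrow> real"
    assume "(u, v) \<in> absolute_value_equiv" "(v, w) \<in> absolute_value_equiv"
    then obtain s t where st: "u \<in> nontrivial_absolute_values" "w \<in> nontrivial_absolute_values" "s > 0" "t > 0"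
      "\<And>x. v x = u x powr s" "\<And>x. w x = v x powr t"
      unfolding absolute_value_equiv_def by blast
    have "w x = u x powr (s * t)" for x
      by (simp add: st(5,6) powr_powr)
    then show "(u, w) \<in> absolute_value_equiv"
      using st(1-4) unfolding absolute_value_equiv_def by (auto intro!: exI[of _ "s * t"])
  qed
qed

lemma exists_large_small:
  assumes v: "v \<in> nontrivial_absolute_values" and w: "w \<in> nontrivial_absolute_values"
    and "(v, w) \<notin> absolute_value_equiv"
  shows "\<exists>x. v x > 1 \<and> w x < 1"
proof -
  interpret v: abs_val v
    by (rule nontrivialD(1)[OF v])
  interpret w: abs_val w
    by (rule nontrivialD(1)[OF w])
  have wv: "(w, v) \<notin> absolute_value_equiv"
    using assms(3) equiv_absolute_value_equiv unfolding equiv_def by (blast dest: symD)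
  obtain x where x: "v x < 1" "w x \<ge> 1"
    using dependent_absolute_values_equivalent[OF v w] assms(3) not_less by blast
  obtain y where y: "w y < 1" "v y \<ge> 1"
    using dependent_absolute_values_equivalent[OF w v] wv not_less by blast
  have "x \<noteq> 0"
    using x(2) by auto
  then have "v x > 0"
    by simp
  then have "v (y / x) > 1"
    using x(1) y(2) by (simp add: v.divide less_divide_eq)
  moreover have "w (y / x) < 1"
    using x(2) y(1) by (simp add: w.divide divide_less_eq)
  ultimately show ?thesis
    by blast
qed

text \<open>
  Weak approximation, by adding one absolute value \<open>u\<close> at a time. If \<open>x\<close> is not large at \<open>u\<close>, multiply an element
  that separates \<open>v\<close> from \<open>u\<close> by a high power of \<open>x\<close>; if it is, multiply by \<open>x ^ k / (1 + x ^ k)\<close> instead, which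
  is near \<open>1\<close> at both \<open>v\<close> and \<open>u\<close>.
\<close>

lemma exists_large_at_one:
  assumes "finite W" and v: "v \<in> nontrivial_absolute_values"
    and W: "\<And>w. w \<in> W \<Longrightarrow> w \<in> nontrivial_absolute_values \<and> (v, w) \<notin> absolute_value_equiv"
  shows "\<exists>x. v x > 1 \<and> (\<forall>w\<in>W. w x < 1)"
  using assms(1) W
proof (induction W)
  case empty
  then show ?case
    using nontrivialD(2)[OF v] by simp
next
  case (insert u W)
  obtain x where x: "v x > 1" "\<And>w. w \<in> W \<Longrightarrow> w x < 1"
    using insert.IH insert.prems by auto
  obtain y where y: "v y > 1" "u y < 1"
    using exists_large_small[OF v, of u] insert.prems by auto
  interpret v: abs_val v
    by (rule nontrivialD(1)[OF v])
  interpret u: abs_val u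
    using insert.prems nontrivialD(1) by blast
  have avW: "abs_val w" if "w \<in> W" for w
    using insert.prems nontrivialD(1) that by blast
  show ?case
  proof (cases "u x > 1")
    case True
    define z where "z = (\<lambda>k. x ^ k / (1 + x ^ k) * y)"
    have "(\<lambda>k. v (z k)) \<longlonglongrightarrow> 1 * v y"
      unfolding z_def v.mult by (intro tendsto_mult tendsto_const v.tendsto_selector_1 x)
    then have ev: "\<forall>\<^sub>F k in sequentially. v (z k) > 1"
      using y(1) by (intro order_tendstoD(1)) auto
    have "(\<lambda>k. u (z k)) \<longlonglongrightarrow> 1 * u y"
      unfolding z_def u.mult by (intro tendsto_mult tendsto_const u.tendsto_selector_1 True)
    then have eu: "\<forall>\<^sub>F k in sequentially. u (z k) < 1"
      using y(2) by (intro order_tendstoD(2)) auto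
    have ew: "\<forall>\<^sub>F k in sequentially. w (z k) < 1" if "w \<in> W" for w
    proof -
      interpret w: abs_val w
        by (rule avW[OF that])
      have "(\<lambda>k. w (z k)) \<longlonglongrightarrow> 0 * w y"
        unfolding z_def w.mult by (intro tendsto_mult tendsto_const w.tendsto_selector_0 x that)
      then show ?thesis
        by (intro order_tendstoD(2)) auto
    qed
    then have "\<forall>\<^sub>F k in sequentially. \<forall>w\<in>W. w (z k) < 1"
      using insert.hyps by (intro eventually_ball_finite) auto
    then have "\<forall>\<^sub>F k in sequentially. v (z k) > 1 \<and> u (z k) < 1 \<and> (\<forall>w\<in>W. w (z k) < 1)"
      using ev eu by (intro eventually_conj)
    then obtain k where "v (z k) > 1 \<and> u (z k) < 1 \<and> (\<forall>w\<in>W. w (z k) < 1)"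
      using eventually_happens' sequentially_bot by blast
    then show ?thesis
      by (intro exI[of _ "z k"]) auto
  next
    case False
    define z where "z = (\<lambda>k. x ^ k * y)"
    have "\<forall>\<^sub>F k in sequentially. w (z k) < 1" if "w \<in> W" for w
    proof -
      interpret w: abs_val w
        by (rule avW[OF that])
      have "(\<lambda>k. w x ^ k) \<longlonglongrightarrow> 0"
        using x(2)[OF that] by (intro LIMSEQ_power_zero) simp
      then have "(\<lambda>k. w (z k)) \<longlonglongrightarrow> 0 * w y"
        unfolding z_def w.mult w.power by (intro tendsto_mult tendsto_const)
      then show ?thesis
        by (intro order_tendstoD(2)) auto
    qed
    then have "\<forall>\<^sub>F k in sequentially. \<forall>w\<in>W. w (z k) < 1"
      using insert.hyps by (intro eventually_ball_finite) auto
    then obtain k where k: "\<forall>w\<in>W. w (z k) < 1"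
      using eventually_happens' sequentially_bot by blast
    have "1 * 1 < v x ^ k * v y"
      using x(1) y(1) one_le_power[of "v x" k] mult_le_less_imp_less[of 1 "v x ^ k" 1 "v y"] by simp
    then have "v (z k) > 1"
      by (simp add: z_def v.mult v.power)
    moreover have "u x ^ k * u y \<le> 1 * u y"
      using False by (intro mult_right_mono power_le_one) auto
    then have "u (z k) < 1"
      using y(2) by (simp add: z_def u.mult u.power)
    ultimately show ?thesis
      using k by (intro exI[of _ "z k"]) auto
  qed
qed

lemma arch_place_rep:
  assumes "\<pi> \<in> arch_places"
  shows "\<exists>v. v \<in> nontrivial_absolute_values \<and> \<not> nonarchimedean v \<and> \<pi> = absolute_value_equiv `` {v}"
proof -
  obtain v where v: "v \<in> nontrivial_absolute_values" "\<pi> = absolute_value_equiv `` {v}"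
    using assms unfolding arch_places_def places_def quotient_def by blast
  have "v \<in> \<pi>"
    unfolding v(2) using equiv_class_self[OF equiv_absolute_value_equiv v(1)] .
  then have "\<not> nonarchimedean v"
    using assms unfolding arch_places_def by blast
  then show ?thesis
    using v by blast
qed

context number_field_type
begin

text \<open>
  More pairwise inequivalent archimedean absolute values than the degree of the field would give as many
  elements, each near \<open>1\<close> at one of them and near \<open>0\<close> at the others. These satisfy an integral
  relation. At the absolute value that belongs to the largest coefficient, this coefficient
  dominates, because archimedean absolute values are monotone on integers.
\<close>

lemma finite_arch_places: "finite (arch_places :: ('a \<Rightarrow> real) set set)"
proof (rule ccontr)
  assume "infinite (arch_places :: ('a \<Rightarrow> real) set set)"
  then obtain T :: "('a \<Rightarrow> real) set set" where T: "T \<subseteq> arch_places" "finite T" "card T = Suc (card qbasis)"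
    using infinite_arbitrarily_large by blast
  have "\<forall>\<pi>\<in>T. \<exists>v. v \<in> nontrivial_absolute_values \<and> \<not> nonarchimedean v \<and> \<pi> = absolute_value_equiv `` {v}"
    using T(1) arch_place_rep by blast
  then obtain v where v: "\<And>\<pi>. \<pi> \<in> T \<Longrightarrow> v \<pi> \<in> nontrivial_absolute_values"
    "\<And>\<pi>. \<pi> \<in> T \<Longrightarrow> \<not> nonarchimedean (v \<pi>)" "\<And>\<pi>. \<pi> \<in> T \<Longrightarrow> \<pi> = absolute_value_equiv `` {v \<pi>}"
    by metis
  have ineq: "(v \<pi>, v \<rho>) \<notin> absolute_value_equiv" if "\<pi> \<in> T" "\<rho> \<in> T" "\<pi> \<noteq> \<rho>" for \<pi> \<rho>
    using equiv_class_eq[OF equiv_absolute_value_equiv, of "v \<pi>" "v \<rho>"] v(3)[OF that(1)] v(3)[OF that(2)] that(3)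
    by auto
  have "\<exists>x. v \<pi> x > 1 \<and> (\<forall>\<rho>\<in>T - {\<pi>}. v \<rho> x < 1)" if \<pi>: "\<pi> \<in> T" for \<pi>
  proof -
    have "\<exists>x. v \<pi> x > 1 \<and> (\<forall>w\<in>v ` (T - {\<pi>}). w x < 1)"
      using T(2) v(1) ineq \<pi> by (intro exists_large_at_one) auto
    then show ?thesis
      by auto
  qed
  then obtain x where x: "\<And>\<pi>. \<pi> \<in> T \<Longrightarrow> v \<pi> (x \<pi>) > 1"
     "\<And>\<pi> \<rho>. \<pi> \<in> T \<Longrightarrow> \<rho> \<in> T \<Longrightarrow> \<rho> \<noteq> \<pi> \<Longrightarrow> v \<rho> (x \<pi>) < 1"
    by (metis DiffI singletonD)
  define z where "z = (\<lambda>\<pi> k. x \<pi> ^ k / (1 + x \<pi> ^ k))"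
  define \<epsilon> where "\<epsilon> = 1 / (2 * real (card T))"
  have "card T > 0"
    using T(3) by simp
  then have "\<epsilon> > 0"
    by (simp add: \<epsilon>_def)
  have av: "abs_val (v \<pi>)" if "\<pi> \<in> T" for \<pi>
    using v(1)[OF that] by (rule nontrivialD)
  have "\<forall>\<^sub>F k in sequentially. \<forall>\<pi>\<in>T. v \<pi> (z \<pi> k) > 1 / 2"
  proof (rule eventually_ball_finite[OF T(2)], rule ballI)
    fix \<pi> assume "\<pi> \<in> T"
    then have "(\<lambda>k. v \<pi> (z \<pi> k)) \<longlonglongrightarrow> 1"
      unfolding z_def by (intro abs_val.tendsto_selector_1 av x)
    then show "\<forall>\<^sub>F k in sequentially. v \<pi> (z \<pi> k) > 1 / 2"
      by (intro order_tendstoD(1)) auto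
  qed
  moreover have "\<forall>\<^sub>F k in sequentially. \<forall>\<pi>\<in>T. \<forall>\<rho>\<in>T - {\<pi>}. v \<rho> (z \<pi> k) < \<epsilon>"
  proof (intro eventually_ball_finite ballI finite_Diff T(2))
    fix \<pi> \<rho> assume "\<pi> \<in> T" "\<rho> \<in> T - {\<pi>}"
    then have "(\<lambda>k. v \<rho> (z \<pi> k)) \<longlonglongrightarrow> 0"
      unfolding z_def by (intro abs_val.tendsto_selector_0 av x) auto
    then show "\<forall>\<^sub>F k in sequentially. v \<rho> (z \<pi> k) < \<epsilon>"
      using \<open>\<epsilon> > 0\<close> by (intro order_tendstoD(2)) auto
  qed
  ultimately have "\<forall>\<^sub>F k in sequentially. (\<forall>\<pi>\<in>T. v \<pi> (z \<pi> k) > 1 / 2) \<and>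
      (\<forall>\<pi>\<in>T. \<forall>\<rho>\<in>T - {\<pi>}. v \<rho> (z \<pi> k) < \<epsilon>)"
    by (rule eventually_conj)
  then obtain k where k: "\<forall>\<pi>\<in>T. v \<pi> (z \<pi> k) > 1 / 2" "\<forall>\<pi>\<in>T. \<forall>\<rho>\<in>T - {\<pi>}. v \<rho> (z \<pi> k) < \<epsilon>"
    using eventually_happens' sequentially_bot by blast
  define w where "w = (\<lambda>\<pi>. z \<pi> k)"
  have "card T > card qbasis"
    using T(3) by simp
  then obtain c :: "('a \<Rightarrow> real) set \<Rightarrow> int" where c: "\<exists>\<pi>\<in>T. \<not> 2 dvd c \<pi>" "(\<Sum>\<pi>\<in>T. of_int (c \<pi>) * w \<pi>) = 0"
    using integer_relation[OF T(2), of 2 w] by auto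
  have ne: "T \<noteq> {}"
    using \<open>card T > 0\<close> by auto
  obtain \<pi> where \<pi>: "\<pi> \<in> T" "\<And>\<rho>. \<rho> \<in> T \<Longrightarrow> \<bar>c \<rho>\<bar> \<le> \<bar>c \<pi>\<bar>"
  proof -
    have "Max ((\<lambda>\<rho>. \<bar>c \<rho>\<bar>) ` T) \<in> (\<lambda>\<rho>. \<bar>c \<rho>\<bar>) ` T"
      using T(2) ne by (intro Max_in) auto
    then obtain \<pi> where "\<pi> \<in> T" "Max ((\<lambda>\<rho>. \<bar>c \<rho>\<bar>) ` T) = \<bar>c \<pi>\<bar>"
      by blast
    then show ?thesis
      using that[of \<pi>] T(2) by (metis Max_ge finite_imageI imageI)
  qed
  have c0: "c \<pi> \<noteq> 0"
  proof
    assume "c \<pi> = 0"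
    then have "c \<rho> = 0" if "\<rho> \<in> T" for \<rho>
      using \<pi>(2)[OF that] by simp
    then show False
      using c(1) by auto
  qed
  interpret abs_val "v \<pi>"
    by (rule av[OF \<pi>(1)])
  define C where "C = v \<pi> (of_int (c \<pi>))"
  have "C > 0"
    using c0 by (simp add: C_def)
  have "of_int (c \<pi>) * w \<pi> + (\<Sum>\<rho>\<in>T - {\<pi>}. of_int (c \<rho>) * w \<rho>) = 0"
    using c(2) \<pi>(1) T(2) by (simp add: sum.remove)
  then have eq: "of_int (c \<pi>) * w \<pi> = - (\<Sum>\<rho>\<in>T - {\<pi>}. of_int (c \<rho>) * w \<rho>)"
    by (rule eq_neg_iff_add_eq_0[THEN iffD2])
  have "C * v \<pi> (w \<pi>) = v \<pi> (\<Sum>\<rho>\<in>T - {\<pi>}. of_int (c \<rho>) * w \<rho>)"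
    unfolding C_def mult[symmetric] eq by simp
  also have "\<dots> \<le> (\<Sum>\<rho>\<in>T - {\<pi>}. v \<pi> (of_int (c \<rho>)) * v \<pi> (w \<rho>))"
    by (rule order_trans[OF sum_le]) (simp add: mult)
  also have "\<dots> \<le> (\<Sum>\<rho>\<in>T - {\<pi>}. C * \<epsilon>)"
  proof (intro sum_mono mult_mono)
    fix \<rho> assume \<rho>: "\<rho> \<in> T - {\<pi>}"
    show "v \<pi> (of_int (c \<rho>)) \<le> C"
      unfolding C_def using \<pi> \<rho> v(2) by (intro archimedean_mono_int) auto
    show "v \<pi> (w \<rho>) \<le> \<epsilon>"
    proof -
      have "\<rho> \<in> T" "\<pi> \<in> T - {\<rho>}"
        using \<pi>(1) \<rho> by auto
      then have "v \<pi> (z \<rho> k) < \<epsilon>"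
        using k(2) by blast
      then show ?thesis
        unfolding w_def by (rule less_imp_le)
    qed
  qed (use \<open>C > 0\<close> in auto)
  also have "\<dots> = C * (real (card T - 1) * \<epsilon>)"
    using \<pi>(1) T(2) by simp
  also have "\<dots> \<le> C * (real (card T) * \<epsilon>)"
    using \<open>C > 0\<close> \<open>\<epsilon> > 0\<close> by (intro mult_left_mono mult_right_mono) auto
  also have "real (card T) * \<epsilon> = 1 / 2"
    using \<open>card T > 0\<close> by (simp add: \<epsilon>_def)
  finally have "v \<pi> (w \<pi>) \<le> 1 / 2"
    using \<open>C > 0\<close> by simp
  then show False
    using k(1) \<pi>(1) unfolding w_def by auto
qed

end

section \<open>Ideals of the ring of integers\<close>

lemma OK_simps [simp]:
  "carrier OK = {x::'a::field_char_0. algebraic_int x}"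
  "x \<otimes>\<^bsub>OK\<^esub> y = x * (y::'a)" "x \<oplus>\<^bsub>OK\<^esub> y = x + (y::'a)" "\<one>\<^bsub>OK\<^esub> = (1::'a)" "\<zero>\<^bsub>OK\<^esub> = (0::'a)"
  by (simp_all add: OK_def ring_of_type_algebra_def)

lemma cring_OK: "cring (OK :: 'a::field_char_0 ring)"
proof (rule cringI)
  show "abelian_group (OK :: 'a ring)"
  proof (rule abelian_groupI)
    fix x :: 'a assume "x \<in> carrier OK"
    then show "\<exists>y\<in>carrier OK. y \<oplus>\<^bsub>OK\<^esub> x = \<zero>\<^bsub>OK\<^esub>"
      by (intro bexI[of _ "- x"]) auto
  qed (auto simp: add_ac)
  show "Group.comm_monoid (OK :: 'a ring)"
    by (rule comm_monoidI) (auto simp: mult_ac)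
qed (simp add: distrib_right)

lemma ideal_OK_iff:
  fixes I :: "'a::field_char_0 set"
  shows "ideal I OK \<longleftrightarrow> (\<forall>x\<in>I. algebraic_int x) \<and> 0 \<in> I \<and> (\<forall>x\<in>I. \<forall>y\<in>I. x + y \<in> I) \<and>
    (\<forall>a x. algebraic_int a \<longrightarrow> x \<in> I \<longrightarrow> a * x \<in> I)"
    (is "_ \<longleftrightarrow> ?R")
proof
  assume "ideal I OK"
  then interpret ideal I OK .
  show ?R
  proof (intro conjI ballI allI impI)
    show "algebraic_int x" if "x \<in> I" for x
      using a_Hcarr[OF that] by simp
    show "0 \<in> I"
      using additive_subgroup.zero_closed[OF is_additive_subgroup] by simp
    show "x + y \<in> I" if "x \<in> I" "y \<in> I" for x y
      using additive_subgroup.a_closed[OF is_additive_subgroup that] by simp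
    show "a * x \<in> I" if "algebraic_int a" "x \<in> I" for a x
      using I_l_closed[OF that(2), of a] that(1) by simp
  qed
next
  assume R: ?R
  interpret cring "OK :: 'a ring"
    by (rule cring_OK)
  show "ideal I OK"
  proof (rule idealI)
    show "ring (OK :: 'a ring)"
      by (rule ring_axioms)
    show "subgroup I (add_monoid OK)"
    proof
      show "I \<subseteq> carrier (add_monoid OK)"
        using R by auto
      show "x \<otimes>\<^bsub>add_monoid OK\<^esub> y \<in> I" if "x \<in> I" "y \<in> I" for x y
        using R that by simp
      show "\<one>\<^bsub>add_monoid OK\<^esub> \<in> I"
        using R by simp
      show "inv\<^bsub>add_monoid OK\<^esub> x \<in> I" if "x \<in> I" for x
      proof -
        have "\<ominus>\<^bsub>OK\<^esub> x = - x"
          using R that by (intro minus_equality) auto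
        moreover have "- x = (-1) * x"
          by simp
        moreover have "(-1) * x \<in> I"
          using R that algebraic_int_minus[OF algebraic_int_1] by blast
        ultimately show ?thesis
          unfolding a_inv_def[symmetric] by metis
      qed
    qed
    show "x \<otimes>\<^bsub>OK\<^esub> a \<in> I" if "a \<in> I" "x \<in> carrier OK" for a x
      using R that by simp
    show "a \<otimes>\<^bsub>OK\<^esub> x \<in> I" if "a \<in> I" "x \<in> carrier OK" for a x
      using R that by (simp add: mult.commute[of a])
  qed
qed

lemma nonzero_prime_ideal_iff:
  "nonzero_prime_ideal P \<longleftrightarrow> nonzero_prime_set (P :: 'a::field_char_0 set)"
proof
  assume P: "nonzero_prime_ideal P"
  then interpret primeideal P OK
    by (simp add: nonzero_prime_ideal_def)
  have id: "(\<forall>x\<in>P. algebraic_int x) \<and> 0 \<in> P \<and> (\<forall>x\<in>P. \<forall>y\<in>P. x + y \<in> P) \<and>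
    (\<forall>a x. algebraic_int a \<longrightarrow> x \<in> P \<longrightarrow> a * x \<in> P)"
    using ideal_axioms unfolding ideal_OK_iff .
  have "1 \<notin> P"
  proof
    assume "1 \<in> P"
    then have "a * 1 \<in> P" if "algebraic_int a" for a
      using id that by metis
    then have "P = carrier OK"
      using id by (auto simp del: mult_1_right) (metis mult_1_right)
    then show False
      using I_notcarr by simp
  qed
  moreover have "a \<in> P \<or> b \<in> P" if "algebraic_int a" "algebraic_int b" "a * b \<in> P" for a b
    using I_prime[of a b] that by simp
  moreover have "\<exists>x\<in>P. x \<noteq> 0"
    using P id unfolding nonzero_prime_ideal_def by blast
  ultimately show "nonzero_prime_set P"
    using id unfolding nonzero_prime_set_def by blast
next
  assume P: "nonzero_prime_set P"
  then have P': "\<And>x. x \<in> P \<Longrightarrow> algebraic_int x" "\<And>x y. x \<in> P \<Longrightarrow> y \<in> P \<Longrightarrow> x + y \<in> P"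
     "\<And>a x. algebraic_int a \<Longrightarrow> x \<in> P \<Longrightarrow> a * x \<in> P" "1 \<notin> P"
     "\<And>a b. algebraic_int a \<Longrightarrow> algebraic_int b \<Longrightarrow> a * b \<in> P \<Longrightarrow> a \<in> P \<or> b \<in> P" "\<exists>x\<in>P. x \<noteq> 0"
    unfolding nonzero_prime_set_def by blast+
  have "0 \<in> P"
    using P'(3)[of 0] P'(6) by auto
  then have "ideal P OK"
    unfolding ideal_OK_iff using P'(1-3) by blast
  then have "primeideal P OK"
  proof (rule primeidealI)
    show "carrier OK \<noteq> P"
      using P'(4) by auto
    show "a \<in> P \<or> b \<in> P" if "a \<in> carrier OK" "b \<in> carrier OK" "a \<otimes>\<^bsub>OK\<^esub> b \<in> P" for a b
      using P'(5)[of a b] that by simp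
  qed (rule cring_OK)
  then show "nonzero_prime_ideal P"
    using P'(6) unfolding nonzero_prime_ideal_def by auto
qed

lemma ideals_set_simps [simp]:
  "carrier (ideals_set R) = {I. ideal I R}" "monoid.mult (ideals_set R) = ideal_prod R"
  "monoid.one (ideals_set R) = carrier R"
  by (simp_all add: ideals_set_def)

lemma comm_monoid_ideals_OK: "Group.comm_monoid (ideals_set (OK :: 'a::field_char_0 ring))"
  by (rule cring.ideals_set_is_comm_monoid[OF cring_OK])

lemma sum_of_ideals_superset:
  fixes I J :: "'a::field_char_0 set"
  assumes "ideal I OK" "ideal J OK"
  shows "I \<subseteq> I <+>\<^bsub>OK\<^esub> J" "J \<subseteq> I <+>\<^bsub>OK\<^esub> J"
proof -
  have "0 \<in> I" "0 \<in> J"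
    using assms by (simp_all add: ideal_OK_iff)
  then show "I \<subseteq> I <+>\<^bsub>OK\<^esub> J" "J \<subseteq> I <+>\<^bsub>OK\<^esub> J"
    unfolding set_add_def' by (auto intro!: exI bexI)
qed

context prime_of_number_field
begin

abbreviation pw :: "nat \<Rightarrow> 'a set" where
  "pw k \<equiv> P [^]\<^bsub>ideals_set OK\<^esub> k"

lemma ideal_P: "ideal P OK"
  unfolding ideal_OK_iff using integral zero_in add_closed mult_closed by blast

lemma pw_0: "pw 0 = {x. algebraic_int x}"
proof -
  interpret M: Group.comm_monoid "ideals_set (OK :: 'a ring)"
    by (rule comm_monoid_ideals_OK)
  show ?thesis
    by (simp add: M.nat_pow_0)
qed

lemma pw_Suc: "pw (Suc k) = ideal_prod OK (pw k) P"
proof -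
  interpret M: Group.comm_monoid "ideals_set (OK :: 'a ring)"
    by (rule comm_monoid_ideals_OK)
  show ?thesis
    by (simp add: M.nat_pow_Suc)
qed

lemma pw_1: "pw 1 = P"
proof -
  interpret M: Group.comm_monoid "ideals_set (OK :: 'a ring)"
    by (rule comm_monoid_ideals_OK)
  show ?thesis
    using M.nat_pow_eone[of P] ideal_P by simp
qed

lemma ideal_pw: "ideal (pw k) OK"
proof -
  interpret M: Group.comm_monoid "ideals_set (OK :: 'a ring)"
    by (rule comm_monoid_ideals_OK)
  show ?thesis
    using M.nat_pow_closed[of P k] ideal_P by simp
qed

lemma pw_closed:
  "x \<in> pw k \<Longrightarrow> algebraic_int x" "x \<in> pw k \<Longrightarrow> y \<in> pw k \<Longrightarrow> x + y \<in> pw k"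
  "algebraic_int a \<Longrightarrow> x \<in> pw k \<Longrightarrow> a * x \<in> pw k"
  using ideal_pw[of k] unfolding ideal_OK_iff by blast+

lemma pw_Suc_mult: "x \<in> pw k \<Longrightarrow> y \<in> P \<Longrightarrow> x * y \<in> pw (Suc k)"
  unfolding pw_Suc using ideal_prod.prod[of x "pw k" y P OK] by simp

lemma pw_Suc_subset: "pw (Suc k) \<subseteq> pw k" "pw (Suc k) \<subseteq> P"
  unfolding pw_Suc
  using ring.ideal_prod_inter[OF cring.axioms(1)[OF cring_OK] ideal_pw[of k] ideal_P] by blast+

lemma gamma_power_pw: "x \<in> pw k \<Longrightarrow> algebraic_int (\<gamma> ^ k * x)"
proof (induction k arbitrary: x)
  case 0
  then show ?case
    by (simp add: pw_0)
next
  case (Suc k)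
  from Suc.prems show ?case
    unfolding pw_Suc
  proof (induction x rule: ideal_prod.induct)
    case (prod i j)
    have "\<gamma> ^ Suc k * (i \<otimes>\<^bsub>OK\<^esub> j) = (\<gamma> ^ k * i) * (\<gamma> * j)"
      by (simp add: mult_ac)
    then show ?case
      using algebraic_int_mult[OF Suc.IH[OF prod(1)] gamma_integral[OF prod(2)]] by metis
  next
    case (sum s1 s2)
    then show ?case
      by (simp only: OK_simps distrib_left algebraic_int_add)
  qed
qed

lemma unif_power_in_pw: "algebraic_int c \<Longrightarrow> unif ^ k * c \<in> pw k"
proof (induction k)
  case 0
  then show ?case
    by (simp add: pw_0)
next
  case (Suc k)
  then have "(unif ^ k * c) * unif \<in> pw (Suc k)"
    by (intro pw_Suc_mult unif) auto
  then show ?case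
    by (simp add: mult_ac)
qed

lemma gamma_pw_Suc: "x \<in> pw (Suc k) \<Longrightarrow> \<gamma> * x \<in> pw k"
  unfolding pw_Suc
proof (induction x rule: ideal_prod.induct)
  case (prod i j)
  have "\<gamma> * (i \<otimes>\<^bsub>OK\<^esub> j) = (\<gamma> * j) * i"
    by (simp add: mult_ac)
  then show ?case
    using pw_closed(3)[OF gamma_integral[OF prod(2)] prod(1)] by metis
next
  case (sum s1 s2)
  then show ?case
    using pw_closed(2)[of "\<gamma> * s1" k "\<gamma> * s2"] by (simp add: distrib_left)
qed

lemma unit_decomposition: "\<exists>t e. algebraic_int t \<and> e \<in> P \<and> 1 = \<gamma> * unif * t + e"
proof -
  obtain t where t: "algebraic_int t" "\<gamma> * unif * t - 1 \<in> P"
    using maximal[OF gamma_unif(1,2)] by blast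
  then show ?thesis
    using minus_closed[OF t(2)] by (intro exI[of _ t] exI[of _ "1 - \<gamma> * unif * t"]) auto
qed

text \<open>
  Since \<open>P\<close> is maximal, \<open>s\<close> is invertible modulo \<open>P\<close>; this improves the exponent one step at a time.
\<close>

lemma pw_primary:
  assumes "algebraic_int s" "s \<notin> P"
  shows "algebraic_int a \<Longrightarrow> s * a \<in> pw k \<Longrightarrow> a \<in> pw k"
proof (induction k)
  case 0
  then show ?case
    by (simp add: pw_0)
next
  case (Suc k)
  have a: "a \<in> pw k"
    using Suc pw_Suc_subset by blast
  obtain t where t: "algebraic_int t" "s * t - 1 \<in> P"
    using maximal[OF assms] by blast
  have "a * (1 - s * t) \<in> pw (Suc k)"
    using a minus_closed[OF t(2)] by (intro pw_Suc_mult) auto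
  moreover have "t * (s * a) \<in> pw (Suc k)"
    using t(1) Suc.prems(2) by (rule pw_closed)
  ultimately have "a * (1 - s * t) + t * (s * a) \<in> pw (Suc k)"
    by (rule pw_closed)
  moreover have "a * (1 - s * t) + t * (s * a) = a"
    by (simp add: algebra_simps)
  ultimately show ?case
    by metis
qed

text \<open>
  The ideal \<open>C\<close> is the product of \<open>A\<close> and the inverse of \<open>P\<close>, the latter being generated by \<open>1\<close> and \<open>\<gamma>\<close>.
\<close>

lemma subset_P_imp_multiple:
  assumes A: "ideal A OK" "A \<subseteq> P"
  defines "C \<equiv> {a + \<gamma> * b | a b. a \<in> A \<and> b \<in> A}"
  shows "ideal C OK" "A = ideal_prod OK P C"
proof -
  have A': "\<And>x. x \<in> A \<Longrightarrow> algebraic_int x" "0 \<in> A" "\<And>x y. x \<in> A \<Longrightarrow> y \<in> A \<Longrightarrow> x + y \<in> A"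
    "\<And>a x. algebraic_int a \<Longrightarrow> x \<in> A \<Longrightarrow> a * x \<in> A"
    using A(1) unfolding ideal_OK_iff by blast+
  show "ideal C OK"
    unfolding ideal_OK_iff
  proof (intro conjI ballI allI impI)
    show "algebraic_int x" if "x \<in> C" for x
      using that A'(1) A(2) gamma_integral unfolding C_def by (auto intro!: algebraic_int_add)
    show "0 \<in> C"
      unfolding C_def using A'(2) by (auto intro!: exI[of _ 0])
    show "x + y \<in> C" if xy: "x \<in> C" "y \<in> C" for x y
    proof -
      obtain a b c d where "a \<in> A" "b \<in> A" "x = a + \<gamma> * b" "c \<in> A" "d \<in> A" "y = c + \<gamma> * d"
        using xy unfolding C_def by blast
      moreover from this have "x + y = (a + c) + \<gamma> * (b + d)"
        by (simp add: algebra_simps)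
      ultimately show ?thesis
        unfolding C_def using A'(3) by blast
    qed
    show "r * x \<in> C" if rx: "algebraic_int r" "x \<in> C" for r x
    proof -
      obtain a b where "a \<in> A" "b \<in> A" "x = a + \<gamma> * b"
        using rx unfolding C_def by blast
      moreover from this have "r * x = (r * a) + \<gamma> * (r * b)"
        by (simp add: algebra_simps)
      ultimately show ?thesis
        unfolding C_def using A'(4)[OF rx(1)] by blast
    qed
  qed
  show "A = ideal_prod OK P C"
  proof
    show "A \<subseteq> ideal_prod OK P C"
    proof
      fix a assume a: "a \<in> A"
      obtain t e where te: "algebraic_int t" "e \<in> P" "1 = \<gamma> * unif * t + e"
        using unit_decomposition by blast
      have C: "\<gamma> * (t * a) \<in> C" "a \<in> C"
        using A'(2) a A'(4)[OF te(1) a] unfolding C_def by force+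
      have "unif \<otimes>\<^bsub>OK\<^esub> (\<gamma> * (t * a)) \<oplus>\<^bsub>OK\<^esub> e \<otimes>\<^bsub>OK\<^esub> a \<in> ideal_prod OK P C"
        by (intro ideal_prod.sum ideal_prod.prod unif te C)
      also have "unif \<otimes>\<^bsub>OK\<^esub> (\<gamma> * (t * a)) \<oplus>\<^bsub>OK\<^esub> e \<otimes>\<^bsub>OK\<^esub> a = (\<gamma> * unif * t + e) * a"
        by (simp add: algebra_simps)
      also have "\<dots> = a"
        unfolding te(3)[symmetric] by simp
      finally show "a \<in> ideal_prod OK P C" .
    qed
    show "ideal_prod OK P C \<subseteq> A"
    proof
      fix x assume "x \<in> ideal_prod OK P C"
      then show "x \<in> A"
      proof (induction x rule: ideal_prod.induct)
        case (prod p c)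
        then obtain a b where ab: "a \<in> A" "b \<in> A" "c = a + \<gamma> * b"
          unfolding C_def by blast
        have "p \<otimes>\<^bsub>OK\<^esub> c = p * a + (\<gamma> * p) * b"
          by (simp add: ab(3) algebra_simps)
        then show ?case
          using A'(3)[OF A'(4)[OF integral[OF prod(1)] ab(1)] A'(4)[OF gamma_integral[OF prod(1)] ab(2)]] by metis
      next
        case (sum s1 s2)
        then show ?case
          using A'(3) by simp
      qed
    qed
  qed
qed

text \<open>
  To contain is to divide: one factor \<open>P\<close> is split off at a time.
\<close>

lemma pw_divides_iff:
  assumes "ideal A OK"
  shows "ideal_divides (pw k) A \<longleftrightarrow> A \<subseteq> pw k"
proof
  interpret R: cring "OK :: 'a ring"
    by (rule cring_OK)
  assume "ideal_divides (pw k) A"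
  then obtain C where "ideal C OK" "A = ideal_prod OK (pw k) C"
    unfolding factor_def by auto
  then show "A \<subseteq> pw k"
    using R.ideal_prod_inter[OF ideal_pw] by blast
next
  interpret R: cring "OK :: 'a ring"
    by (rule cring_OK)
  show "A \<subseteq> pw k \<Longrightarrow> ideal_divides (pw k) A"
    using assms
  proof (induction k arbitrary: A)
    case 0
    have "A = ideal_prod OK (carrier OK) A"
      using R.ideal_prod_one[OF 0(2)] R.ideal_prod_commute[OF 0(2) R.oneideal] by simp
    moreover have "pw 0 = carrier OK"
      by (simp only: pw_0 OK_simps)
    ultimately show ?case
      unfolding factor_def using 0(2) by auto
  next
    case (Suc k)
    define C where "C = {a + \<gamma> * b | a b. a \<in> A \<and> b \<in> A}"
    have "A \<subseteq> P"
      using Suc.prems pw_Suc_subset by blast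
    then have C: "ideal C OK" "A = ideal_prod OK P C"
      unfolding C_def using subset_P_imp_multiple[OF Suc.prems(2)] by blast+
    have "C \<subseteq> pw k"
    proof
      fix x assume "x \<in> C"
      then obtain a b where ab: "a \<in> A" "b \<in> A" "x = a + \<gamma> * b"
        unfolding C_def by blast
      then have "a \<in> pw k" "\<gamma> * b \<in> pw k"
        using Suc.prems(1) pw_Suc_subset gamma_pw_Suc by blast+
      then show "x \<in> pw k"
        unfolding ab(3) by (rule pw_closed)
    qed
    then have "ideal_divides (pw k) C"
      using Suc.IH C(1) by blast
    then obtain D where D: "ideal D OK" "C = ideal_prod OK (pw k) D"
      unfolding factor_def by auto
    have "A = ideal_prod OK (ideal_prod OK P (pw k)) D"
      unfolding R.ideal_prod_assoc[OF ideal_P ideal_pw D(1)] using C(2) D(2) by simp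
    also have "ideal_prod OK P (pw k) = pw (Suc k)"
      unfolding pw_Suc by (rule R.ideal_prod_commute[OF ideal_P ideal_pw])
    finally show ?case
      unfolding factor_def using D(1) by auto
  qed
qed

text \<open>
  Relatively prime numerator and denominator: if \<open>P\<close> contains the numerator, some \<open>b\<close> in the denominator is
  outside of \<open>P\<close>, and \<open>b * x\<close> lies in the numerator. Conversely, the numerator is contained in the fractional ideal
  of \<open>x\<close>, since \<open>1\<close> is in the inverse of the denominator. For \<open>k = 0\<close> the equivalence fails when \<open>x\<close> has a pole
  at \<open>P\<close>.
\<close>

lemma numerator_subset_pw_iff:
  assumes q: "ideal_quotient x A B" and x: "x \<noteq> 0" and k: "k \<ge> 1"
  shows "A \<subseteq> pw k \<longleftrightarrow> ord_at x \<ge> int k"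
proof -
  have A: "ideal A OK" and B: "ideal B OK" and AB: "A <+>\<^bsub>OK\<^esub> B = carrier OK"
    and eq: "principal_fractional_ideal x = ideal_prod ring_of_type_algebra A (inverse_ideal B)"
    using q by (auto simp: ideal_quotient_def)
  have A': "\<And>x. x \<in> A \<Longrightarrow> algebraic_int x" "\<And>x y. x \<in> A \<Longrightarrow> y \<in> A \<Longrightarrow> x + y \<in> A"
    "\<And>a x. algebraic_int a \<Longrightarrow> x \<in> A \<Longrightarrow> a * x \<in> A" and B': "\<And>x. x \<in> B \<Longrightarrow> algebraic_int x"
    using A B unfolding ideal_OK_iff by blast+
  show ?thesis
  proof
    assume sub: "A \<subseteq> pw k"
    obtain l where l: "k = Suc l"
      using k by (cases k) auto
    have AP: "A \<subseteq> P"
      using sub pw_Suc_subset(2)[of l] l by blast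
    have "1 \<in> A <+>\<^bsub>OK\<^esub> B"
      unfolding AB by simp
    then obtain a b where ab: "a \<in> A" "b \<in> B" "1 = a + b"
      unfolding set_add_def' by auto
    have bP: "b \<notin> P"
    proof
      assume "b \<in> P"
      then have "1 \<in> P"
        unfolding ab(3) using ab(1) AP by (intro add_closed) auto
      then show False
        using one_notin by simp
    qed
    have "b * z \<in> A" if "z \<in> ideal_prod ring_of_type_algebra A (inverse_ideal B)" for z
      using that
    proof (induction z rule: ideal_prod.induct)
      case (prod i j)
      have "algebraic_int (j * b)"
        using prod(2) ab(2) unfolding inverse_ideal_def by simp
      then have "(j * b) * i \<in> A"
        using prod(1) by (rule A')
      then show ?case
        by (simp add: ring_of_type_algebra_def mult_ac)
    next
      case (sum s1 s2)
      then show ?case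
        using A'(2)[of "b * s1" "b * s2"] by (simp add: ring_of_type_algebra_def distrib_left)
    qed
    moreover have "x \<in> principal_fractional_ideal x"
      unfolding principal_fractional_ideal_def by (auto intro!: exI[of _ 1])
    ultimately have "b * x \<in> pw k"
      using eq sub by blast
    then have "algebraic_int (\<gamma> ^ k * (b * x))"
      by (rule gamma_power_pw)
    moreover have b0: "b \<noteq> 0"
      using bP zero_in by auto
    ultimately have "ord_at (\<gamma> powi int k * (b * x)) \<ge> 0"
      using x gamma_unif(4) by (intro ord_at_integer_nonneg) auto
    moreover have "ord_at (\<gamma> powi int k * (b * x)) = - int k + (0 + ord_at x)"
      using x b0 gamma_unif(4) ord_at_notin[OF B'[OF ab(2)] bP] ord_at_gamma[of "int k"]
      by (subst ord_at_mult, simp, simp, subst ord_at_mult) simp_all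
    ultimately show "ord_at x \<ge> int k"
      by simp
  next
    assume ord: "ord_at x \<ge> int k"
    define n where "n = nat (ord_at x)"
    have n: "ord_at x = int n" "k \<le> n"
      using ord by (auto simp: n_def)
    obtain s c where s: "algebraic_int s" "s \<notin> P" "algebraic_int c" "s * x = unif ^ n * c"
      using ord_at_clear[OF x n(1)] by blast
    have split: "unif ^ n * c = unif ^ k * (unif ^ (n - k) * c)"
      using n(2) by (simp add: mult.assoc[symmetric] power_add[symmetric])
    have sx: "s * x \<in> pw k"
      unfolding s(4) split
      using gamma_unif(3) s(3) by (intro unif_power_in_pw algebraic_int_mult algebraic_int_power)
    show "A \<subseteq> pw k"
    proof
      fix a assume a: "a \<in> A"
      have "1 \<in> inverse_ideal B"
        unfolding inverse_ideal_def using B' by simp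
      then have "a \<otimes>\<^bsub>ring_of_type_algebra\<^esub> 1 \<in> ideal_prod ring_of_type_algebra A (inverse_ideal B)"
        using a by (intro ideal_prod.prod)
      then have "a \<in> principal_fractional_ideal x"
        unfolding eq by (simp add: ring_of_type_algebra_def)
      then obtain t where t: "algebraic_int t" "a = x * t"
        unfolding principal_fractional_ideal_def by auto
      have "t * (s * x) \<in> pw k"
        using t(1) sx by (rule pw_closed)
      then have "s * a \<in> pw k"
        by (simp add: t(2) mult_ac)
      then show "a \<in> pw k"
        using pw_primary[OF s(1,2) A'(1)[OF a]] by blast
    qed
  qed
qed

lemma ideal_ord_numerator:
  assumes q: "ideal_quotient x A B" and x: "x \<noteq> 0"
  shows "ideal_ord P A = enat (nat (ord_at x))"
proof -
  have A: "ideal A OK"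
    using q by (simp add: ideal_quotient_def)
  have iff: "ideal_divides (pw k) A \<longleftrightarrow> k \<le> nat (ord_at x)" for k
  proof (cases "k = 0")
    case True
    have "A \<subseteq> pw 0"
      using A unfolding pw_0 ideal_OK_iff by blast
    then show ?thesis
      using pw_divides_iff[OF A, of 0] True by simp
  next
    case False
    then show ?thesis
      using pw_divides_iff[OF A, of k] numerator_subset_pw_iff[OF q x, of k] by linarith
  qed
  have "ideal_ord P A = Sup {enat k | k. k \<le> nat (ord_at x)}"
    unfolding ideal_ord_def iff ..
  also have "\<dots> = enat (nat (ord_at x))"
    by (rule antisym) (auto intro!: Sup_least Sup_upper)
  finally show ?thesis .
qed

lemma divides_numerator_iff:
  assumes q: "ideal_quotient x A B" and x: "x \<noteq> 0"
  shows "ideal_divides P A \<longleftrightarrow> val x < 1"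
proof -
  have A: "ideal A OK"
    using q by (simp add: ideal_quotient_def)
  show ?thesis
    using pw_divides_iff[OF A, of 1] numerator_subset_pw_iff[OF q x, of 1] val_less_1_iff[OF x]
    unfolding pw_1 by simp
qed

lemma divides_sum_imp:
  assumes "ideal A OK" "ideal B OK" "ideal_divides P (A <+>\<^bsub>OK\<^esub> B)"
  shows "ideal_divides P A" "ideal_divides P B"
proof -
  interpret R: cring "OK :: 'a ring"
    by (rule cring_OK)
  have "ideal (A <+>\<^bsub>OK\<^esub> B) OK"
    using assms(1,2) by (rule R.add_ideals)
  then have "A <+>\<^bsub>OK\<^esub> B \<subseteq> P"
    using assms(3) pw_divides_iff[of "A <+>\<^bsub>OK\<^esub> B" 1] unfolding pw_1 by blast
  then have "A \<subseteq> P" "B \<subseteq> P"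
    using sum_of_ideals_superset[OF assms(1,2)] by blast+
  then show "ideal_divides P A" "ideal_divides P B"
    using pw_divides_iff[OF assms(1), of 1] pw_divides_iff[OF assms(2), of 1] unfolding pw_1 by blast+
qed

end

section \<open>Primes, places and integrality\<close>

context number_field_type
begin

lemma prime_of_number_fieldI: "nonzero_prime_set P \<Longrightarrow> prime_of_number_field K P"
  by (intro prime_of_number_field.intro number_field_type_axioms prime_of_number_field_axioms.intro)

text \<open>
  A prime containing \<open>N\<close> is a union of residue classes modulo \<open>N\<close>.
\<close>

lemma finite_primes_containing:
  assumes "N > 0"
  shows "finite {P :: 'a set. nonzero_prime_set P \<and> of_nat N \<in> P}" (is "finite ?S")
proof -
  obtain F where F: "residues_mod N F"
    using exists_residues_mod[OF assms] by blast
  have finF: "finite F"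
    using F by (simp add: residues_mod_def)
  have sub: "P \<subseteq> Q" if PQ: "P \<in> ?S" "Q \<in> ?S" "P \<inter> F = Q \<inter> F" for P Q
  proof
    fix x assume x: "x \<in> P"
    interpret P: prime_of_number_field K P
      using PQ(1) by (intro prime_of_number_fieldI) simp
    interpret Q: prime_of_number_field K Q
      using PQ(2) by (intro prime_of_number_fieldI) simp
    obtain f y where f: "f \<in> F" "algebraic_int y" "x = f + of_nat N * y"
      using F P.integral[OF x] unfolding residues_mod_def by metis
    have "y * of_nat N \<in> P" "y * of_nat N \<in> Q"
      using PQ f(2) by (auto intro: P.mult_closed Q.mult_closed)
    moreover from this have "x - y * of_nat N \<in> P"
      using x by (intro P.diff_closed)
    then have "f \<in> P"
      using f(3) by (simp add: mult.commute)
    then have "f \<in> Q"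
      using PQ(3) f(1) by blast
    ultimately show "x \<in> Q"
      unfolding f(3) by (intro Q.add_closed) (simp_all add: mult.commute)
  qed
  have "inj_on (\<lambda>P. P \<inter> F) ?S"
  proof (rule inj_onI)
    fix P Q assume "P \<in> ?S" "Q \<in> ?S" "P \<inter> F = Q \<inter> F"
    then show "P = Q"
      using sub[of P Q] sub[of Q P] by (metis subset_antisym)
  qed
  moreover have "(\<lambda>P. P \<inter> F) ` ?S \<subseteq> Pow F"
    by blast
  ultimately show ?thesis
    using finF by (metis finite_Pow_iff finite_imageD finite_subset)
qed

text \<open>
  Ideals containing \<open>N\<close> are determined by the representatives modulo \<open>N\<close> that they contain, so a proper ideal with
  the largest number of representatives is maximal, and hence prime.
\<close>

lemma proper_ideal_in_prime:
  fixes I :: "'a set"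
  assumes I: "\<And>x. x \<in> I \<Longrightarrow> algebraic_int x" "\<And>x y. x \<in> I \<Longrightarrow> y \<in> I \<Longrightarrow> x + y \<in> I"
    "\<And>a x. algebraic_int a \<Longrightarrow> x \<in> I \<Longrightarrow> a * x \<in> I" "1 \<notin> I" "N > 0" "of_nat N \<in> I"
  shows "\<exists>P. nonzero_prime_set P \<and> I \<subseteq> P"
proof -
  obtain F where F: "residues_mod N F"
    using exists_residues_mod[OF I(5)] by blast
  have finF: "finite F"
    using F by (simp add: residues_mod_def)
  define proper where "proper = (\<lambda>J. I \<subseteq> J \<and> (\<forall>x\<in>J. algebraic_int x) \<and> (\<forall>x\<in>J. \<forall>y\<in>J. x + y \<in> J) \<and>
    (\<forall>a x. algebraic_int a \<longrightarrow> x \<in> J \<longrightarrow> a * x \<in> J) \<and> 1 \<notin> J)"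
  have "proper I"
    using I unfolding proper_def by blast
  moreover have "\<forall>J. proper J \<longrightarrow> card (J \<inter> F) < Suc (card F)"
    using finF by (simp add: card_mono le_imp_less_Suc)
  ultimately obtain P where P: "proper P" "\<And>J. proper J \<Longrightarrow> card (J \<inter> F) \<le> card (P \<inter> F)"
    using ex_has_greatest_nat[of proper I "\<lambda>J. card (J \<inter> F)" "Suc (card F)"] by blast
  have P': "I \<subseteq> P" "\<And>x. x \<in> P \<Longrightarrow> algebraic_int x" "\<And>x y. x \<in> P \<Longrightarrow> y \<in> P \<Longrightarrow> x + y \<in> P"
    "\<And>a x. algebraic_int a \<Longrightarrow> x \<in> P \<Longrightarrow> a * x \<in> P" "1 \<notin> P"
    using P(1) unfolding proper_def by blast+
  have NP: "of_nat N \<in> P"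
    using P'(1) I(6) by blast
  have zero: "0 \<in> P"
    using P'(4)[OF algebraic_int_0 NP] by simp
  have maximal: "J = P" if J: "proper J" "P \<subseteq> J" for J
  proof -
    have "J \<inter> F = P \<inter> F"
    proof -
      have "P \<inter> F \<subseteq> J \<inter> F"
        using J(2) by blast
      then show ?thesis
        using card_seteq[of "J \<inter> F" "P \<inter> F"] P(2)[OF J(1)] finF by simp
    qed
    have "x \<in> P" if x: "x \<in> J" for x
    proof -
      have J': "\<And>x. x \<in> J \<Longrightarrow> algebraic_int x" "\<And>x y. x \<in> J \<Longrightarrow> y \<in> J \<Longrightarrow> x + y \<in> J"
        using J(1) unfolding proper_def by blast+
      obtain f y where f: "f \<in> F" "algebraic_int y" "x = f + of_nat N * y"
        using F J'(1)[OF x] unfolding residues_mod_def by metis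
      have "(- y) * of_nat N \<in> P" "y * of_nat N \<in> P"
        using f(2) by (auto intro!: P'(4) NP simp del: mult_minus_left)
      moreover from this have "x + (- y) * of_nat N \<in> J"
        using x J(2) by (intro J'(2)) auto
      then have "f \<in> J"
        using f(3) by (simp add: mult.commute)
      then have "f \<in> P"
        using f(1) \<open>J \<inter> F = P \<inter> F\<close> by blast
      ultimately show ?thesis
        unfolding f(3) by (intro P'(3)) (simp_all add: mult.commute)
    qed
    then show ?thesis
      using J(2) by blast
  qed
  have prime: "b \<in> P" if ab: "algebraic_int a" "algebraic_int b" "a * b \<in> P" "a \<notin> P" for a b
  proof -
    define J where "J = {x + a * t | x t. x \<in> P \<and> algebraic_int t}"
    have "P \<subseteq> J"
    proof
      fix x assume "x \<in> P"
      then show "x \<in> J"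
        unfolding J_def by (intro CollectI exI[of _ x] exI[of _ 0]) simp
    qed
    have "a \<in> J"
      unfolding J_def using zero by (intro CollectI exI[of _ 0] exI[of _ 1]) simp
    then have "J \<noteq> P"
      using ab(4) by blast
    then have "\<not> proper J"
      using maximal \<open>P \<subseteq> J\<close> by blast
    have int: "algebraic_int x" if "x \<in> J" for x
      using that P'(2) ab(1) unfolding J_def by (auto intro!: algebraic_int_add algebraic_int_mult)
    have add: "x + y \<in> J" if xy: "x \<in> J" "y \<in> J" for x y
    proof -
      obtain p s q t where "p \<in> P" "algebraic_int s" "x = p + a * s" "q \<in> P" "algebraic_int t" "y = q + a * t"
        using xy unfolding J_def by blast
      moreover from this have "x + y = (p + q) + a * (s + t)"
        by (simp add: algebra_simps)
      ultimately show ?thesis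
        unfolding J_def using P'(3) algebraic_int_add by blast
    qed
    have mult: "c * x \<in> J" if cx: "algebraic_int c" "x \<in> J" for c x
    proof -
      obtain p s where "p \<in> P" "algebraic_int s" "x = p + a * s"
        using cx(2) unfolding J_def by blast
      moreover from this have "c * x = (c * p) + a * (c * s)"
        by (simp add: algebra_simps)
      ultimately show ?thesis
        unfolding J_def using P'(4)[OF cx(1)] algebraic_int_mult[OF cx(1)] by blast
    qed
    have "1 \<in> J"
    proof (rule ccontr)
      assume "1 \<notin> J"
      moreover have "I \<subseteq> J"
        using P'(1) \<open>P \<subseteq> J\<close> by (rule subset_trans)
      ultimately have "proper J"
        unfolding proper_def using int add mult by simp
      then show False
        using \<open>\<not> proper J\<close> by contradiction
    qed
    then obtain p t where pt: "p \<in> P" "algebraic_int t" "1 = p + a * t"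
      unfolding J_def by blast
    have "b = 1 * b"
      by simp
    also have "\<dots> = b * p + t * (a * b)"
      unfolding pt(3) by (simp add: algebra_simps)
    also have "\<dots> \<in> P"
      by (rule P'(3)[OF P'(4)[OF ab(2) pt(1)] P'(4)[OF pt(2) ab(3)]])
    finally show ?thesis .
  qed
  have "nonzero_prime_set P"
    unfolding nonzero_prime_set_def
  proof (intro conjI)
    show "\<exists>x\<in>P. x \<noteq> 0"
      using NP I(5) by (intro bexI[of _ "of_nat N"]) auto
    show "\<forall>x\<in>P. algebraic_int x"
      by (intro ballI P'(2))
    show "\<forall>x\<in>P. \<forall>y\<in>P. x + y \<in> P"
      by (intro ballI P'(3))
    show "\<forall>a x. algebraic_int a \<longrightarrow> x \<in> P \<longrightarrow> a * x \<in> P"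
      by (intro allI impI P'(4))
    show "1 \<notin> P"
      by (rule P'(5))
    show "\<forall>a b. algebraic_int a \<longrightarrow> algebraic_int b \<longrightarrow> a * b \<in> P \<longrightarrow> a \<in> P \<or> b \<in> P"
    proof (intro allI impI)
      fix a b assume "algebraic_int a" "algebraic_int b" "a * b \<in> P"
      then show "a \<in> P \<or> b \<in> P"
        using prime[of a b] by (cases "a \<in> P") simp_all
    qed
  qed
  then show ?thesis
    using P'(1) by blast
qed

text \<open>
  The denominators of \<open>x\<close> form an ideal that contains an integer and is contained in no prime.
\<close>

lemma algebraic_int_local_global:
  fixes x :: 'a
  assumes "\<And>P. nonzero_prime_set P \<Longrightarrow> \<exists>s. algebraic_int s \<and> s \<notin> P \<and> algebraic_int (s * x)"
  shows "algebraic_int x"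
proof -
  define I where "I = {s. algebraic_int s \<and> algebraic_int (s * x)}"
  obtain N where N: "N > 0" "algebraic_int (of_nat N * x)"
    using algebraic_int_of_multiple by metis
  have "1 \<in> I"
  proof (rule ccontr)
    assume "1 \<notin> I"
    moreover have "algebraic_int s" if "s \<in> I" for s
      using that by (simp add: I_def)
    moreover have "s + t \<in> I" if "s \<in> I" "t \<in> I" for s t
      using that by (auto simp: I_def distrib_right)
    moreover have "a * s \<in> I" if "algebraic_int a" "s \<in> I" for a s
      using that by (auto simp: I_def mult.assoc)
    moreover have "of_nat N \<in> I"
      using N(2) by (simp add: I_def)
    ultimately obtain P where P: "nonzero_prime_set P" "I \<subseteq> P"
      using proper_ideal_in_prime[of I N] N(1) by blast
    obtain s where "algebraic_int s" "s \<notin> P" "algebraic_int (s * x)"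
      using assms[OF P(1)] by blast
    then show False
      using P(2) by (auto simp: I_def)
  qed
  then show ?thesis
    by (simp add: I_def)
qed

end

context prime_of_number_field
begin

definition place :: "('a \<Rightarrow> real) set" where
  "place = absolute_value_equiv `` {val}"

lemma nontrivial_val: "val \<in> nontrivial_absolute_values"
proof -
  have "val unif < 1" "unif \<noteq> 0"
    using val_less_1_iff_in[of unif] unif gamma_unif by auto
  then show ?thesis
    unfolding nontrivial_absolute_values_def using absolute_value_val by (auto intro!: exI[of _ unif])
qed

lemma val_in_place: "val \<in> place"
  unfolding place_def by (rule equiv_class_self[OF equiv_absolute_value_equiv nontrivial_val])

lemma place_in_places: "place \<in> places"
  unfolding place_def places_def using nontrivial_val by (rule quotientI)

lemma place_not_arch: "place \<notin> arch_places"
  unfolding arch_places_def using val_in_place nonarchimedean_val by blast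

lemma prime_of_place: "prime_of_place place = P"
proof -
  have *: "(\<forall>v\<in>place. v x < 1) \<longleftrightarrow> val x < 1" for x
  proof
    assume "\<forall>v\<in>place. v x < 1"
    then show "val x < 1"
      using val_in_place by blast
  next
    assume x: "val x < 1"
    show "\<forall>v\<in>place. v x < 1"
    proof
      fix v assume "v \<in> place"
      then obtain s where s: "s > 0" "\<And>x. v x = val x powr s"
        unfolding place_def absolute_value_equiv_def by blast
      show "v x < 1"
      proof (cases "x = 0")
        case False
        then have "val x powr s < 1 powr s"
          using x s(1) by (intro powr_less_mono2) auto
        then show ?thesis
          by (simp add: s(2))
      qed (simp add: s(2))
    qed
  qed
  show ?thesis
    unfolding prime_of_place_def * using val_less_1_iff_in integral by auto
qed

lemma prime_in_places_place: "place \<in> S \<Longrightarrow> prime_in_places P S"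
  unfolding prime_in_places_def using place_not_arch prime_of_place by blast

end

section \<open>Rigid divisibility\<close>

text \<open>
  Otherwise \<open>0\<close> would be periodic.
\<close>

lemma wandering_zero_orb_nonzero:
  assumes "wandering \<phi> 0" "n \<ge> 1"
  shows "orb \<phi> n \<noteq> 0"
proof
  assume n: "orb \<phi> n = 0"
  have mult: "orb \<phi> (k * n) = 0" for k
    by (induction k) (simp_all add: orb_add n)
  have "orb \<phi> m = orb \<phi> (m mod n)" for m
  proof -
    have "orb \<phi> (m mod n + m div n * n) = orb \<phi> (m mod n)"
      using orb_add[of "m mod n" "m div n * n" \<phi>] mult[of "m div n"] by simp
    then show ?thesis
      by simp
  qed
  then have "range (orb \<phi>) \<subseteq> orb \<phi> ` {..<n}"
    using assms(2) by (auto intro!: image_eqI[of _ _ "_ mod n"])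
  then show False
    using assms(1) finite_subset unfolding wandering_def by blast
qed

context prime_of_number_field
begin

lemma numerators_rigid_at_prime:
  assumes phi: "\<And>i. val (coeff \<phi> i) \<le> 1" and H: "pderiv \<phi> ^ 2 = \<phi> * H" "\<And>i. val (coeff H i) \<le> 1"
    and nz: "\<And>n. n \<ge> 1 \<Longrightarrow> orb \<phi> n \<noteq> 0"
    and q: "\<And>n. n \<ge> 1 \<Longrightarrow> ideal_quotient (orb \<phi> n) (A n) (B n)"
  shows "m \<ge> 1 \<Longrightarrow> n \<ge> 1 \<Longrightarrow> ideal_divides P (A n <+>\<^bsub>OK\<^esub> A m) \<Longrightarrow> ideal_divides P (A (gcd m n))"
    and "m \<ge> 1 \<Longrightarrow> ideal_ord P (A m) > 0 \<Longrightarrow> k \<ge> 1 \<Longrightarrow> ideal_ord P (A (k * m)) = ideal_ord P (A m)"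
proof -
  have A: "ideal (A n) OK" if "n \<ge> 1" for n
    using q[OF that] by (simp add: ideal_quotient_def)
  have div: "ideal_divides P (A n) \<longleftrightarrow> val (orb \<phi> n) < 1" if "n \<ge> 1" for n
    using divides_numerator_iff[OF q[OF that] nz[OF that]] .
  show "ideal_divides P (A (gcd m n))"
    if mn: "m \<ge> 1" "n \<ge> 1" and sum: "ideal_divides P (A n <+>\<^bsub>OK\<^esub> A m)"
  proof -
    have "val (orb \<phi> m) < 1" "val (orb \<phi> n) < 1"
      using divides_sum_imp[OF A[OF mn(2)] A[OF mn(1)] sum] div mn by blast+
    then have "val (orb \<phi> (gcd m n)) < 1"
      by (rule val.orb_less_1_gcd[OF phi])
    moreover have "gcd m n \<ge> 1"
      using mn by (simp add: Suc_le_eq)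
    ultimately show ?thesis
      using div by blast
  qed
  show "ideal_ord P (A (k * m)) = ideal_ord P (A m)"
    if m: "m \<ge> 1" and ord: "ideal_ord P (A m) > 0" and k: "k \<ge> 1"
  proof -
    have km: "k * m \<ge> 1"
      using m k by simp
    have "ord_at (orb \<phi> m) \<ge> 1"
      using ord unfolding ideal_ord_numerator[OF q[OF m] nz[OF m]] by (simp add: zero_enat_def)
    then have "val (orb \<phi> m) < 1"
      using val_less_1_iff[OF nz[OF m]] by blast
    then have "val (orb \<phi> (k * m)) = val (orb \<phi> m)"
      using val.orb_rigid[OF phi H nz[OF m]] k by blast
    then have "ord_at (orb \<phi> (k * m)) = ord_at (orb \<phi> m)"
      using nz[OF m] nz[OF km] by (simp add: val_def powr_inj)
    then show ?thesis
      unfolding ideal_ord_numerator[OF q[OF m] nz[OF m]] ideal_ord_numerator[OF q[OF km] nz[OF km]] by simp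
  qed
qed

end

context number_field_type
begin

lemma rigid_divisibility_sequence_numerators:
  fixes \<phi> :: "'a poly"
  assumes S: "finite S" "S \<subseteq> places" "arch_places \<subseteq> S"
    and loc: "\<And>P x. nonzero_prime_set P \<Longrightarrow> \<not> prime_in_places P S \<Longrightarrow>
        x \<in> range (coeff \<phi>) \<union> range (coeff H) \<Longrightarrow> \<exists>s. algebraic_int s \<and> s \<notin> P \<and> algebraic_int (s * x)"
    and H: "pderiv \<phi> ^ 2 = \<phi> * H"
    and nz: "\<And>n. n \<ge> 1 \<Longrightarrow> orb \<phi> n \<noteq> 0"
    and q: "\<And>n. n \<ge> 1 \<Longrightarrow> ideal_quotient (orb \<phi> n) (A n) (B n)"
  shows "rigid_divisibility_sequence S A"
proof -
  have rigid: "(m \<ge> 1 \<longrightarrow> n \<ge> 1 \<longrightarrow> ideal_divides P (A n <+>\<^bsub>OK\<^esub> A m) \<longrightarrow> ideal_divides P (A (gcd m n))) \<and>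
     (m \<ge> 1 \<longrightarrow> ideal_ord P (A m) > 0 \<longrightarrow> n \<ge> 1 \<longrightarrow> ideal_ord P (A (n * m)) = ideal_ord P (A m))"
    if P: "nonzero_prime_ideal P" "\<not> prime_in_places P S" for P m n
  proof -
    have P': "nonzero_prime_set P"
      using P(1) by (simp add: nonzero_prime_ideal_iff)
    interpret prime_of_number_field K P
      using P' by (rule prime_of_number_fieldI)
    have "val (coeff \<phi> i) \<le> 1" "val (coeff H i) \<le> 1" for i
      using loc[OF P' P(2), of "coeff \<phi> i"] loc[OF P' P(2), of "coeff H i"]
      unfolding val_le_1_iff local_integral_def by blast+
    note * = numerators_rigid_at_prime[OF this(1) H this(2) nz q]
    show ?thesis
      using *(1)[of m n] *(2)[of m n] by blast
  qed
  have "ideal (A n) OK" if "n \<ge> 1" for n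
    using q[OF that] by (simp add: ideal_quotient_def)
  then show ?thesis
    unfolding rigid_divisibility_sequence_def using S rigid by blast
qed

lemma common_denominator:
  assumes "finite W"
  shows "\<exists>D>0. \<forall>x\<in>W. algebraic_int (of_nat D * (x :: 'a))"
  using assms
proof (induction W)
  case (insert x W)
  then obtain D where D: "D > 0" "\<And>y. y \<in> W \<Longrightarrow> algebraic_int (of_nat D * y)"
    by blast
  obtain N where N: "N > 0" "algebraic_int (of_nat N * x)"
    using algebraic_int_of_multiple by metis
  have "algebraic_int (of_nat (D * N) * y)" if y: "y \<in> insert x W" for y
  proof (cases "y = x")
    case True
    have "of_nat (D * N) * y = of_nat D * (of_nat N * x)"
      using True by simp
    then show ?thesis
      using algebraic_int_mult[OF algebraic_int_of_nat N(2)] by metis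
  next
    case False
    then have "of_nat (D * N) * y = of_nat N * (of_nat D * y)" "algebraic_int (of_nat D * y)"
      using y D(2) by auto
    then show ?thesis
      using algebraic_int_mult[OF algebraic_int_of_nat] by metis
  qed
  then show ?case
    using D(1) N(1) by (intro exI[of _ "D * N"]) simp
qed auto

lemma poly_denominator:
  fixes p q :: "'a poly"
  shows "\<exists>D>0. \<forall>x\<in>range (coeff p) \<union> range (coeff q). algebraic_int (of_nat D * x)"
proof -
  have "coeff r i \<in> insert 0 (coeff r ` {..degree r})" for r :: "'a poly" and i
    by (cases "i \<le> degree r") (auto simp: coeff_eq_0)
  then have "range (coeff r) \<subseteq> insert 0 (coeff r ` {..degree r})" for r :: "'a poly"
    by blast
  then have "finite (range (coeff r))" for r :: "'a poly"
    using finite_subset by blast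
  then show ?thesis
    by (intro common_denominator) auto
qed

section \<open>Heights outside finitely many primes\<close>

definition integral_away_from :: "nat \<Rightarrow> 'a \<Rightarrow> bool" where
  "integral_away_from D x \<longleftrightarrow> (\<forall>P. nonzero_prime_set P \<longrightarrow> of_nat D \<notin> P \<longrightarrow>
     (\<exists>s. algebraic_int s \<and> s \<notin> P \<and> algebraic_int (s * x)))"

text \<open>
  The absolute values that can exceed \<open>1\<close> at elements that are integral away from \<open>D\<close>.
\<close>

definition abs_vals_over :: "nat \<Rightarrow> ('a \<Rightarrow> real) set" where
  "abs_vals_over D = (\<lambda>\<sigma> x. cmod (\<sigma> x)) ` {\<sigma>. embedding \<sigma>} \<union>
     prime_of_number_field.val ` {P. nonzero_prime_set P \<and> of_nat D \<in> P}"

lemma finite_abs_vals_over: "D > 0 \<Longrightarrow> finite (abs_vals_over D)"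
  unfolding abs_vals_over_def by (intro finite_UnI finite_imageI finite_embeddings finite_primes_containing)

lemma abs_vals_over_abs_val:
  assumes "v \<in> abs_vals_over D"
  shows "abs_val v"
proof -
  consider \<sigma> where "embedding \<sigma>" "v = (\<lambda>x. cmod (\<sigma> x))"
    | P where "nonzero_prime_set P" "v = prime_of_number_field.val P"
    using assms unfolding abs_vals_over_def by blast
  then show ?thesis
  proof cases
    case 1
    then show ?thesis
      using embedding_abs_val by blast
  next
    case 2
    then interpret prime_of_number_field K P
      by (intro prime_of_number_fieldI)
    show ?thesis
      unfolding 2(2) by (rule val.abs_val_axioms)
  qed
qed

lemma power_of_denominator:
  assumes "D > 0" "R > 0"
  shows "\<exists>k. \<forall>P :: 'a set. nonzero_prime_set P \<longrightarrow> of_nat D \<in> P \<longrightarrow> prime_of_number_field.val P (of_nat D) ^ k * R \<le> 1"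
proof -
  have "\<forall>\<^sub>F k in sequentially. \<forall>P\<in>{P :: 'a set. nonzero_prime_set P \<and> of_nat D \<in> P}.
      prime_of_number_field.val P (of_nat D) ^ k * R < 1"
  proof (intro eventually_ball_finite finite_primes_containing assms ballI)
    fix P :: "'a set" assume P: "P \<in> {P. nonzero_prime_set P \<and> of_nat D \<in> P}"
    then interpret prime_of_number_field K P
      by (intro prime_of_number_fieldI) simp
    have "val (of_nat D) < 1"
      using P val_less_1_iff_in[of "of_nat D"] by simp
    then have "(\<lambda>k. val (of_nat D) ^ k) \<longlonglongrightarrow> 0"
      by (intro LIMSEQ_power_zero) simp
    then have "(\<lambda>k. val (of_nat D) ^ k * R) \<longlonglongrightarrow> 0 * R"
      by (intro tendsto_mult tendsto_const)
    then show "\<forall>\<^sub>F k in sequentially. val (of_nat D) ^ k * R < 1"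
      by (intro order_tendstoD(2)) auto
  qed
  then obtain k where "\<forall>P\<in>{P :: 'a set. nonzero_prime_set P \<and> of_nat D \<in> P}.
      prime_of_number_field.val P (of_nat D) ^ k * R < 1"
    using eventually_happens' sequentially_bot by blast
  then show ?thesis
    by (intro exI[of _ k]) (auto intro: less_imp_le)
qed

text \<open>
  The power of \<open>D\<close> compensates the poles at the primes containing \<open>D\<close>, and does no harm elsewhere.
\<close>

lemma clear_denominator_power:
  fixes x :: 'a
  assumes x: "integral_away_from D x" "\<And>v. v \<in> abs_vals_over D \<Longrightarrow> v x \<le> R"
    and k: "\<And>P :: 'a set. nonzero_prime_set P \<Longrightarrow> of_nat D \<in> P \<Longrightarrow> prime_of_number_field.val P (of_nat D) ^ k * R \<le> 1"
  shows "algebraic_int (of_nat D ^ k * x)"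
proof (rule algebraic_int_local_global)
  fix P :: "'a set" assume P: "nonzero_prime_set P"
  interpret prime_of_number_field K P
    using P by (rule prime_of_number_fieldI)
  show "\<exists>s. algebraic_int s \<and> s \<notin> P \<and> algebraic_int (s * (of_nat D ^ k * x))"
  proof (cases "of_nat D \<in> P")
    case True
    then have "val \<in> abs_vals_over D"
      unfolding abs_vals_over_def using P by blast
    then have "val x \<le> R"
      by (rule x(2))
    then have "val (of_nat D ^ k * x) \<le> val (of_nat D) ^ k * R"
      unfolding val.mult val.power by (intro mult_left_mono) auto
    also have "\<dots> \<le> 1"
      by (rule k[OF P True])
    finally show ?thesis
      unfolding val_le_1_iff local_integral_def .
  next
    case False
    then obtain s where s: "algebraic_int s" "s \<notin> P" "algebraic_int (s * x)"
      using x(1) P unfolding integral_away_from_def by blast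
    have "s * (of_nat D ^ k * x) = of_nat D ^ k * (s * x)"
      by (simp add: mult_ac)
    moreover have "algebraic_int (of_nat D ^ k * (s * x))"
      by (intro algebraic_int_mult algebraic_int_power algebraic_int_of_nat s(3))
    ultimately show ?thesis
      using s(1,2) by metis
  qed
qed

lemma embedding_in_abs_vals_over: "embedding \<sigma> \<Longrightarrow> (\<lambda>x. cmod (\<sigma> x)) \<in> abs_vals_over D"
  unfolding abs_vals_over_def by blast

lemma cmod_embedding_of_nat_power:
  assumes "embedding \<sigma>"
  shows "cmod (\<sigma> (of_nat D ^ k * x)) = real D ^ k * cmod (\<sigma> x)"
  by (simp add: embedding_simps[OF assms] norm_mult norm_power)

text \<open>
  After multiplication by a fixed power of \<open>D\<close>, these are algebraic integers with bounded conjugates.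
\<close>

lemma finite_bounded_integral_away_from:
  assumes D: "D > 0"
  shows "finite {x. integral_away_from D x \<and> (\<forall>v\<in>abs_vals_over D. v x \<le> R)}"
proof -
  define R' where "R' = max R 1"
  have "R' > 0"
    by (simp add: R'_def)
  then obtain k where k: "\<And>P :: 'a set. nonzero_prime_set P \<Longrightarrow> of_nat D \<in> P \<Longrightarrow>
      prime_of_number_field.val P (of_nat D) ^ k * R' \<le> 1"
    using power_of_denominator[OF D, of R'] by blast
  define Z where "Z = {z::'a. algebraic_int z \<and> (\<forall>\<sigma>. embedding \<sigma> \<longrightarrow> cmod (\<sigma> z) \<le> real D ^ k * R')}"
  have D0: "(of_nat D :: 'a) ^ k \<noteq> 0"
    using D by simp
  have "{x. integral_away_from D x \<and> (\<forall>v\<in>abs_vals_over D. v x \<le> R)} \<subseteq> (\<lambda>z. z / of_nat D ^ k) ` Z"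
  proof
    fix x assume "x \<in> {x. integral_away_from D x \<and> (\<forall>v\<in>abs_vals_over D. v x \<le> R)}"
    then have x: "integral_away_from D x" "\<And>v. v \<in> abs_vals_over D \<Longrightarrow> v x \<le> R'"
      by (auto simp: R'_def le_max_iff_disj)
    have "algebraic_int (of_nat D ^ k * x)"
    proof (rule clear_denominator_power[where D = D and R = R', OF x(1)])
      show "v x \<le> R'" if "v \<in> abs_vals_over D" for v
        using x(2) that by blast
    qed (rule k)
    moreover have "cmod (\<sigma> (of_nat D ^ k * x)) \<le> real D ^ k * R'" if "embedding \<sigma>" for \<sigma>
      unfolding cmod_embedding_of_nat_power[OF that]
      using x(2)[OF embedding_in_abs_vals_over[OF that]] by (intro mult_left_mono) auto
    ultimately have "of_nat D ^ k * x \<in> Z"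
      by (simp add: Z_def)
    then show "x \<in> (\<lambda>z. z / of_nat D ^ k) ` Z"
      using D0 by (intro image_eqI[of _ _ "of_nat D ^ k * x"]) auto
  qed
  moreover have "finite Z"
    unfolding Z_def by (rule finite_algebraic_ints_bounded_conjugates)
  ultimately show ?thesis
    using finite_subset by blast
qed

text \<open>
  A substitute for the product formula: an element cannot be very small at one of the absolute values without
  being large at another. Upper bounds are stated as powers of two so that an exponent proportional
  to \<open>t\<close> clears the denominators of \<open>u\<close>. The resulting algebraic integer divides an integer \<open>c\<close> that is at most
  exponential in \<open>t\<close>; at an embedding the product of its conjugates is bounded below by \<open>1\<close>, and at a
  prime it is at least as large as \<open>c\<close>.
\<close>

lemma integral_away_from_lower_bound:
  assumes D: "D > 0" and v: "v \<in> abs_vals_over D"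
  shows "\<exists>b>0. \<forall>t u. u \<noteq> 0 \<longrightarrow> integral_away_from D u \<longrightarrow> (\<forall>w\<in>abs_vals_over D. w u \<le> 2 ^ t) \<longrightarrow> v u \<ge> b ^ t"
proof -
  define n where "n = card qbasis"
  obtain E where E: "\<And>P :: 'a set. nonzero_prime_set P \<Longrightarrow> of_nat D \<in> P \<Longrightarrow>
      prime_of_number_field.val P (of_nat D) ^ E * 2 \<le> 1"
    using power_of_denominator[OF D zero_less_numeral] by blast
  define Q where "Q = real D ^ E * 2"
  have DE: "real D ^ E \<ge> 1"
    using D by (intro one_le_power) auto
  have Q: "Q \<ge> 1" "real D ^ E \<le> Q"
    using DE by (simp_all add: Q_def)
  have main: "algebraic_int (of_nat D ^ (E * t) * u) \<and>
      (\<forall>\<sigma>. embedding \<sigma> \<longrightarrow> cmod (\<sigma> (of_nat D ^ (E * t) * u)) \<le> Q ^ t)"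
    if u: "integral_away_from D u" "\<And>w. w \<in> abs_vals_over D \<Longrightarrow> w u \<le> 2 ^ t" for t u
  proof (intro conjI allI impI)
    show "algebraic_int (of_nat D ^ (E * t) * u)"
    proof (rule clear_denominator_power[where D = D and R = "2 ^ t", OF u(1)])
      show "w u \<le> 2 ^ t" if "w \<in> abs_vals_over D" for w
        using u(2) that by blast
      fix P :: "'a set" assume P: "nonzero_prime_set P" "of_nat D \<in> P"
      interpret prime_of_number_field K P
        using P(1) by (rule prime_of_number_fieldI)
      have "(val (of_nat D) ^ E * 2) ^ t \<le> 1"
        using E[OF P] by (intro power_le_one) auto
      then show "val (of_nat D) ^ (E * t) * 2 ^ t \<le> 1"
        by (simp add: power_mult power_mult_distrib)
    qed
    fix \<sigma> :: "'a \<Rightarrow> complex" assume \<sigma>: "embedding \<sigma>"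
    have "cmod (\<sigma> (of_nat D ^ (E * t) * u)) \<le> real D ^ (E * t) * 2 ^ t"
      unfolding cmod_embedding_of_nat_power[OF \<sigma>]
      using u(2)[OF embedding_in_abs_vals_over[OF \<sigma>]] by (intro mult_left_mono) auto
    also have "\<dots> = Q ^ t"
      by (simp add: Q_def power_mult power_mult_distrib)
    finally show "cmod (\<sigma> (of_nat D ^ (E * t) * u)) \<le> Q ^ t" .
  qed
  consider (arch) \<sigma> where "embedding \<sigma>" "v = (\<lambda>x. cmod (\<sigma> x))"
    | (prime) P where "nonzero_prime_set P" "of_nat D \<in> P" "v = prime_of_number_field.val P"
    using v unfolding abs_vals_over_def by blast
  then show ?thesis
  proof cases
    case arch
    define b where "b = 1 / (Q ^ n * Q)"
    have "b > 0"
      using Q by (simp add: b_def)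
    moreover have "v u \<ge> b ^ t" if u: "u \<noteq> 0" "integral_away_from D u" "\<forall>w\<in>abs_vals_over D. w u \<le> 2 ^ t" for t u
    proof -
      let ?z = "of_nat D ^ (E * t) * u"
      have z: "algebraic_int ?z" "?z \<noteq> 0" "Q ^ t \<ge> 1" "\<And>\<sigma>. embedding \<sigma> \<Longrightarrow> cmod (\<sigma> ?z) \<le> Q ^ t"
        using main[of u t] u D Q(1) by auto
      have "1 \<le> cmod (\<sigma> ?z) * (Q ^ t) ^ n"
        unfolding n_def
        by (rule algebraic_int_divides_integer_bounded(2)[OF z(1-3) _ arch(1)]) (use z(4) in blast)
      also have "cmod (\<sigma> ?z) = (real D ^ E) ^ t * cmod (\<sigma> u)"
        unfolding cmod_embedding_of_nat_power[OF arch(1)] by (simp add: power_mult)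
      also have "(real D ^ E) ^ t * cmod (\<sigma> u) * (Q ^ t) ^ n \<le> Q ^ t * cmod (\<sigma> u) * (Q ^ t) ^ n"
        using Q DE by (intro mult_right_mono power_mono) auto
      also have "\<dots> = v u * (Q ^ n * Q) ^ t"
        by (simp add: arch(2) power_mult_distrib power_mult[symmetric] mult_ac)
      finally have "1 \<le> v u * (Q ^ n * Q) ^ t" .
      moreover have "(Q ^ n * Q) ^ t > 0"
        using Q by simp
      ultimately show ?thesis
        unfolding b_def power_divide by (simp add: pos_divide_le_eq)
    qed
    ultimately show ?thesis
      by blast
  next
    case prime
    interpret prime_of_number_field K P
      using prime(1) by (rule prime_of_number_fieldI)
    obtain C where C: "C \<ge> 0" "\<And>M. M > 0 \<Longrightarrow> val (of_nat M) \<ge> real M powr (- C)"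
      using val_of_nat_lower by blast
    define b where "b = Q powr (- (C * real n))"
    have "b > 0"
      using Q by (simp add: b_def)
    moreover have "v u \<ge> b ^ t" if u: "u \<noteq> 0" "integral_away_from D u" "\<forall>w\<in>abs_vals_over D. w u \<le> 2 ^ t" for t u
    proof -
      let ?z = "of_nat D ^ (E * t) * u"
      have z: "algebraic_int ?z" "?z \<noteq> 0" "Q ^ t \<ge> 1" "\<And>\<sigma>. embedding \<sigma> \<Longrightarrow> cmod (\<sigma> ?z) \<le> Q ^ t"
        using main[of u t] u D Q(1) by auto
      have "\<exists>c::int. c \<noteq> 0 \<and> \<bar>c\<bar> \<le> (Q ^ t) ^ card qbasis \<and> algebraic_int (of_int c / ?z)"
        by (rule algebraic_int_divides_integer_bounded(1)[OF z(1-3)]) (use z(4) in blast)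
      then obtain c :: int where c: "c \<noteq> 0" "\<bar>c\<bar> \<le> (Q ^ t) ^ n" "algebraic_int (of_int c / ?z)"
        unfolding n_def by blast
      define M where "M = nat \<bar>c\<bar>"
      have M: "M > 0" "real M \<le> (Q ^ t) ^ n"
        using c(1,2) by (simp_all add: M_def)
      have "b ^ t = ((Q ^ t) ^ n) powr (- C)"
        using Q unfolding b_def
        by (simp add: powr_realpow[symmetric] powr_powr powr_power mult_ac)
      also have "\<dots> \<le> real M powr (- C)"
        using M C(1) by (intro powr_mono2') auto
      also have "\<dots> \<le> val (of_nat M)"
        by (rule C(2)[OF M(1)])
      also have "\<dots> = val (of_int c)"
        unfolding M_def by (rule val.of_int_abs[symmetric])
      also have "\<dots> = val (of_int c / ?z) * val ?z"
        using z(2) unfolding val.mult[symmetric] by simp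
      also have "\<dots> \<le> 1 * val ?z"
        using val_integer_le_1[OF c(3)] by (intro mult_right_mono) auto
      also have "\<dots> = val (of_nat D ^ (E * t)) * val u"
        by (simp add: val.mult)
      also have "\<dots> \<le> 1 * val u"
        by (intro mult_right_mono val_integer_le_1 algebraic_int_power) auto
      finally show ?thesis
        by (simp add: prime(3))
    qed
    ultimately show ?thesis
      by blast
  qed
qed

end

section \<open>Finiteness of the Zsigmondy set\<close>

lemma exponential_beats_linear:
  fixes c A B :: real
  assumes "c > 0"
  shows "\<exists>H. \<forall>h. c * 2 ^ h \<le> A * real h + B \<longrightarrow> h < H"
proof -
  have lim: "(\<lambda>h. real h * (1 / 2) ^ h) \<longlonglongrightarrow> 0" "(\<lambda>h. (1 / 2 :: real) ^ h) \<longlonglongrightarrow> 0"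
    using powser_times_n_limit_0[of "1 / 2 :: real"] LIMSEQ_power_zero[of "1 / 2 :: real"] by simp_all
  have "(\<lambda>h. A * (real h * (1 / 2) ^ h) + B * (1 / 2) ^ h) \<longlonglongrightarrow> A * 0 + B * 0"
    by (intro tendsto_add tendsto_mult tendsto_const lim)
  then have "\<forall>\<^sub>F h in sequentially. A * (real h * (1 / 2) ^ h) + B * (1 / 2) ^ h < c"
    using assms by (intro order_tendstoD(2)) auto
  then obtain H where H: "\<And>h. h \<ge> H \<Longrightarrow> A * (real h * (1 / 2) ^ h) + B * (1 / 2) ^ h < c"
    unfolding eventually_sequentially by blast
  have "h < H" if h: "c * 2 ^ h \<le> A * real h + B" for h
  proof (rule ccontr)
    assume "\<not> h < H"
    then have "A * (real h * (1 / 2) ^ h) + B * (1 / 2) ^ h < c"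
      by (intro H) simp
    then have "(A * (real h * (1 / 2) ^ h) + B * (1 / 2) ^ h) * 2 ^ h < c * 2 ^ h"
      by (intro mult_strict_right_mono) auto
    moreover have "(A * (real h * (1 / 2) ^ h) + B * (1 / 2) ^ h) * 2 ^ h = A * real h + B"
      by (simp add: distrib_right power_divide)
    ultimately show False
      using h by linarith
  qed
  then show ?thesis
    by blast
qed

context number_field_type
begin

text \<open>
  Otherwise the orbit would be bounded at all absolute values over \<open>D\<close>, and so it would be finite.
\<close>

lemma exists_escaping_abs_val:
  fixes \<phi> :: "'a poly"
  assumes D: "D > 0" and deg: "degree \<phi> \<ge> 2" and "wandering \<phi> 0"
    and int: "\<And>n. integral_away_from D (orb \<phi> n)"
  shows "\<exists>v\<in>abs_vals_over D. \<exists>c>0. \<exists>N. \<forall>n\<ge>N. v (orb \<phi> n) \<ge> exp (c * real (degree \<phi>) ^ n)"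
proof (rule ccontr)
  assume contra: "\<not> ?thesis"
  have "\<exists>R. \<forall>n. v (orb \<phi> n) \<le> R" if v: "v \<in> abs_vals_over D" for v
  proof -
    interpret abs_val v
      by (rule abs_vals_over_abs_val[OF v])
    show ?thesis
      using orbit_bounded_or_escapes[OF deg] contra v by blast
  qed
  then obtain R where R: "\<And>v n. v \<in> abs_vals_over D \<Longrightarrow> v (orb \<phi> n) \<le> R v"
    by metis
  define R' where "R' = (\<Sum>v\<in>abs_vals_over D. \<bar>R v\<bar>)"
  have R': "v (orb \<phi> n) \<le> R'" if v: "v \<in> abs_vals_over D" for v n
  proof -
    have "\<bar>R v\<bar> \<le> R'"
      unfolding R'_def using finite_abs_vals_over[OF D] v by (intro member_le_sum) auto
    then show ?thesis
      using R[OF v, of n] by linarith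
  qed
  have "range (orb \<phi>) \<subseteq> {x. integral_away_from D x \<and> (\<forall>v\<in>abs_vals_over D. v x \<le> R')}"
    using int R' by blast
  then have "finite (range (orb \<phi>))"
    using finite_subset finite_bounded_integral_away_from[OF D, of R'] by blast
  then show False
    using assms(3) by (simp add: wandering_def)
qed

lemma uniform_upper_bound:
  fixes \<phi> :: "'a poly"
  assumes D: "D > 0" and deg: "degree \<phi> \<ge> 2"
  shows "\<exists>C\<ge>0. \<forall>v\<in>abs_vals_over D. \<forall>n. v (orb \<phi> n) \<le> exp (C * real (degree \<phi>) ^ n)"
proof -
  have "\<exists>C\<ge>0. \<forall>n. v (orb \<phi> n) \<le> exp (C * real (degree \<phi>) ^ n)" if "v \<in> abs_vals_over D" for v
    using abs_val.orbit_upper_bound[OF abs_vals_over_abs_val[OF that] deg] .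
  then obtain C where C: "\<And>v. v \<in> abs_vals_over D \<Longrightarrow> C v \<ge> 0"
      "\<And>v n. v \<in> abs_vals_over D \<Longrightarrow> v (orb \<phi> n) \<le> exp (C v * real (degree \<phi>) ^ n)"
    by metis
  define C' where "C' = (\<Sum>v\<in>abs_vals_over D. C v)"
  have "v (orb \<phi> n) \<le> exp (C' * real (degree \<phi>) ^ n)" if v: "v \<in> abs_vals_over D" for v n
  proof -
    have "C v \<le> C'"
      unfolding C'_def using finite_abs_vals_over[OF D] v C(1) by (intro member_le_sum) auto
    then have "C v * real (degree \<phi>) ^ n \<le> C' * real (degree \<phi>) ^ n"
      by (intro mult_right_mono) auto
    then show ?thesis
      using C(2)[OF v, of n] by (meson exp_le_cancel_iff order_trans)
  qed
  moreover have "C' \<ge> 0"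
    unfolding C'_def using C(1) by (intro sum_nonneg)
  ultimately show ?thesis
    by blast
qed

lemma uniform_lower_bound:
  fixes \<phi> :: "'a poly"
  assumes D: "D > 0" and deg: "degree \<phi> \<ge> 2" and H: "pderiv \<phi> ^ 2 = \<phi> * H"
    and nz: "\<And>n. n \<ge> 1 \<Longrightarrow> orb \<phi> n \<noteq> 0"
  shows "\<exists>L\<ge>0. \<forall>v\<in>abs_vals_over D. \<forall>n\<ge>1. v (orb \<phi> n) \<ge> exp (- L * real n)"
proof -
  have "\<exists>c>0. \<forall>n\<ge>1. v (orb \<phi> n) \<ge> c ^ n" if "v \<in> abs_vals_over D" for v
    using abs_val.orbit_lower_bound[OF abs_vals_over_abs_val[OF that] deg H nz] .
  then obtain c where c: "\<And>v. v \<in> abs_vals_over D \<Longrightarrow> c v > 0"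
      "\<And>v n. v \<in> abs_vals_over D \<Longrightarrow> n \<ge> 1 \<Longrightarrow> v (orb \<phi> n) \<ge> c v ^ n"
    by metis
  define L where "L = (\<Sum>v\<in>abs_vals_over D. \<bar>ln (c v)\<bar>)"
  have "v (orb \<phi> n) \<ge> exp (- L * real n)" if v: "v \<in> abs_vals_over D" and n: "n \<ge> 1" for v n
  proof -
    have "\<bar>ln (c v)\<bar> \<le> L"
      unfolding L_def using finite_abs_vals_over[OF D] v by (intro member_le_sum) auto
    then have "real n * - L \<le> real n * ln (c v)"
      by (intro mult_left_mono) auto
    then have "exp (- L * real n) \<le> exp (real n * ln (c v))"
      by (simp add: mult.commute)
    also have "\<dots> = c v ^ n"
      using c(1)[OF v] by (simp add: exp_of_nat_mult)
    finally show ?thesis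
      using c(2)[OF v n] by linarith
  qed
  moreover have "L \<ge> 0"
    unfolding L_def by (intro sum_nonneg) auto
  ultimately show ?thesis
    by blast
qed

lemma orb_integral_away_from:
  fixes \<phi> :: "'a poly"
  assumes "\<And>i. algebraic_int (of_nat D * coeff \<phi> i)"
  shows "integral_away_from D (orb \<phi> n)"
  unfolding integral_away_from_def
proof (intro allI impI)
  fix P :: "'a set" assume P: "nonzero_prime_set P" "of_nat D \<notin> P"
  interpret prime_of_number_field K P
    using P(1) by (rule prime_of_number_fieldI)
  have "val (coeff \<phi> i) \<le> 1" for i
    unfolding val_le_1_iff local_integral_def using assms[of i] P(2) by (intro exI[of _ "of_nat D"]) simp
  then have "val (orb \<phi> n) \<le> 1"
    by (intro val.iter_le_1) auto
  then show "\<exists>s. algebraic_int s \<and> s \<notin> P \<and> algebraic_int (s * orb \<phi> n)"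
    unfolding val_le_1_iff local_integral_def .
qed

text \<open>
  If a prime \<open>P\<close> away from \<open>D\<close> divides the \<open>n\<close>-th term, it divides an earlier one with index \<open>i\<close>, and hence the one
  with index \<open>gcd i n\<close>. This is a proper divisor of \<open>n\<close>, so it is at most \<open>n div 2\<close> and occurs in the
  product; and by rigidity the order of its term at \<open>P\<close> is that of the \<open>n\<close>-th term.
\<close>

lemma non_primitive_term_divides:
  fixes \<phi> :: "'a poly"
  assumes coeffs: "\<And>i. algebraic_int (of_nat D * coeff \<phi> i)" "\<And>i. algebraic_int (of_nat D * coeff H i)"
    and H: "pderiv \<phi> ^ 2 = \<phi> * H"
    and nz: "\<And>n. n \<ge> 1 \<Longrightarrow> orb \<phi> n \<noteq> 0"
    and q: "\<And>n. n \<ge> 1 \<Longrightarrow> ideal_quotient (orb \<phi> n) (A n) (B n)"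
    and n: "n \<in> zsigmondy_set A"
  shows "integral_away_from D ((\<Prod>j\<in>{1..n div 2}. orb \<phi> j) / orb \<phi> n)"
  unfolding integral_away_from_def
proof (intro allI impI)
  fix P :: "'a set" assume P: "nonzero_prime_set P" "of_nat D \<notin> P"
  interpret prime_of_number_field K P
    using P(1) by (rule prime_of_number_fieldI)
  have coeff_val: "val (coeff \<phi> i) \<le> 1" "val (coeff H i) \<le> 1" for i
    unfolding val_le_1_iff local_integral_def using coeffs[of i] P(2) by (auto intro!: exI[of _ "of_nat D"])
  have n1: "n \<ge> 1"
    using n by (simp add: zsigmondy_set_def)
  have div: "ideal_divides P (A m) \<longleftrightarrow> val (orb \<phi> m) < 1" if "m \<ge> 1" for m
    using divides_numerator_iff[OF q[OF that] nz[OF that]] .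
  have le1: "val (orb \<phi> m) \<le> 1" for m
    using coeff_val(1) by (intro val.iter_le_1) auto
  have prod_le1: "(\<Prod>j\<in>J. val (orb \<phi> j)) \<le> 1" for J :: "nat set"
    using le1 by (intro prod_le_1) auto
  have "val ((\<Prod>j\<in>{1..n div 2}. orb \<phi> j) / orb \<phi> n) \<le> 1"
  proof (cases "val (orb \<phi> n) < 1")
    case False
    then have "val (orb \<phi> n) = 1"
      using le1[of n] by linarith
    then show ?thesis
      using prod_le1 by (simp add: val.divide val.prod)
  next
    case True
    have "\<not> primitive_divisor A n P"
      using n unfolding zsigmondy_set_def by blast
    then obtain i where i: "1 \<le> i" "i < n" "val (orb \<phi> i) < 1"
      unfolding primitive_divisor_def nonzero_prime_ideal_iff using P(1) div[OF n1] True div by blast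
    define g where "g = gcd i n"
    have g: "g \<ge> 1" "g dvd n" "g \<le> i"
      using i(1) n1 by (auto simp: g_def Suc_le_eq gcd_le1_nat)
    obtain k where k: "n = g * k"
      using g(2) by blast
    have "k \<noteq> 0" "k \<noteq> 1"
      using k n1 g(3) i(2) by auto
    then have "g * 2 \<le> n"
      unfolding k by (intro mult_left_mono) auto
    then have g2: "g \<in> {1..n div 2}"
      using g(1) by auto
    have "val (orb \<phi> g) < 1"
      unfolding g_def using val.orb_less_1_gcd[OF coeff_val(1) i(3) True] .
    then have "val (orb \<phi> (k * g)) = val (orb \<phi> g)"
      using val.orb_rigid[OF coeff_val(1) H coeff_val(2) nz[OF g(1)]] \<open>k \<noteq> 0\<close> by simp
    then have eq: "val (orb \<phi> n) = val (orb \<phi> g)"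
      unfolding k by (simp add: mult.commute)
    have "val (\<Prod>j\<in>{1..n div 2}. orb \<phi> j) = val (orb \<phi> g) * (\<Prod>j\<in>{1..n div 2} - {g}. val (orb \<phi> j))"
      unfolding val.prod using g2 by (intro prod.remove) auto
    also have "\<dots> \<le> val (orb \<phi> g) * 1"
      by (intro mult_left_mono prod_le1) auto
    finally have "val (\<Prod>j\<in>{1..n div 2}. orb \<phi> j) \<le> val (orb \<phi> n)"
      unfolding eq by simp
    moreover have "val (orb \<phi> n) > 0"
      using nz[OF n1] by simp
    ultimately show ?thesis
      unfolding val.divide using divide_le_eq_1_pos by blast
  qed
  then show "\<exists>s. algebraic_int s \<and> s \<notin> P \<and> algebraic_int (s * ((\<Prod>j\<in>{1..n div 2}. orb \<phi> j) / orb \<phi> n))"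
    unfolding val_le_1_iff local_integral_def .
qed

text \<open>
  With \<open>h = n div 2\<close>, every absolute value over \<open>D\<close> of the quotient \<open>u\<close> is at most the exponential of
  \<open>e + L * n\<close>, where \<open>e = C * h * d ^ h\<close>. One of them is at most \<open>exp (e - c * d ^ n)\<close>, and comparison with
  the lower bound gives an inequality of the form \<open>c * d ^ n \<le> A1 * (h + 1) * d ^ h\<close>. As \<open>n \<ge> 2 * h\<close>, one factor
  \<open>d ^ h\<close> cancels, and \<open>h\<close> is bounded.
\<close>

lemma finite_zsigmondy_set_numerators:
  fixes \<phi> :: "'a poly"
  assumes deg: "degree \<phi> \<ge> 2" and wand: "wandering \<phi> 0" and H: "pderiv \<phi> ^ 2 = \<phi> * H"
    and q: "\<And>n. n \<ge> 1 \<Longrightarrow> ideal_quotient (orb \<phi> n) (A n) (B n)"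
  shows "finite (zsigmondy_set A)"
proof -
  define d where "d = real (degree \<phi>)"
  have d: "d \<ge> 2"
    using deg by (simp add: d_def)
  note nz = wandering_zero_orb_nonzero[OF wand]
  obtain D where D: "D > 0" "\<And>x. x \<in> range (coeff \<phi>) \<union> range (coeff H) \<Longrightarrow> algebraic_int (of_nat D * x)"
    using poly_denominator by metis
  have coeffs: "algebraic_int (of_nat D * coeff \<phi> i)" "algebraic_int (of_nat D * coeff H i)" for i
    by (intro D(2); simp)+
  obtain v c N where v: "v \<in> abs_vals_over D" "c > 0" "\<And>n. n \<ge> N \<Longrightarrow> v (orb \<phi> n) \<ge> exp (c * d ^ n)"
    using exists_escaping_abs_val[OF D(1) deg wand orb_integral_away_from[OF coeffs(1)]]
    unfolding d_def by blast
  obtain C where C: "C \<ge> 0" "\<And>w n. w \<in> abs_vals_over D \<Longrightarrow> w (orb \<phi> n) \<le> exp (C * d ^ n)"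
    using uniform_upper_bound[OF D(1) deg] unfolding d_def by blast
  obtain L where L: "L \<ge> 0" "\<And>w n. w \<in> abs_vals_over D \<Longrightarrow> n \<ge> 1 \<Longrightarrow> w (orb \<phi> n) \<ge> exp (- L * real n)"
    using uniform_lower_bound[OF D(1) deg H nz] by blast
  obtain b where b: "b > 0" "\<And>t u. u \<noteq> 0 \<Longrightarrow> integral_away_from D u \<Longrightarrow>
      (\<forall>w\<in>abs_vals_over D. w u \<le> 2 ^ t) \<Longrightarrow> v u \<ge> b ^ t"
    using integral_away_from_lower_bound[OF D(1) v(1)] by blast
  define \<beta> where "\<beta> = \<bar>ln b\<bar>"
  define A1 where "A1 = C + \<beta> * (2 * C + 4 * L + 2)"
  obtain H0 where H0: "\<And>h. c * 2 ^ h \<le> A1 * real h + A1 \<Longrightarrow> h < H0"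
    using exponential_beats_linear[OF v(2)] by blast
  have bound: "n < max N (2 * H0 + 2)" if n: "n \<in> zsigmondy_set A" for n
  proof (rule ccontr)
    assume "\<not> n < max N (2 * H0 + 2)"
    then have nN: "n \<ge> N" "n \<ge> 2 * H0 + 2"
      by auto
    then have n1: "n \<ge> 1"
      by linarith
    define h where "h = n div 2"
    define u where "u = (\<Prod>j\<in>{1..h}. orb \<phi> j) / orb \<phi> n"
    have h: "2 * h \<le> n" "n \<le> 2 * h + 1" "H0 \<le> h"
      using nN by (auto simp: h_def)
    have u0: "u \<noteq> 0"
      unfolding u_def using nz n1 by (auto simp: Suc_le_eq)
    have ui: "integral_away_from D u"
      unfolding u_def h_def by (rule non_primitive_term_divides[OF coeffs H nz q n])
    have dh: "d ^ h \<ge> 1"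
      using d by (intro one_le_power) auto
    define e where "e = C * real h * d ^ h"
    have e0: "e \<ge> 0"
      unfolding e_def using C(1) dh by (intro mult_nonneg_nonneg) auto
    have prod_le: "w (\<Prod>j\<in>{1..h}. orb \<phi> j) \<le> exp e" if w: "w \<in> abs_vals_over D" for w
    proof -
      interpret w: abs_val w
        by (rule abs_vals_over_abs_val[OF w])
      have "w (\<Prod>j\<in>{1..h}. orb \<phi> j) \<le> (\<Prod>j\<in>{1..h}. exp (C * d ^ h))"
        unfolding w.prod
      proof (intro prod_mono conjI)
        fix j assume j: "j \<in> {1..h}"
        have "C * d ^ j \<le> C * d ^ h"
          using j d C(1) by (intro mult_left_mono power_increasing) auto
        then show "w (orb \<phi> j) \<le> exp (C * d ^ h)"
          using C(2)[OF w, of j] by (meson exp_le_cancel_iff order_trans)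
      qed simp
      also have "\<dots> = exp (C * d ^ h) ^ h"
        by simp
      also have "\<dots> = exp (real h * (C * d ^ h))"
        by (rule exp_of_nat_mult[symmetric])
      also have "real h * (C * d ^ h) = e"
        by (simp add: e_def)
      finally show ?thesis .
    qed
    define t where "t = nat \<lceil>(e + L * real n) / ln 2\<rceil>"
    have ln2: "ln (2::real) > 0" "ln (2::real) \<ge> 1 / 2"
      using ln_ge_iff[of 2 "1 / 2"] exp_half_le2 by auto
    have t_lower: "e + L * real n \<le> real t * ln 2"
    proof -
      have "(e + L * real n) / ln 2 \<le> real t"
        unfolding t_def by (rule real_nat_ceiling_ge)
      then show ?thesis
        using ln2(1) by (simp add: pos_divide_le_eq)
    qed
    have t_upper: "real t \<le> 2 * (e + L * real n) + 1"
    proof -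
      have nn: "(e + L * real n) / ln 2 \<ge> 0"
        using e0 L(1) ln2(1) by (intro divide_nonneg_pos add_nonneg_nonneg mult_nonneg_nonneg) auto
      then have "real t \<le> (e + L * real n) / ln 2 + 1"
        unfolding t_def by linarith
      also have "(e + L * real n) / ln 2 \<le> (e + L * real n) / (1 / 2)"
        using e0 L(1) ln2 by (intro divide_left_mono) auto
      finally show ?thesis
        by simp
    qed
    have "\<forall>w\<in>abs_vals_over D. w u \<le> 2 ^ t"
    proof
      fix w assume w: "w \<in> abs_vals_over D"
      interpret w: abs_val w
        by (rule abs_vals_over_abs_val[OF w])
      have "w u \<le> exp e / exp (- L * real n)"
        unfolding u_def w.divide using prod_le[OF w] L(2)[OF w n1] by (intro frac_le) auto
      also have "\<dots> = exp (e + L * real n)"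
        by (simp add: exp_diff[symmetric])
      also have "\<dots> \<le> exp (real t * ln 2)"
        using t_lower by simp
      also have "\<dots> = 2 ^ t"
        by (simp add: exp_of_nat_mult)
      finally show "w u \<le> 2 ^ t" .
    qed
    then have "b ^ t \<le> v u"
      by (rule b(2)[OF u0 ui])
    moreover have "v u \<le> exp e / exp (c * d ^ n)"
    proof -
      interpret v: abs_val v
        by (rule abs_vals_over_abs_val[OF v(1)])
      show ?thesis
        unfolding u_def v.divide using prod_le[OF v(1)] v(3)[OF nN(1)] by (intro frac_le) auto
    qed
    moreover have "exp (- \<beta> * real t) \<le> b ^ t"
    proof -
      have "real t * - \<beta> \<le> real t * ln b"
        by (intro mult_left_mono) (auto simp: \<beta>_def)
      then have "exp (- \<beta> * real t) \<le> exp (real t * ln b)"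
        by (simp add: mult.commute)
      also have "\<dots> = b ^ t"
        using b(1) by (simp add: exp_of_nat_mult)
      finally show ?thesis .
    qed
    ultimately have "exp (- \<beta> * real t) \<le> exp (e - c * d ^ n)"
      by (simp add: exp_diff)
    then have "c * d ^ n \<le> e + \<beta> * real t"
      by simp
    also have "\<beta> * real t \<le> \<beta> * (2 * (e + L * real n) + 1)"
      using t_upper by (intro mult_left_mono) (auto simp: \<beta>_def)
    finally have 1: "c * d ^ n \<le> e + \<beta> * (2 * (e + L * real n) + 1)"
      by simp
    \<comment> \<open>a common bound for the terms in \<open>h * d ^ h\<close>, in \<open>n\<close>, and the constants\<close>
    define y where "y = (real h + 1) * d ^ h"
    have y: "real h * d ^ h \<le> y" "real n \<le> 2 * y" "1 \<le> y"
    proof -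
      show "real h * d ^ h \<le> y"
        unfolding y_def using dh by (intro mult_right_mono) auto
      have "(real h + 1) * 1 \<le> y"
        unfolding y_def using dh by (intro mult_left_mono) auto
      then have hy: "real h + 1 \<le> y"
        by simp
      have "real n \<le> 2 * real h + 1"
        using h(2) by linarith
      then show "real n \<le> 2 * y"
        using hy by linarith
      show "1 \<le> y"
        using hy by linarith
    qed
    have "e \<le> C * y"
      unfolding e_def mult.assoc using y(1) C(1) by (intro mult_left_mono) auto
    moreover have "L * real n \<le> L * (2 * y)"
      using y(2) L(1) by (intro mult_left_mono) auto
    ultimately have "2 * (e + L * real n) + 1 \<le> (2 * C + 4 * L + 2) * y"
      using y(3) by (simp add: distrib_right)
    then have "\<beta> * (2 * (e + L * real n) + 1) \<le> \<beta> * ((2 * C + 4 * L + 2) * y)"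
      by (intro mult_left_mono) (auto simp: \<beta>_def)
    then have "c * d ^ n \<le> C * y + \<beta> * ((2 * C + 4 * L + 2) * y)"
      using 1 \<open>e \<le> C * y\<close> by linarith
    also have "\<dots> = A1 * y"
      by (simp only: A1_def distrib_right mult.assoc)
    finally have 2: "c * d ^ n \<le> A1 * y" .
    have "d ^ h * d ^ h \<le> d ^ n"
      using h(1) d by (simp add: power_add[symmetric] power_increasing)
    then have "c * (d ^ h * d ^ h) \<le> c * d ^ n"
      using v(2) by (intro mult_left_mono) auto
    then have "c * (d ^ h * d ^ h) \<le> A1 * y"
      using 2 by linarith
    then have "(c * d ^ h) * d ^ h \<le> (A1 * (real h + 1)) * d ^ h"
      by (simp add: y_def mult.assoc)
    then have "c * d ^ h \<le> A1 * (real h + 1)"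
      by (rule mult_right_le_imp_le) (use dh in linarith)
    moreover have "c * 2 ^ h \<le> c * d ^ h"
      using d v(2) by (intro mult_left_mono power_mono) auto
    ultimately have "c * 2 ^ h \<le> A1 * real h + A1"
      by (simp add: distrib_left)
    then have "h < H0"
      by (rule H0)
    then show False
      using h(3) by simp
  qed
  have "zsigmondy_set A \<subseteq> {..<max N (2 * H0 + 2)}"
    using bound by blast
  then show ?thesis
    using finite_subset by blast
qed

text \<open>
  The exceptional places are the archimedean ones and those of the primes that contain a common denominator of \<open>\<phi>\<close>
  and \<open>H\<close>.
\<close>

lemma exists_rigid_places:
  fixes \<phi> :: "'a poly"
  assumes H: "pderiv \<phi> ^ 2 = \<phi> * H" and nz: "\<And>n. n \<ge> 1 \<Longrightarrow> orb \<phi> n \<noteq> 0"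
    and q: "\<And>n. n \<ge> 1 \<Longrightarrow> ideal_quotient (orb \<phi> n) (A n) (B n)"
  shows "\<exists>S. rigid_divisibility_sequence S A"
proof -
  obtain D where D: "D > 0" "\<And>x. x \<in> range (coeff \<phi>) \<union> range (coeff H) \<Longrightarrow> algebraic_int (of_nat D * x)"
    using poly_denominator by metis
  define S where "S = arch_places \<union> prime_of_number_field.place ` {P :: 'a set. nonzero_prime_set P \<and> of_nat D \<in> P}"
  have "rigid_divisibility_sequence S A"
  proof (rule rigid_divisibility_sequence_numerators[OF _ _ _ _ H nz q])
    show "finite S"
      unfolding S_def using finite_arch_places finite_primes_containing[OF D(1)] by blast
    show "S \<subseteq> places"
    proof
      fix \<pi> assume "\<pi> \<in> S"
      then consider "\<pi> \<in> arch_places" | P where "nonzero_prime_set P" "\<pi> = prime_of_number_field.place P"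
        unfolding S_def by blast
      then show "\<pi> \<in> places"
      proof cases
        case 1
        then show ?thesis
          by (simp add: arch_places_def)
      next
        case 2
        then show ?thesis
          using prime_of_number_field.place_in_places[OF prime_of_number_fieldI] by blast
      qed
    qed
    show "arch_places \<subseteq> S"
      by (simp add: S_def)
    fix P :: "'a set" and x :: 'a assume P: "nonzero_prime_set P" "\<not> prime_in_places P S"
      and x: "x \<in> range (coeff \<phi>) \<union> range (coeff H)"
    have "of_nat D \<notin> P"
    proof
      assume "of_nat D \<in> P"
      then have "prime_of_number_field.place P \<in> S"
        unfolding S_def using P(1) by blast
      then show False
        using prime_of_number_field.prime_in_places_place[OF prime_of_number_fieldI[OF P(1)]] P(2) by blast
    qed
    then show "\<exists>s. algebraic_int s \<and> s \<notin> P \<and> algebraic_int (s * x)"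
      using D(2)[OF x] by (intro exI[of _ "of_nat D"]) simp
  qed
  then show ?thesis
    by blast
qed

lemma rigid_at_arch_places:
  fixes \<phi> :: "'a poly" and f :: "nat \<Rightarrow> 'a poly" and m :: nat
  assumes \<phi>: "\<phi> = (\<Prod>i=1..m. f i ^ e i)"
    and f: "\<And>i j. i \<in> {1..m} \<Longrightarrow> algebraic_int (coeff (f i) j)" "\<And>i. i \<in> {1..m} \<Longrightarrow> e i \<ge> 2"
    and nz: "\<And>n. n \<ge> 1 \<Longrightarrow> orb \<phi> n \<noteq> 0"
    and q: "\<And>n. n \<ge> 1 \<Longrightarrow> ideal_quotient (orb \<phi> n) (A n) (B n)"
  shows "rigid_divisibility_sequence arch_places A"
proof -
  have "(\<forall>j. coeff \<phi> j \<in> {x. algebraic_int x}) \<and>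
      (\<exists>H. pderiv \<phi> ^ 2 = \<phi> * H \<and> (\<forall>j. coeff H j \<in> {x. algebraic_int x}))"
    unfolding \<phi> using f by (intro prod_of_powers_pderiv_square) auto
  then obtain H where H: "pderiv \<phi> ^ 2 = \<phi> * H" "\<And>j. algebraic_int (coeff H j)" "\<And>j. algebraic_int (coeff \<phi> j)"
    by blast
  show ?thesis
  proof (rule rigid_divisibility_sequence_numerators[OF finite_arch_places _ _ _ H(1) nz q])
    show "arch_places \<subseteq> (places :: ('a \<Rightarrow> real) set set)"
      by (auto simp: arch_places_def)
    fix P :: "'a set" and x :: 'a assume P: "nonzero_prime_set P" and x: "x \<in> range (coeff \<phi>) \<union> range (coeff H)"
    have "1 \<notin> P"
      using P by (simp add: nonzero_prime_set_def)
    moreover have "algebraic_int x"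
      using x H(2,3) by auto
    ultimately show "\<exists>s. algebraic_int s \<and> s \<notin> P \<and> algebraic_int (s * x)"
      by (intro exI[of _ 1]) simp
  qed simp
qed

end

theorem theorem1p5:
  fixes \<phi> :: "'a::field_char_0 poly"
    and \<AA> \<BB> :: "nat \<Rightarrow> 'a set"
  assumes "number_field TYPE('a)"
    and "powerful \<phi>"
    and "degree \<phi> \<ge> 3"
    and "wandering \<phi> 0"
    and "\<And>n. n \<ge> 1 \<Longrightarrow> ideal_quotient ((poly \<phi> ^^ n) 0) (\<AA> n) (\<BB> n)"
  shows "(\<exists>S. rigid_divisibility_sequence S \<AA>) \<and>
    finite (zsigmondy_set \<AA>) \<and>
    (\<forall>(m::nat) (f :: nat \<Rightarrow> 'a poly) (e :: nat \<Rightarrow> nat).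
       \<phi> = (\<Prod>i=1..m. f i ^ e i) \<and>
       (\<forall>i\<in>{1..m}. (\<forall>j. coeff (f i) j \<in> carrier OK) \<and> degree (f i) \<ge> 1 \<and> e i \<ge> 2)
       \<longrightarrow> rigid_divisibility_sequence arch_places \<AA>)"
proof -
  interpret number_field_type "TYPE('a)"
    by unfold_locales (rule assms(1))
  have "\<exists>H. pderiv \<phi> ^ 2 = \<phi> * H"
  proof (rule dvd_pderiv_square)
    show "\<phi> \<noteq> 0"
      using assms(3) by auto
    show "p ^ 2 dvd \<phi>" if "Factorial_Ring.irreducible p" "p dvd \<phi>" for p
      using assms(2) that unfolding powerful_def by blast
  qed
  then obtain H where H: "pderiv \<phi> ^ 2 = \<phi> * H"
    by (elim exE)
  have deg: "degree \<phi> \<ge> 2"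
    using assms(3) by simp
  note nz = wandering_zero_orb_nonzero[OF assms(4)]
  show ?thesis
  proof (intro conjI allI impI)
    show "\<exists>S. rigid_divisibility_sequence S \<AA>"
      by (rule exists_rigid_places[OF H nz assms(5)])
    show "finite (zsigmondy_set \<AA>)"
      by (rule finite_zsigmondy_set_numerators[OF deg assms(4) H assms(5)])
    fix m :: nat and f :: "nat \<Rightarrow> 'a poly" and e :: "nat \<Rightarrow> nat"
    assume *: "\<phi> = (\<Prod>i=1..m. f i ^ e i) \<and>
       (\<forall>i\<in>{1..m}. (\<forall>j. coeff (f i) j \<in> carrier OK) \<and> degree (f i) \<ge> 1 \<and> e i \<ge> 2)"
    then have \<phi>: "\<phi> = (\<Prod>i=1..m. f i ^ e i)"
      by blast
    show "rigid_divisibility_sequence arch_places \<AA>"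
    proof (rule rigid_at_arch_places[OF \<phi> _ _ nz assms(5)])
      show "algebraic_int (coeff (f i) j)" if "i \<in> {1..m}" for i j
        using * that by simp
      show "e i \<ge> 2" if "i \<in> {1..m}" for i
        using * that by blast
    qed
  qed
qed

end
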